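(* Let $\mathcal H$ be a nonzero separable complex Hilbert space and let $\boldsymbol T=(T_1,T_2)$ be a left-inverse commuting pair of bounded linear operators on $\mathcal H$. Assume that $\boldsymbol T$ is a cyclic analytic toral $2$-isometry. Then there exist finite positive Borel measures $\mu_1,\mu_2$ on the unit circle $\mathbb T$ such that $\boldsymbol T$ is unitarily equivalent to the pair $(M_{z_1},M_{z_2})$ of multiplication operators by the coordinate functions on $\mathcal D(\mu_1,\mu_2)$; that is, there is a unitary $U:\mathcal H\to\mathcal D(\mu_1,\mu_2)$ with $UT_i=M_{z_i}U$ for $i=1,2$.
   Context: A pair $(T_1,T_2)$ of left invertible commuting operators is left-inverse commuting if $L_1T_2=T_2L_1$ and $L_2T_1=T_1L_2$, where $L_i=(T_i^*T_i)^{-1}T_i^*$. A commuting pair $(T_1,T_2)$ is a toral $2$-isometry if $I-T_i^*T_i-T_j^*T_j+T_j^*T_i^*T_iT_j=0$ for all $i,j\in\{1,2\}$ (including $i=j$). It is analytic if each $T_i$ is analytic, i.e. $\bigcap_{m\ge1}T_i^m\mathcal H=\{0\}$. It is cyclic if there is $x\in\mathcal H$ such that the closed linear span of $\{T_1^mT_2^nx:m,n\ge0\}$ is $\mathcal H$. Dirichlet-type space: for a finite positive Borel measure $\mu$ on $\mathbb T$, let $P_\mu(z)=\int_{\mathbb T}\frac{1-|z|^2}{|\zeta-z|^2}\,d\mu(\zeta)$, $z\in\mathbb D$. Let $dA$ be normalized area measure on the open unit disc $\mathbb D$ and $dt$ normalized arc-length measure on $\mathbb T$. For $f$ holomorphic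 on $\mathbb D^2$ put $$D_{\mu_1,\mu_2}(f)=\lim_{r\to1^-}\int_{\mathbb D}\int_{\mathbb T}P_{\mu_1}(z_1)|\partial_1f(z_1,re^{it})|^2\,dt\,dA(z_1)+\lim_{r\to1^-}\int_{\mathbb D}\int_{\mathbb T}P_{\mu_2}(z_2)|\partial_2f(re^{it},z_2)|^2\,dt\,dA(z_2).$$ $\mathcal D(\mu_1,\mu_2)$ is the Hilbert space of all $f$ in the Hardy space $H^2(\mathbb D^2)$ with $D_{\mu_1,\mu_2}(f)<\infty$, with norm $\|f\|^2=\|f\|^2_{H^2(\mathbb D^2)}+D_{\mu_1,\mu_2}(f)$. On it $M_{z_1},M_{z_2}$ are bounded operators. *)

theory Defs
  imports "HOL-Analysis.Analysis"
begin

section \<open>Complex Hilbert spaces\<close>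

text \<open>
  A complex inner product space is a real inner product space (which supplies norm and topology)
  with a compatible complex scalar multiplication and a sesquilinear form, linear in the first
  argument, whose real part is the real inner product. Hence \<open>cinner x x = of_real ((norm x)\<^sup>2)\<close>.
\<close>

class complex_inner = real_inner +
  fixes scaleC :: "complex \<Rightarrow> 'a \<Rightarrow> 'a"  (infixr \<open>*\<^sub>C\<close> 75)
    and cinner :: "'a \<Rightarrow> 'a \<Rightarrow> complex"
  assumes scaleC_add_right: "c *\<^sub>C (x + y) = c *\<^sub>C x + c *\<^sub>C y"
    and scaleC_add_left: "(c + d) *\<^sub>C x = c *\<^sub>C x + d *\<^sub>C x"
    and scaleC_scaleC: "c *\<^sub>C d *\<^sub>C x = (c * d) *\<^sub>C x"
    and scaleR_scaleC: "r *\<^sub>R x = complex_of_real r *\<^sub>C x"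
    and cinner_commute: "cinner x y = cnj (cinner y x)"
    and cinner_add_left: "cinner (x + y) z = cinner x z + cinner y z"
    and cinner_scaleC_left: "cinner (c *\<^sub>C x) y = c * cinner x y"
    and inner_eq_Re_cinner: "inner x y = Re (cinner x y)"

class chilbert_space = complex_inner + complete_space

global_interpretation complex_vector: vector_space "scaleC :: complex \<Rightarrow> 'a \<Rightarrow> 'a::complex_inner"
  defines cspan = complex_vector.span
proof
  fix c d :: complex and x y :: 'a
  show "1 *\<^sub>C x = x"
    using scaleR_scaleC[of 1 x] by simp
qed (simp_all add: scaleC_add_right scaleC_add_left scaleC_scaleC)

definition bounded_clinear :: "('a::complex_inner \<Rightarrow> 'a) \<Rightarrow> bool" where
  "bounded_clinear T \<longleftrightarrow> bounded_linear T \<and> (\<forall>c x. T (c *\<^sub>C x) = c *\<^sub>C T x)"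

text \<open>The Hilbert space adjoint; it exists and is unique for bounded operators on a Hilbert space.\<close>

definition cadjoint :: "('a::chilbert_space \<Rightarrow> 'a) \<Rightarrow> 'a \<Rightarrow> 'a" where
  "cadjoint T = (THE S. \<forall>x y. cinner (T x) y = cinner x (S y))"

section \<open>Pairs of operators\<close>

definition left_invertible :: "('a::chilbert_space \<Rightarrow> 'a) \<Rightarrow> bool" where
  "left_invertible T \<longleftrightarrow> bounded_clinear T \<and> (\<exists>S. bounded_clinear S \<and> S \<circ> T = id)"

text \<open>\<open>(T\<^sup>* T)\<^sup>-\<^sup>1 T\<^sup>*\<close>; for left invertible \<open>T\<close> the operator \<open>T\<^sup>* T\<close> is bijective.\<close>

definition left_inverse_op :: "('a::chilbert_space \<Rightarrow> 'a) \<Rightarrow> 'a \<Rightarrow> 'a" where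
  "left_inverse_op T = inv (cadjoint T \<circ> T) \<circ> cadjoint T"

definition left_inverse_commuting ::
    "('a::chilbert_space \<Rightarrow> 'a) \<Rightarrow> ('a \<Rightarrow> 'a) \<Rightarrow> bool" where
  "left_inverse_commuting T1 T2 \<longleftrightarrow>
     left_invertible T1 \<and> left_invertible T2 \<and> T1 \<circ> T2 = T2 \<circ> T1 \<and>
     left_inverse_op T1 \<circ> T2 = T2 \<circ> left_inverse_op T1 \<and>
     left_inverse_op T2 \<circ> T1 = T1 \<circ> left_inverse_op T2"

definition toral_2_isometry :: "('a::chilbert_space \<Rightarrow> 'a) \<Rightarrow> ('a \<Rightarrow> 'a) \<Rightarrow> bool" where
  "toral_2_isometry T1 T2 \<longleftrightarrow>
     bounded_clinear T1 \<and> bounded_clinear T2 \<and> T1 \<circ> T2 = T2 \<circ> T1 \<and>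
     (\<forall>A\<in>{T1, T2}. \<forall>B\<in>{T1, T2}. \<forall>x.
        x - cadjoint A (A x) - cadjoint B (B x) + cadjoint B (cadjoint A (A (B x))) = 0)"

definition analytic_operator :: "('a::chilbert_space \<Rightarrow> 'a) \<Rightarrow> bool" where
  "analytic_operator T \<longleftrightarrow> (\<Inter>m\<in>{1..}. range (T ^^ m)) = {0}"

definition cyclic_pair :: "('a::chilbert_space \<Rightarrow> 'a) \<Rightarrow> ('a \<Rightarrow> 'a) \<Rightarrow> bool" where
  "cyclic_pair T1 T2 \<longleftrightarrow>
     (\<exists>x. closure (cspan {(T1 ^^ m) ((T2 ^^ n) x) |m n. True}) = UNIV)"

section \<open>Dirichlet-type spaces on the bidisc\<close>

definition circle_measure :: "complex measure \<Rightarrow> bool" where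
  "circle_measure \<mu> \<longleftrightarrow>
     finite_measure \<mu> \<and> sets \<mu> = sets (restrict_space borel (sphere 0 1))"

definition poisson :: "complex measure \<Rightarrow> complex \<Rightarrow> real" where
  "poisson \<mu> z = (LINT \<zeta>|\<mu>. (1 - (cmod z)\<^sup>2) / (cmod (\<zeta> - z))\<^sup>2)"

abbreviation bidisc :: "(complex \<times> complex) set" where
  "bidisc \<equiv> ball 0 1 \<times> ball 0 1"

definition area_measure :: "complex measure" where
  "area_measure = uniform_measure lborel (ball 0 1)"

text \<open>Normalized arc-length on the circle, in the angular parameter \<open>t\<close> of \<open>cis t\<close>.\<close>

definition arc_measure :: "real measure" where
  "arc_measure = uniform_measure lborel {0..2*pi}"

text \<open>Holomorphy in two variables: existence of a complex linear Frechet derivative.\<close>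

definition holomorphic_bidisc :: "(complex \<times> complex \<Rightarrow> complex) \<Rightarrow> bool" where
  "holomorphic_bidisc f \<longleftrightarrow>
     (\<forall>z\<in>bidisc. \<exists>a b. (f has_derivative (\<lambda>h. a * fst h + b * snd h)) (at z))"

definition partial1 :: "(complex \<times> complex \<Rightarrow> complex) \<Rightarrow> complex \<times> complex \<Rightarrow> complex" where
  "partial1 f z = deriv (\<lambda>w. f (w, snd z)) (fst z)"

definition partial2 :: "(complex \<times> complex \<Rightarrow> complex) \<Rightarrow> complex \<times> complex \<Rightarrow> complex" where
  "partial2 f z = deriv (\<lambda>w. f (fst z, w)) (snd z)"

definition hardy_norm_sq :: "(complex \<times> complex \<Rightarrow> complex) \<Rightarrow> ennreal" where
  "hardy_norm_sq f =
     (SUP r\<in>{0<..<1}. \<integral>\<^sup>+ s. (\<integral>\<^sup>+ t.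
        ennreal ((cmod (f (of_real r * cis s, of_real r * cis t)))\<^sup>2) \<partial>arc_measure) \<partial>arc_measure)"

text \<open>
  A function on the bidisc is represented by its extension by \<open>0\<close> to all pairs of complex numbers,
  so that equality of representatives is equality on the bidisc.
\<close>

definition hardy_space :: "(complex \<times> complex \<Rightarrow> complex) set" where
  "hardy_space =
     {f. holomorphic_bidisc f \<and> (\<forall>z. z \<notin> bidisc \<longrightarrow> f z = 0) \<and> hardy_norm_sq f < \<infinity>}"

text \<open>
  For holomorphic \<open>f\<close> both integrals increase with \<open>r\<close>, so the limits exist in \<open>[0, \<infinity>]\<close>.
\<close>

definition dirichlet_integral ::
    "complex measure \<Rightarrow> complex measure \<Rightarrow> (complex \<times> complex \<Rightarrow> complex) \<Rightarrow> ennreal" where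
  "dirichlet_integral \<mu>1 \<mu>2 f =
     Lim (at_left (1::real)) (\<lambda>r. \<integral>\<^sup>+ z. (\<integral>\<^sup>+ t.
        ennreal (poisson \<mu>1 z * (cmod (partial1 f (z, of_real r * cis t)))\<^sup>2)
          \<partial>arc_measure) \<partial>area_measure) +
     Lim (at_left (1::real)) (\<lambda>r. \<integral>\<^sup>+ z. (\<integral>\<^sup>+ t.
        ennreal (poisson \<mu>2 z * (cmod (partial2 f (of_real r * cis t, z)))\<^sup>2)
          \<partial>arc_measure) \<partial>area_measure)"

definition dirichlet_space ::
    "complex measure \<Rightarrow> complex measure \<Rightarrow> (complex \<times> complex \<Rightarrow> complex) set" where
  "dirichlet_space \<mu>1 \<mu>2 = {f \<in> hardy_space. dirichlet_integral \<mu>1 \<mu>2 f < \<infinity>}"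

definition dirichlet_norm ::
    "complex measure \<Rightarrow> complex measure \<Rightarrow> (complex \<times> complex \<Rightarrow> complex) \<Rightarrow> real" where
  "dirichlet_norm \<mu>1 \<mu>2 f = sqrt (enn2real (hardy_norm_sq f + dirichlet_integral \<mu>1 \<mu>2 f))"

definition mult_z1 :: "(complex \<times> complex \<Rightarrow> complex) \<Rightarrow> complex \<times> complex \<Rightarrow> complex" where
  "mult_z1 f = (\<lambda>z. fst z * f z)"

definition mult_z2 :: "(complex \<times> complex \<Rightarrow> complex) \<Rightarrow> complex \<times> complex \<Rightarrow> complex" where
  "mult_z2 f = (\<lambda>z. snd z * f z)"

text \<open>
  A unitary is a complex linear isometry onto the space; the inner product, being determined by
  the norm through polarization, is then preserved as well.
\<close>

definition unitary_onto_dirichlet ::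
    "complex measure \<Rightarrow> complex measure \<Rightarrow>
     ('a::chilbert_space \<Rightarrow> complex \<times> complex \<Rightarrow> complex) \<Rightarrow> bool" where
  "unitary_onto_dirichlet \<mu>1 \<mu>2 U \<longleftrightarrow>
     bij_betw U UNIV (dirichlet_space \<mu>1 \<mu>2) \<and>
     (\<forall>x y. U (x + y) = (\<lambda>z. U x z + U y z)) \<and>
     (\<forall>c x. U (c *\<^sub>C x) = (\<lambda>z. c * U x z)) \<and>
     (\<forall>x. dirichlet_norm \<mu>1 \<mu>2 (U x) = norm x)"

end

theory Submission
  imports Defs "HOL-Probability.Probability" "HOL-Complex_Analysis.Complex_Analysis"
begin

text \<open>
  For a 2-isometry \<open>T\<close> the defect \<open>\<delta>(x) = \<parallel>Tx\<parallel>\<^sup>2 - \<parallel>x\<parallel>\<^sup>2\<close> is a nonnegative quadratic form with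
  \<open>\<delta>(Tx) = \<delta>(x)\<close>, and for vectors \<open>y m\<close> in the kernel of the adjoint of \<open>T\<close> the norm
  \<open>\<parallel>\<Sum>m\<le>M. T^m (y m)\<parallel>\<^sup>2\<close> equals \<open>\<Sum>m\<le>M. \<parallel>y m\<parallel>\<^sup>2\<close> plus
  \<open>\<Sum>N=1..M. \<delta>(\<Sum>k\<le>N. k T^k (y k)) / (N (N+1))\<close> plus the boundary term
  \<open>\<delta>(\<Sum>k\<le>M. k T^k (y k)) / (M+1)\<close>.

  Left-inverse commutation makes the projections onto the two adjoint kernels commute. Their
  intersection is spanned by a unit vector \<open>e\<close> (at most one-dimensional by cyclicity, nonzero by
  analyticity), and a vector is determined by its coefficients \<open>\<langle>L1^m L2^n x, e\<rangle>\<close>. Applying the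
  norm formula in both variables bounds an explicit energy of the coefficients by \<open>\<parallel>x\<parallel>\<^sup>2\<close>.
  Conversely, for an array of finite energy the boundary terms of suitable rectangular truncations
  are small, because a convergent series cannot dominate the harmonic series; so the truncations are
  bounded, and nested closed convex sets produce a vector with the given coefficients.

  By Herglotz' theorem there is a measure \<open>\<mu>\<close> with \<open>\<integral>|\<Sum> c k \<zeta>^k|\<^sup>2 d\<mu> = \<delta>(\<Sum> c k T^k e)\<close>.
  On the function side, for \<open>|\<zeta>| = 1\<close> the Poisson kernel times \<open>|g'|\<^sup>2\<close> is
  \<open>(1 - |z|\<^sup>2) |g'(z) / (\<zeta> - z)|\<^sup>2\<close>, so Parseval's identity for the weight \<open>1 - |z|\<^sup>2\<close> turns the
  Dirichlet integral of \<open>g = \<Sum> g k z^k\<close> into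
  \<open>\<Sum>N\<ge>1. (\<integral>|\<Sum>k\<le>N. k (g k) \<zeta>^k|\<^sup>2 d\<mu>) / (N (N+1))\<close>: the same energy.
\<close>

text \<open>The weight 1/(N(N+1)) has two origins whose agreement carries the proof. For operators
  it comes from 1/(N(N+1)) + 1/(N+1) = 1/N, which makes the norm formula telescope. On the disc it
  is the integral of (1 - s) s^(N-1) over [0,1], where s = |z|^2 is uniformly distributed under
  normalized area. The two variables decouple through the mixed toral identity: the defect of T1 is
  invariant under T2, and the vectors T1^k e are orthogonal to the range of T2, so different powers
  of T2 do not interact in the defect of T1. The obstacle is surjectivity. The boundary terms of a
  rectangular truncation are controlled only for suitable side lengths, and what is then known about
  the truncations is a bound on their norms, not convergence. This is why the limit vector is taken
  from nested closed convex sets, and why the norm equality is obtained last, from the uniqueness of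
  a vector with given coefficients.\<close>

section \<open>Hilbert space preliminaries\<close>

text \<open>Stands in for weak compactness of balls. Points of almost minimal norm form a Cauchy
  sequence by the parallelogram law, because the midpoint of a point of \<open>C k\<close> and a
  point of a later set still lies in \<open>C k\<close>.\<close>

lemma nested_closed_convex_Inter:
  fixes C :: "nat \<Rightarrow> 'a::{real_inner,complete_space} set"
  assumes closed: "\<And>k. closed (C k)" and convex: "\<And>k. convex (C k)"
    and decreasing: "\<And>k. C (Suc k) \<subseteq> C k"
    and bounded: "\<And>k. \<exists>x\<in>C k. norm x \<le> R"
  shows "\<exists>x. (\<forall>k. x \<in> C k) \<and> norm x \<le> R"
proof -
  have C_mono: "C l \<subseteq> C k" if "k \<le> l" for k l
    using decreasing that by (rule lift_Suc_antimono_le)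
  define d where "d k = Inf (norm ` C k)" for k
  have bdd: "bdd_below (norm ` C k)" for k
    by (rule bdd_belowI[of _ 0]) auto
  have ne: "C k \<noteq> {}" for k using bounded[of k] by auto
  have d_le: "d k \<le> norm x" if "x \<in> C k" for k x
    unfolding d_def using that by (intro cInf_lower bdd) auto
  have d_R: "d k \<le> R" for k
    using bounded[of k] d_le by (meson order_trans)
  have d_nonneg: "0 \<le> d k" for k
    unfolding d_def using ne[of k] by (intro cInf_greatest) auto
  have d_mono: "incseq d"
    unfolding incseq_def d_def
    by (intro allI impI cInf_superset_mono bdd image_mono C_mono) (use ne in auto)
  obtain D where D: "d \<longlonglongrightarrow> D" "\<forall>i. d i \<le> D"
    using incseq_convergent[OF d_mono, of R] d_R by blast
  have D_R: "D \<le> R"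
    by (rule LIMSEQ_le_const2[OF D(1)]) (use d_R in auto)
  have "\<exists>x\<in>C k. norm x < d k + 1 / real (Suc k)" for k
  proof -
    have "\<exists>t\<in>norm ` C k. t < d k + 1 / real (Suc k)"
      unfolding d_def by (rule cInf_lessD) (use ne in auto)
    then show ?thesis by auto
  qed
  then obtain x where x: "\<And>k. x k \<in> C k" "\<And>k. norm (x k) < d k + 1 / real (Suc k)"
    by metis
  \<comment> \<open>Parallelogram bound for |x k - x l|^2 with k \<le> l: both norms are at most D +
    1/(k+1), and the midpoint lies in \<open>C k\<close>, so its norm is at least
    \<open>d k\<close>.\<close>
  define h where "h k = 4 * (D + 1 / real (Suc k))\<^sup>2 - 4 * (d k)\<^sup>2" for k
  have h_lim: "h \<longlonglongrightarrow> 0"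
  proof -
    have "h \<longlonglongrightarrow> 4 * (D + 0)\<^sup>2 - 4 * D\<^sup>2"
      unfolding h_def by (intro tendsto_intros D(1) LIMSEQ_Suc lim_1_over_n)
    then show ?thesis by simp
  qed
  have diff_le: "(norm (x k - x l))\<^sup>2 \<le> h k" if "k \<le> l" for k l
  proof -
    have "(1/2) *\<^sub>R x k + (1/2) *\<^sub>R x l \<in> C k"
      by (intro convexD convex x) (use x[of l] C_mono[OF that] in auto)
    then have "d k \<le> norm ((1/2) *\<^sub>R (x k + x l))"
      using d_le by (simp add: scaleR_add_right)
    then have "2 * d k \<le> norm (x k + x l)" by simp
    then have "4 * (d k)\<^sup>2 \<le> (norm (x k + x l))\<^sup>2"
      using power_mono[of "2 * d k" "norm (x k + x l)" 2] d_nonneg[of k]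
      by (simp add: power_mult_distrib)
    moreover have "(norm (x k))\<^sup>2 \<le> (D + 1 / real (Suc k))\<^sup>2"
      using x(2)[of k] D(2) by (intro power_mono) (auto intro: order_trans[OF less_imp_le])
    moreover have "(norm (x l))\<^sup>2 \<le> (D + 1 / real (Suc k))\<^sup>2"
    proof (intro power_mono)
      have "1 / real (Suc l) \<le> 1 / real (Suc k)"
        using that by (intro divide_left_mono) auto
      then show "norm (x l) \<le> D + 1 / real (Suc k)"
        using x(2)[of l] D(2)[rule_format, of l] by linarith
    qed simp
    moreover have "(norm (x k - x l))\<^sup>2 + (norm (x k + x l))\<^sup>2 = 2 * (norm (x k))\<^sup>2 + 2 * (norm (x l))\<^sup>2"
      by (simp add: power2_norm_eq_inner inner_simps)
    ultimately show ?thesis unfolding h_def by linarith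
  qed
  have "Cauchy x"
  proof (rule CauchyI')
    fix \<epsilon> :: real assume "\<epsilon> > 0"
    then obtain N where N: "\<And>k. k \<ge> N \<Longrightarrow> norm (h k) < \<epsilon>\<^sup>2"
      using LIMSEQ_D[OF h_lim, of "\<epsilon>\<^sup>2"] by auto
    have "dist (x m) (x n) < \<epsilon>" if "m \<ge> N" "n > m" for m n
    proof -
      have "(norm (x m - x n))\<^sup>2 < \<epsilon>\<^sup>2"
        using diff_le[of m n] N[OF that(1)] that by simp
      then show ?thesis using \<open>\<epsilon> > 0\<close> by (simp add: power2_less_imp_less dist_norm)
    qed
    then show "\<exists>M. \<forall>m\<ge>M. \<forall>n>m. dist (x m) (x n) < \<epsilon>" by blast
  qed
  then obtain y where y: "x \<longlonglongrightarrow> y"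
    using Cauchy_convergent_iff convergent_def by blast
  have "y \<in> C k" for k
    by (rule closed_sequentially[OF closed _ LIMSEQ_ignore_initial_segment[OF y, of k]])
      (use x(1) C_mono in \<open>meson le_add2 subsetD\<close>)
  moreover have "norm y \<le> D + 0"
    by (rule LIMSEQ_le[OF tendsto_norm[OF y]
          tendsto_add[OF D(1) LIMSEQ_Suc[OF lim_1_over_n]]]) (use x(2) in \<open>auto intro!: exI[of _ 0] less_imp_le\<close>)
  ultimately show ?thesis using D_R by (intro exI[of _ y]) auto
qed

text \<open>Cutting \<open>C\<close> with balls of radius slightly above the infimum of the norms
  gives a decreasing family, and a common point attains the infimum.\<close>

lemma minimal_norm_element:
  fixes C :: "'a::{real_inner,complete_space} set"
  assumes "closed C" "convex C" "C \<noteq> {}"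
  shows "\<exists>x\<in>C. \<forall>z\<in>C. norm x \<le> norm z"
proof -
  define d where "d = Inf (norm ` C)"
  have bdd: "bdd_below (norm ` C)"
    by (rule bdd_belowI[of _ 0]) auto
  have d_le: "d \<le> norm x" if "x \<in> C" for x
    unfolding d_def using that by (intro cInf_lower bdd) auto
  have "\<exists>x. (\<forall>k. x \<in> C \<inter> cball 0 (d + 1 / real (Suc k))) \<and> norm x \<le> d + 1"
  proof (rule nested_closed_convex_Inter)
    fix k
    show "closed (C \<inter> cball 0 (d + 1 / real (Suc k)))" "convex (C \<inter> cball 0 (d + 1 / real (Suc k)))"
      using assms by (auto intro: convex_Int)
    have le: "1 / real (Suc (Suc k)) \<le> 1 / real (Suc k)"
      by (intro divide_left_mono) auto
    show "C \<inter> cball 0 (d + 1 / real (Suc (Suc k))) \<subseteq> C \<inter> cball 0 (d + 1 / real (Suc k))"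
      using le by auto
    have "\<exists>t\<in>norm ` C. t < d + 1 / real (Suc k)"
      unfolding d_def by (rule cInf_lessD) (use assms in auto)
    then obtain x where "x \<in> C" "norm x < d + 1 / real (Suc k)" by auto
    moreover have "1 / real (Suc k) \<le> 1" by simp
    ultimately have "norm x \<le> d + 1" "x \<in> C" "norm x \<le> d + 1 / real (Suc k)"
      by linarith+
    then show "\<exists>x\<in>C \<inter> cball 0 (d + 1 / real (Suc k)). norm x \<le> d + 1"
      by (intro bexI[of _ x]) auto
  qed
  then obtain x where x: "\<And>k. x \<in> C" "\<And>k. norm x \<le> d + 1 / real (Suc k)" by auto
  have "norm x \<le> d + 0"
    by (rule LIMSEQ_le_const[OF tendsto_add[OF tendsto_const LIMSEQ_Suc[OF lim_1_over_n]]])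
      (use x(2) in auto)
  then show ?thesis using x(1) d_le by (intro bexI[of _ x]) force+
qed

lemma orthogonal_projection_exists:
  fixes V :: "'a::{real_inner,complete_space} set"
  assumes "closed V" "subspace V"
  shows "\<exists>v\<in>V. \<forall>w\<in>V. inner (y - v) w = 0"
proof -
  have C: "(\<lambda>v. y - v) ` V = (\<lambda>v. y + v) ` V"
  proof -
    have "y - v \<in> (\<lambda>v. y + v) ` V" "y + v \<in> (\<lambda>v. y - v) ` V" if "v \<in> V" for v
      using subspace_neg[OF assms(2) that] by (auto intro!: image_eqI[of _ _ "-v"])
    then show ?thesis by blast
  qed
  have "\<exists>u\<in>(\<lambda>v. y - v) ` V. \<forall>z\<in>(\<lambda>v. y - v) ` V. norm u \<le> norm z"
    unfolding C by (intro minimal_norm_element closed_translation convex_translation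
        subspace_imp_convex) (use assms subspace_0 in auto)
  then obtain v where v: "v \<in> V" "\<And>z. z \<in> V \<Longrightarrow> norm (y - v) \<le> norm (y - z)" by auto
  have "inner (y - v) w = 0" if "w \<in> V" for w
  proof (cases "w = 0")
    case False
    \<comment> \<open>The minimiser over real s of the squared norm of y - v - s w; inserting it
      turns the minimality of \<open>v\<close> into a bound on the inner product.\<close>
    define t where "t = inner (y - v) w / inner w w"
    have ww: "inner w w > 0" using False by simp
    have "norm (y - v) \<le> norm (y - (v + t *\<^sub>R w))"
      by (intro v subspace_add subspace_scale assms that)
    then have "inner (y - v) (y - v) \<le> inner ((y - v) - t *\<^sub>R w) ((y - v) - t *\<^sub>R w)"
      unfolding diff_diff_eq by (rule norm_le[THEN iffD1])
    also have "\<dots> = inner (y - v) (y - v) - 2 * t * inner (y - v) w + t * t * inner w w"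
      unfolding inner_diff_left[of _ "t *\<^sub>R w"] inner_diff_right[of _ _ "t *\<^sub>R w"]
        inner_scaleR_left inner_scaleR_right inner_commute[of w "y - v"]
      by (simp add: algebra_simps)
    also have "\<dots> = inner (y - v) (y - v) - (inner (y - v) w)\<^sup>2 / inner w w"
      using ww by (simp add: t_def power2_eq_square)
    finally have "(inner (y - v) w)\<^sup>2 / inner w w \<le> 0" by simp
    then show ?thesis using ww by (simp add: divide_le_0_iff)
  qed simp
  then show ?thesis using v(1) by blast
qed

lemma riesz_representation_real:
  fixes \<phi> :: "'a::{real_inner,complete_space} \<Rightarrow> real"
  assumes "bounded_linear \<phi>"
  shows "\<exists>u. \<forall>x. \<phi> x = inner x u"
proof (cases "\<forall>x. \<phi> x = 0")
  case False
  then obtain y where y: "\<phi> y \<noteq> 0" by auto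
  interpret bounded_linear \<phi> by fact
  have "closed {x. \<phi> x = 0}"
    by (intro closed_Collect_eq continuous_intros continuous_on linear_continuous_on assms)
  moreover have "subspace {x. \<phi> x = 0}"
    by (auto simp: subspace_def zero add scaleR)
  ultimately obtain v where v: "\<phi> v = 0" "\<And>w. \<phi> w = 0 \<Longrightarrow> inner (y - v) w = 0"
    using orthogonal_projection_exists[of "{x. \<phi> x = 0}" y] by auto
  define u where "u = y - v"
  have u: "\<phi> u \<noteq> 0" using y v(1) by (simp add: u_def diff)
  then have uu: "inner u u \<noteq> 0" using zero by auto
  have "\<phi> x = inner x ((\<phi> u / inner u u) *\<^sub>R u)" for x
  proof -
    have "inner u (x - (\<phi> x / \<phi> u) *\<^sub>R u) = 0"
      unfolding u_def by (rule v(2)) (use u in \<open>simp add: diff scaleR u_def[symmetric]\<close>)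
    then have "inner u x = (\<phi> x / \<phi> u) * inner u u"
      by (simp add: inner_diff_right)
    then show ?thesis using u uu by (simp add: inner_commute)
  qed
  then show ?thesis by blast
qed (auto intro: exI[of _ 0])

section \<open>Complex inner product algebra and the adjoint\<close>

lemma cinner_add_right: "cinner x (y + z) = cinner x y + cinner (x::'a::complex_inner) z"
  by (subst (1 2 3) cinner_commute) (simp add: cinner_add_left)

lemma cinner_scaleC_right: "cinner x (c *\<^sub>C y) = cnj c * cinner (x::'a::complex_inner) y"
  by (subst (1 2) cinner_commute) (simp add: cinner_scaleC_left)

lemma scaleC_minus1: "(-1) *\<^sub>C x = - (x::'a::complex_inner)"
  using scaleR_scaleC[of "-1" x] by simp

lemma scaleC_zero_one [simp]: "0 *\<^sub>C x = (0::'a::complex_inner)" "c *\<^sub>C 0 = (0::'a::complex_inner)"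
  "1 *\<^sub>C x = x"
  by simp_all

lemma cinner_minus_left: "cinner (- x) y = - cinner (x::'a::complex_inner) y"
  using cinner_scaleC_left[of "-1" x y] by (simp add: scaleC_minus1)

lemma cinner_minus_right: "cinner x (- y) = - cinner (x::'a::complex_inner) y"
  using cinner_scaleC_right[of x "-1" y] by (simp add: scaleC_minus1)

lemma cinner_diff_left: "cinner (x - y) z = cinner x z - cinner (y::'a::complex_inner) z"
  using cinner_add_left[of x "- y" z] by (simp add: cinner_minus_left)

lemma cinner_diff_right: "cinner x (y - z) = cinner x y - cinner (x::'a::complex_inner) z"
  using cinner_add_right[of x y "- z"] by (simp add: cinner_minus_right)

lemma cinner_zero [simp]: "cinner 0 y = 0" "cinner (x::'a::complex_inner) 0 = 0"
  using cinner_diff_left[of y y y] cinner_diff_right[of x x x] by simp_all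

lemma cinner_sum_left: "cinner (sum f A) y = (\<Sum>i\<in>A. cinner (f i) (y::'a::complex_inner))"
  by (induction A rule: infinite_finite_induct) (auto simp: cinner_add_left)

lemma cinner_sum_right: "cinner y (sum f A) = (\<Sum>i\<in>A. cinner (y::'a::complex_inner) (f i))"
  by (induction A rule: infinite_finite_induct) (auto simp: cinner_add_right)

lemmas cinner_simps = cinner_add_left cinner_add_right cinner_diff_left cinner_diff_right
  cinner_scaleC_left cinner_scaleC_right cinner_minus_left cinner_minus_right

lemma Im_cinner: "Im (cinner x y) = - inner (\<i> *\<^sub>C x) (y::'a::complex_inner)"
  by (simp add: inner_eq_Re_cinner cinner_scaleC_left)

lemma cinner_self: "cinner x x = of_real ((norm (x::'a::complex_inner))\<^sup>2)"
  using cinner_commute[of x x]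
  by (auto simp: complex_eq_iff power2_norm_eq_inner inner_eq_Re_cinner)

lemma cinner_eq_zero_iff: "cinner x x = 0 \<longleftrightarrow> (x::'a::complex_inner) = 0"
  by (simp add: cinner_self)

lemma norm_scaleC: "norm (c *\<^sub>C x) = cmod c * norm (x::'a::complex_inner)"
proof -
  have "cinner (c *\<^sub>C x) (c *\<^sub>C x) = of_real ((cmod c * norm x)\<^sup>2)"
    unfolding cinner_scaleC_left cinner_scaleC_right cinner_self[of x] power_mult_distrib
      of_real_mult complex_norm_square[of c] by (simp add: mult_ac)
  then have "(norm (c *\<^sub>C x))\<^sup>2 = (cmod c * norm x)\<^sup>2"
    unfolding cinner_self of_real_eq_iff .
  then show ?thesis by (simp add: power2_eq_iff_nonneg)
qed

lemma cmod_cinner_le: "cmod (cinner x y) \<le> norm x * norm (y::'a::complex_inner)"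
proof (cases "cinner x y = 0")
  case False
  \<comment> \<open>A unimodular factor that rotates the inner product onto the positive reals,
    which reduces the claim to the real Cauchy-Schwarz inequality.\<close>
  define c where "c = cnj (cinner x y) / cmod (cinner x y)"
  have "cmod c = 1" using False by (simp add: c_def norm_divide)
  have "cmod (cinner x y) = Re (cinner (c *\<^sub>C x) y)"
  proof -
    have "c * cinner x y = of_real (cmod (cinner x y) ^ 2) / of_real (cmod (cinner x y))"
      unfolding c_def complex_norm_square by simp
    then show ?thesis using False
      by (simp add: cinner_scaleC_left power2_eq_square flip: of_real_mult of_real_divide)
  qed
  also have "\<dots> \<le> norm (c *\<^sub>C x) * norm y"
    unfolding inner_eq_Re_cinner[symmetric] by (rule norm_cauchy_schwarz)
  finally show ?thesis using \<open>cmod c = 1\<close> by (simp add: norm_scaleC)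
qed simp

lemma bounded_linear_cinner_left: "bounded_linear (\<lambda>x. cinner x (y::'a::complex_inner))"
  by (rule bounded_linear_intro[where K = "norm y"])
    (auto simp: cinner_add_left scaleR_scaleC cinner_scaleC_left scaleR_conv_of_real cmod_cinner_le)

lemma bounded_clinear_funpow: "bounded_clinear T \<Longrightarrow> bounded_clinear (T ^^ n)"
proof (induction n)
  case (Suc n)
  then show ?case by (auto simp: bounded_clinear_def intro: bounded_linear_compose[unfolded comp_def])
qed (auto simp: bounded_clinear_def id_def bounded_linear_ident)

lemma cadjoint_cinner:
  fixes T :: "'a::chilbert_space \<Rightarrow> 'a"
  assumes T: "bounded_clinear T"
  shows "cinner (T x) y = cinner x (cadjoint T y)"
proof -
  have lin: "bounded_linear T" and sc: "\<And>c x. T (c *\<^sub>C x) = c *\<^sub>C T x"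
    using T by (auto simp: bounded_clinear_def)
  have "\<exists>u. \<forall>x. inner (T x) y = inner x u" for y
    by (rule riesz_representation_real)
      (rule bounded_linear_compose[OF bounded_linear_inner_left lin])
  then obtain S where S: "\<And>x y. inner (T x) y = inner x (S y)" by metis
  \<comment> \<open>The imaginary part of the form is recovered from its real part at
    \<open>\<i> *\<^sub>C x\<close>, so complex homogeneity of \<open>T\<close> upgrades the real
    adjoint to the complex one.\<close>
  have S': "cinner (T x) y = cinner x (S y)" for x y
    using S[of x y] S[of "\<i> *\<^sub>C x" y]
    by (simp add: complex_eq_iff Im_cinner sc flip: inner_eq_Re_cinner)
  have "cadjoint T = S"
    unfolding cadjoint_def
  proof (rule the_equality)
    show "\<forall>x y. cinner (T x) y = cinner x (S y)" using S' by blast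
    fix S2 assume "\<forall>x y. cinner (T x) y = cinner x (S2 y)"
    then have "cinner x (S2 y - S y) = 0" for x y
      using S' by (simp add: cinner_diff_right)
    then show "S2 = S" by (metis cinner_eq_zero_iff eq_iff_diff_eq_0 ext)
  qed
  then show ?thesis using S' by simp
qed

section \<open>Two-isometries\<close>

text \<open>The conditions on \<open>L\<close> say that T L is the orthogonal projection onto the
  range of \<open>T\<close>. This pins down \<open>L\<close> and keeps adjoints out of the
  locale.\<close>

locale two_isometry =
  fixes T L :: "'h::complex_inner \<Rightarrow> 'h"
  assumes T_bounded: "bounded_clinear T"
    and two_iso: "cinner (T (T x)) (T (T y)) - 2 * cinner (T x) (T y) + cinner x y = 0"
    and L_T: "L (T x) = x"
    and orthogonal: "cinner (x - T (L x)) (T y) = 0"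
begin

lemma T_linear: "linear T" and T_scaleC: "T (c *\<^sub>C x) = c *\<^sub>C T x"
  using T_bounded by (auto simp: bounded_clinear_def bounded_linear.linear)

lemmas T_simps = linear_add[OF T_linear] linear_diff[OF T_linear] linear_scale[OF T_linear]
  linear_0[OF T_linear] linear_sum[OF T_linear] T_scaleC

lemma pow_linear: "linear (T ^^ n)" and pow_scaleC: "(T ^^ n) (c *\<^sub>C x) = c *\<^sub>C (T ^^ n) x"
  using bounded_clinear_funpow[OF T_bounded, of n]
  by (auto simp: bounded_clinear_def bounded_linear.linear)

lemmas pow_simps = linear_add[OF pow_linear] linear_diff[OF pow_linear] linear_scale[OF pow_linear]
  linear_0[OF pow_linear] linear_sum[OF pow_linear] pow_scaleC

text \<open>The images under \<open>T\<close> of two candidates differ by a vector that lies in the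
  range of \<open>T\<close> and is orthogonal to it. Linearity of \<open>L\<close> and its
  commutation with other operators thereby reduce to orthogonality checks.\<close>

lemma L_unique:
  assumes "\<And>y. cinner (x - T v) (T y) = 0"
  shows "L x = v"
proof -
  have "T (L x - v) = (x - T v) - (x - T (L x))" by (simp add: T_simps)
  then have "cinner (T (L x - v)) (T (L x - v)) = 0"
    using assms[of "L x - v"] orthogonal[of x "L x - v"] by (simp add: cinner_diff_left)
  then have "T (L x - v) = T 0" by (simp add: cinner_eq_zero_iff T_simps)
  then have "L x - v = 0" using L_T by metis
  then show ?thesis by simp
qed

lemma L_add: "L (x + y) = L x + L y"
proof (rule L_unique)
  fix z
  have "x + y - T (L x + L y) = (x - T (L x)) + (y - T (L y))" by (simp add: T_simps)
  then show "cinner (x + y - T (L x + L y)) (T z) = 0"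
    by (simp only: cinner_add_left orthogonal add_0_left)
qed

lemma L_scaleC: "L (c *\<^sub>C x) = c *\<^sub>C L x"
proof (rule L_unique)
  fix z
  have "c *\<^sub>C x - T (c *\<^sub>C L x) = c *\<^sub>C (x - T (L x))"
    using scaleC_add_right[of c "x - T (L x)" "T (L x)"] by (simp add: T_simps algebra_simps)
  then show "cinner (c *\<^sub>C x - T (c *\<^sub>C L x)) (T z) = 0"
    using orthogonal by (simp add: cinner_scaleC_left)
qed

lemma L_linear: "linear L"
  by (rule linearI) (auto simp: L_add L_scaleC scaleR_scaleC)

lemmas L_simps = L_add linear_diff[OF L_linear] linear_scale[OF L_linear]
  linear_0[OF L_linear] linear_sum[OF L_linear] L_scaleC

lemma Lpow_add: "(L ^^ n) (x + y) = (L ^^ n) x + (L ^^ n) y"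
  and Lpow_scaleC: "(L ^^ n) (c *\<^sub>C x) = c *\<^sub>C (L ^^ n) x"
  and Lpow_zero: "(L ^^ n) 0 = 0"
  by (induction n) (auto simp: L_simps)

text \<open>The sesquilinear form of the adjoint of \<open>T\<close> times \<open>T\<close> minus
  the identity; the 2-isometry identity says exactly that \<open>T\<close> preserves it.\<close>

definition dform :: "'h \<Rightarrow> 'h \<Rightarrow> complex" where
  "dform x y = cinner (T x) (T y) - cinner x y"

definition defect :: "'h \<Rightarrow> real" where
  "defect x = (norm (T x))\<^sup>2 - (norm x)\<^sup>2"

lemma dform_self: "dform x x = of_real (defect x)"
  by (simp add: dform_def defect_def cinner_self)

lemma dform_simps:
  "dform (x + x') y = dform x y + dform x' y" "dform x (y + y') = dform x y + dform x y'"
  "dform (c *\<^sub>C x) y = c * dform x y" "dform x (c *\<^sub>C y) = cnj c * dform x y"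
  "dform 0 y = 0" "dform x 0 = 0"
  by (simp_all add: dform_def cinner_simps T_simps algebra_simps)

lemma dform_sum:
  "dform (sum f A) y = (\<Sum>i\<in>A. dform (f i) y)" "dform x (sum g A) = (\<Sum>i\<in>A. dform x (g i))"
  by (simp_all add: dform_def T_simps cinner_sum_left cinner_sum_right sum_subtractf)

lemma dform_commute: "dform x y = cnj (dform y x)"
  unfolding dform_def by (simp flip: cinner_commute)

lemma dform_T: "dform (T x) (T y) = dform x y"
  using two_iso[of x y] by (simp add: dform_def algebra_simps)

lemma dform_pow: "dform ((T ^^ n) x) ((T ^^ n) y) = dform x y"
  by (induction n) (auto simp: dform_T)

lemma defect_add: "defect (x + y) = defect x + 2 * Re (dform x y) + defect y"
proof -
  have "of_real (defect (x + y)) = of_real (defect x) + (dform x y + cnj (dform x y)) + of_real (defect y)"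
    unfolding dform_self[symmetric] dform_commute[of y x, symmetric]
    by (simp add: dform_simps)
  from arg_cong[OF this, of Re] show ?thesis by simp
qed

lemma defect_T: "defect (T x) = defect x"
  using dform_T[of x x] by (simp add: dform_self)

lemma defect_pow: "defect ((T ^^ n) x) = defect x"
  by (induction n) (auto simp: defect_T)

lemma defect_zero: "defect 0 = 0"
  by (simp add: defect_def T_simps)

lemma defect_scaleC: "defect (c *\<^sub>C x) = (cmod c)\<^sup>2 * defect x"
  by (simp add: defect_def T_simps norm_scaleC power_mult_distrib algebra_simps)

lemma defect_scaleR: "defect (r *\<^sub>R x) = r\<^sup>2 * defect x"
  by (simp add: scaleR_scaleC defect_scaleC)

text \<open>Since \<open>T\<close> preserves \<open>dform\<close>, every further application of
  \<open>T\<close> adds the same amount, so inner products along orbits are affine in n.\<close>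

lemma cinner_pow: "cinner ((T ^^ n) x) ((T ^^ n) y) = cinner x y + of_nat n * dform x y"
proof (induction n)
  case (Suc n)
  then show ?case using dform_pow[of n x y] by (simp add: dform_def[of "(T ^^ n) x"] algebra_simps)
qed simp

lemma norm_pow: "(norm ((T ^^ n) x))\<^sup>2 = (norm x)\<^sup>2 + real n * defect x"
proof -
  have "complex_of_real ((norm ((T ^^ n) x))\<^sup>2) = of_real ((norm x)\<^sup>2 + real n * defect x)"
    unfolding cinner_self[symmetric] cinner_pow by (simp add: dform_self cinner_self)
  then show ?thesis unfolding of_real_eq_iff .
qed

text \<open>Squared norms along the orbit of \<open>x\<close> are affine in n with slope
  \<open>defect x\<close>; a negative slope would make one of them negative.\<close>

lemma defect_nonneg: "0 \<le> defect x"
proof (rule ccontr)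
  assume neg: "\<not> 0 \<le> defect x"
  then obtain n where "(norm x)\<^sup>2 < real n * (- defect x)"
    using reals_Archimedean3[of "- defect x"] by auto
  then have "(norm ((T ^^ n) x))\<^sup>2 < 0" unfolding norm_pow by simp
  then show False using zero_le_power2[of "norm ((T ^^ n) x)"] by linarith
qed

lemma norm_le_T: "norm x \<le> norm (T x)"
  by (rule power2_le_imp_le) (use defect_nonneg[of x] in \<open>auto simp: defect_def\<close>)

lemma norm_T_L_add: "(norm x)\<^sup>2 = (norm (x - T (L x)))\<^sup>2 + (norm (T (L x)))\<^sup>2"
proof -
  have "inner (x - T (L x)) (T (L x)) = 0"
    by (simp add: inner_eq_Re_cinner orthogonal)
  then show ?thesis
    by (simp add: power2_norm_eq_inner inner_diff_left inner_diff_right inner_commute)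
qed

lemma norm_L_le: "norm (L x) \<le> norm x"
proof -
  have "norm (T (L x)) \<le> norm x"
    by (rule power2_le_imp_le) (use norm_T_L_add[of x] in auto)
  then show ?thesis using norm_le_T[of "L x"] by linarith
qed

lemma norm_Lpow_le: "norm ((L ^^ n) x) \<le> norm x"
  by (induction n) (auto intro: order_trans[OF norm_L_le])

lemma continuous_Lpow: "continuous_on UNIV (L ^^ n)"
proof -
  have "bounded_linear (L ^^ n)"
    by (rule bounded_linear_intro[where K = 1])
      (auto simp: Lpow_add scaleR_scaleC Lpow_scaleC norm_Lpow_le)
  then show ?thesis by (simp add: linear_continuous_on)
qed

text \<open>Iterating x = (x - T (L x)) + T (L x) gives a finite Wold expansion: the coefficients
  are orthogonal to the range of \<open>T\<close>, and the last term is an unrestricted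
  remainder.\<close>

lemma telescope: "x = (\<Sum>m<M. (T ^^ m) ((L ^^ m) x - T (L ((L ^^ m) x)))) + (T ^^ M) ((L ^^ M) x)"
  by (induction M) (auto simp: pow_simps funpow_swap1)

text \<open>A new summand u = T^(M+1) (y (M+1)) meets T^m (y m) only through m times the defect
  form, because the plain inner product vanishes once T^m is cancelled. These cross terms add up to
  the form of \<open>s M\<close> against u, which also governs how the defect of \<open>s\<close>
  grows; this explains the factors k in \<open>s\<close>. The last coefficient need not be
  orthogonal to the range, which later lets it absorb a remainder.\<close>

lemma norm_sum_pow_aux:
  assumes "\<And>m z. m < M \<Longrightarrow> cinner (y m) (T z) = 0"
  defines "s \<equiv> \<lambda>M. \<Sum>k\<le>M. real k *\<^sub>R (T ^^ k) (y k)"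
  shows "(norm (\<Sum>m\<le>M. (T ^^ m) (y m)))\<^sup>2 = (\<Sum>m\<le>M. (norm (y m))\<^sup>2)
     + (\<Sum>N<M. defect (s (Suc N)) / (real (Suc N) * real (Suc (Suc N)))) + defect (s M) / real (Suc M)"
  using assms(1)
proof (induction M)
  case 0
  then show ?case by (simp add: s_def defect_zero)
next
  case (Suc M)
  define X where "X = (\<Sum>m\<le>M. (T ^^ m) (y m))"
  define u where "u = (T ^^ Suc M) (y (Suc M))"
  have "inner ((T ^^ m) (y m)) u = real m * Re (dform ((T ^^ m) (y m)) u)" if "m \<le> M" for m
  proof -
    define v where "v = (T ^^ (M - m)) (y (Suc M))"
    have "Suc M = m + Suc (M - m)" using that by simp
    then have u: "u = (T ^^ m) (T v)"
      unfolding u_def v_def by (metis comp_apply funpow.simps(2) funpow_add)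
    have "cinner (y m) (T v) = 0" using Suc.prems[of m] that by simp
    then show ?thesis unfolding u inner_eq_Re_cinner cinner_pow dform_pow by simp
  qed
  then have Xu: "inner X u = Re (dform (s M) u)"
    unfolding X_def s_def inner_sum_left dform_sum Re_sum scaleR_scaleC dform_simps by simp
  have "(norm (X + u))\<^sup>2 = (norm X)\<^sup>2 + 2 * inner X u + (norm u)\<^sup>2"
    by (simp add: power2_norm_eq_inner inner_simps inner_commute)
  also have "(norm u)\<^sup>2 = (norm (y (Suc M)))\<^sup>2 + real (Suc M) * defect u"
    unfolding u_def norm_pow defect_pow ..
  finally have 1: "(norm (X + u))\<^sup>2 = (norm X)\<^sup>2 + 2 * Re (dform (s M) u)
      + (norm (y (Suc M)))\<^sup>2 + real (Suc M) * defect u" by (simp add: Xu)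
  have "s (Suc M) = s M + real (Suc M) *\<^sub>R u" by (simp add: s_def u_def)
  then have 2: "defect (s (Suc M)) = defect (s M) + 2 * real (Suc M) * Re (dform (s M) u)
      + (real (Suc M))\<^sup>2 * defect u"
    by (simp add: defect_add defect_scaleR) (simp add: scaleR_scaleC dform_simps)
  have IH: "(norm X)\<^sup>2 = (\<Sum>m\<le>M. (norm (y m))\<^sup>2)
     + (\<Sum>N<M. defect (s (Suc N)) / (real (Suc N) * real (Suc (Suc N)))) + defect (s M) / real (Suc M)"
    unfolding X_def by (rule Suc.IH) (use Suc.prems in auto)
  \<comment> \<open>With a = M + 1 this rests on 1/(a(a+1)) + 1/(a+1) = 1/a: the old boundary term
    and the growth of the norm together become one new interior term and the new boundary
    term.\<close>
  have 3: "d / (a * (a + 1)) + d / (a + 1) = d0 / a + 2 * r + a * v"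
    if "d = d0 + 2 * a * r + a\<^sup>2 * v" "a > 0" for d a d0 r v :: real
    using that(2) unfolding that(1) by (simp add: divide_simps) (simp add: power2_eq_square algebra_simps)
  have "defect (s (Suc M)) / (real (Suc M) * real (Suc (Suc M))) + defect (s (Suc M)) / real (Suc (Suc M))
      = defect (s M) / real (Suc M) + 2 * Re (dform (s M) u) + real (Suc M) * defect u"
    using 3[OF 2] by (simp add: add_ac)
  moreover have "(\<Sum>m\<le>Suc M. (T ^^ m) (y m)) = X + u" by (simp add: X_def u_def)
  ultimately show ?case using 1 IH by simp
qed

text \<open>In the sums of the previous lemma the term k = 0 vanishes and a common factor
  \<open>T\<close> splits off, which the defect ignores. What remains is indexed like the Taylor
  coefficients of a derivative.\<close>

lemma norm_sum_pow:
  assumes "\<And>m z. m \<le> M \<Longrightarrow> cinner (y m) (T z) = 0"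
  defines "s \<equiv> \<lambda>M. \<Sum>k\<le>M. real (Suc k) *\<^sub>R (T ^^ k) (y (Suc k))"
  shows "(norm (\<Sum>m\<le>Suc M. (T ^^ m) (y m)))\<^sup>2 = (\<Sum>m\<le>Suc M. (norm (y m))\<^sup>2)
     + (\<Sum>K\<le>M. defect (s K) / (real (Suc K) * real (Suc (Suc K)))) + defect (s M) / real (Suc (Suc M))"
proof -
  have "(\<Sum>k\<le>Suc K. real k *\<^sub>R (T ^^ k) (y k)) = T (s K)" for K
    unfolding s_def by (subst sum.atMost_Suc_shift) (simp add: T_simps)
  then show ?thesis
    using norm_sum_pow_aux[of "Suc M" y] assms(1) by (simp add: defect_T lessThan_Suc_atMost)
qed

lemma norm_ge_sum_defect:
  assumes y: "\<And>m. y m = (L ^^ m) x - T (L ((L ^^ m) x))"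
  defines "s \<equiv> \<lambda>M. \<Sum>k\<le>M. real (Suc k) *\<^sub>R (T ^^ k) (y (Suc k))"
  shows "(norm x)\<^sup>2 \<ge> (\<Sum>m\<le>M. (norm (y m))\<^sup>2) + (\<Sum>K<M. defect (s K) / (real (Suc K) * real (Suc (Suc K))))"
proof -
  \<comment> \<open>The remainder of the expansion enters as the coefficient of index M + 1, the one
    without an orthogonality condition. The sums \<open>s K\<close> with K < M do not see it, and
    the terms that do are nonnegative.\<close>
  define y' where "y' m = (if m \<le> M then y m else (L ^^ m) x)" for m
  define s' where "s' M = (\<Sum>k\<le>M. real (Suc k) *\<^sub>R (T ^^ k) (y' (Suc k)))" for M
  have "x = (\<Sum>m\<le>Suc M. (T ^^ m) (y' m))"
    using telescope[of x "Suc M"] by (simp add: y'_def y lessThan_Suc_atMost)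
  then have "(norm x)\<^sup>2 = (\<Sum>m\<le>Suc M. (norm (y' m))\<^sup>2)
     + (\<Sum>K\<le>M. defect (s' K) / (real (Suc K) * real (Suc (Suc K)))) + defect (s' M) / real (Suc (Suc M))"
    unfolding s'_def by (simp only:) (rule norm_sum_pow, auto simp: y'_def y orthogonal)
  moreover have "(\<Sum>m\<le>Suc M. (norm (y' m))\<^sup>2) \<ge> (\<Sum>m\<le>M. (norm (y m))\<^sup>2)"
    by (simp add: y'_def)
  moreover have "(\<Sum>K\<le>M. defect (s' K) / (real (Suc K) * real (Suc (Suc K))))
      \<ge> (\<Sum>K<M. defect (s K) / (real (Suc K) * real (Suc (Suc K))))"
  proof -
    have "s' K = s K" if "K < M" for K
      unfolding s'_def s_def using that by (intro sum.cong) (auto simp: y'_def)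
    then show ?thesis
      by (simp add: lessThan_Suc_atMost[symmetric] defect_nonneg del: of_nat_Suc)
  qed
  moreover have "defect (s' M) / real (Suc (Suc M)) \<ge> 0"
    by (intro divide_nonneg_nonneg defect_nonneg) auto
  ultimately show ?thesis by linarith
qed

end

section \<open>Herglotz' theorem\<close>

lemma prob_space_arc_measure: "prob_space arc_measure"
  unfolding arc_measure_def by (rule prob_space_uniform_measure) auto

interpretation arc: prob_space arc_measure
  by (rule prob_space_arc_measure)

lemma sets_arc_measure [measurable_cong, simp]: "sets arc_measure = sets borel"
  by (simp add: arc_measure_def)

lemma space_arc_measure [simp]: "space arc_measure = UNIV"
  by (simp add: arc_measure_def)

lemma cis_measurable [measurable]: "cis \<in> borel_measurable borel"
  by (intro borel_measurable_continuous_onI continuous_intros)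

lemma integrable_arc_bounded:
  fixes f :: "real \<Rightarrow> 'b::{banach, second_countable_topology}"
  assumes "f \<in> borel_measurable borel" "\<And>t. norm (f t) \<le> B"
  shows "integrable arc_measure f"
  by (rule arc.integrable_const_bound[of _ B]) (use assms in auto)

lemma integrable_arc_cis:
  fixes f :: "real \<Rightarrow> complex"
  assumes "\<And>t. f t = c * cis (of_int k * t)"
  shows "integrable arc_measure f"
  using assms by (intro integrable_arc_bounded[of _ "cmod c"]) (auto simp: assms[abs_def] norm_mult)

lemma integral_arc_cis: "(LINT t|arc_measure. cis (of_int k * t)) = (if k = 0 then 1 else 0)"
proof (cases "k = 0")
  case False
  have "arc_measure = density lborel (\<lambda>t. ennreal (indicator {0..2*pi} t / (2*pi)))"
    unfolding arc_measure_def uniform_measure_def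
    by (intro density_cong) (auto simp: divide_ennreal[symmetric] split: split_indicator)
  then have "(LINT t|arc_measure. cis (of_int k * t))
      = (LINT t|density lborel (\<lambda>t. ennreal (indicator {0..2*pi} t / (2*pi))). cis (of_int k * t))"
    by (rule arg_cong)
  also have "\<dots> = (LINT t|lborel. (indicator {0..2*pi} t / (2*pi)) *\<^sub>R cis (of_int k * t))"
    by (rule integral_density) auto
  also have "\<dots> = (LINT t|lborel. indicator {0..2*pi} t *\<^sub>R (cis (of_int k * t) / (2*pi)))"
    by (intro Bochner_Integration.integral_cong) (auto simp: scaleR_conv_of_real split: split_indicator)
  also have "\<dots> = cis (of_int k * (2*pi)) / (2*pi*\<i>*k) - cis (of_int k * 0) / (2*pi*\<i>*k)"
  proof (rule integral_FTC_Icc)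
    show "((\<lambda>t. cis (of_int k * t) / (2*pi*\<i>*k)) has_vector_derivative cis (of_int k * x) / (2*pi)) (at x within {0..2*pi})" for x
    proof -
      have "((\<lambda>z. exp (\<i> * of_int k * z) / (2*pi*\<i>*k)) has_field_derivative exp (\<i> * of_int k * of_real x) / (2*pi)) (at (of_real x))"
        using False by (auto intro!: derivative_eq_intros)
      from has_vector_derivative_real_field[OF this] show ?thesis
        by (simp add: cis_conv_exp mult.assoc)
    qed
    show "continuous_on {0..2*pi} (\<lambda>t. cis (of_int k * t) / (2*pi))"
      by (intro continuous_intros) auto
  qed simp
  also have "cis (of_int k * (2*pi)) = 1"
    using cis_multiple_2pi[of "of_int k"] by (simp add: mult.commute)
  finally show ?thesis using False by simp
qed (use arc.prob_space in simp)

lemma cis_cnj_power: "cis t ^ j * cnj (cis t) ^ l = cis (of_int (int j - int l) * t)"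
proof -
  have "cis t ^ j * cnj (cis t) ^ l = cis (real j * t + real l * (- t))"
    by (simp only: cis_cnj Complex.DeMoivre cis_mult)
  then show ?thesis by (simp add: algebra_simps)
qed

text \<open>The distributions with Fejer-type densities \<open>\<Sum> (1 - \<bar>k\<bar>/N) b k cis (-k t)\<close> are tight, and a weak limit
  has the prescribed Fourier coefficients.\<close>

lemma herglotz_distribution:
  fixes b :: "int \<Rightarrow> complex"
  assumes psd: "\<And>N c. \<exists>r\<ge>0. (\<Sum>j<N. \<Sum>l<N. c j * cnj (c l) * b (int j - int l)) = complex_of_real r"
    and b0: "b 0 = of_real \<beta>" "\<beta> > 0"
  shows "\<exists>M. real_distribution M \<and> (\<forall>k::int. char M (of_int k) = b k / of_real \<beta>)"
proof -
  \<comment> \<open>Positive semidefiniteness tested on c j = cis (-j t). Collecting equal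
    differences j - l shows that F N / N is a Fejer mean of the prescribed series, now known to be
    nonnegative.\<close>
  define F where "F N t = (\<Sum>j<N. \<Sum>l<N. cis (- real j * t) * cnj (cis (- real l * t)) * b (int j - int l))" for N t
  have F_alt: "F N t = (\<Sum>j<N. \<Sum>l<N. b (int j - int l) * cis (of_int (int l - int j) * t))" for N t
    unfolding F_def by (intro sum.cong refl) (simp add: cis_cnj cis_mult algebra_simps)
  define r where "r N t = Re (F N t) / (real N * \<beta>)" for N t
  have F: "0 \<le> Re (F N t)" "F N t = of_real (Re (F N t))" for N t
  proof -
    obtain u where "u \<ge> 0" "F N t = of_real u"
      using psd[where N = N and c = "\<lambda>j. cis (- real j * t)"] unfolding F_def by blast
    then show "0 \<le> Re (F N t)" "F N t = of_real (Re (F N t))" by simp_all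
  qed
  have r_nonneg: "0 \<le> r N t" for N t unfolding r_def using F(1) b0(2) by simp
  have F_meas [measurable]: "F N \<in> borel_measurable borel" for N
    unfolding F_alt[abs_def] by measurable
  have r_meas [measurable]: "r N \<in> borel_measurable borel" for N unfolding r_def[abs_def] by measurable
  have term_eq: "b (int j - int l) * cis (of_int (int l - int j) * t) * cis (of_int k * t)
      = b (int j - int l) * cis (of_int (int l - int j + k) * t)" for j l k t
    by (simp add: cis_mult distrib_right)
  have integrable_term: "integrable arc_measure (\<lambda>t. b (int j - int l) * cis (of_int (int l - int j + k) * t))" for j l k
    by (rule integrable_arc_cis[OF refl])
  have integrable_F: "integrable arc_measure (\<lambda>t. F N t * cis (of_int k * t))" for N k
    unfolding F_alt sum_distrib_right term_eq
    by (intro Bochner_Integration.integrable_sum integrable_term)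
  have integral_F: "(LINT t|arc_measure. F N t * cis (of_int k * t)) = of_nat (N - nat \<bar>k\<bar>) * b k" for N k
  proof -
    have "(LINT t|arc_measure. F N t * cis (of_int k * t))
        = (\<Sum>j<N. \<Sum>l<N. (LINT t|arc_measure. b (int j - int l) * cis (of_int (int l - int j + k) * t)))"
      unfolding F_alt sum_distrib_right term_eq
      by (subst Bochner_Integration.integral_sum, intro Bochner_Integration.integrable_sum integrable_term,
          subst Bochner_Integration.integral_sum, intro integrable_term, rule refl)
    also have "\<dots> = (\<Sum>j<N. \<Sum>l<N. if int j - int l = k then b k else 0)"
      unfolding integral_mult_right_zero integral_arc_cis by (intro sum.cong refl) auto
    also have "\<dots> = (\<Sum>p\<in>{p \<in> {..<N} \<times> {..<N}. int (fst p) - int (snd p) = k}. b k)"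
      unfolding sum.cartesian_product by (subst sum.inter_filter) (auto simp: case_prod_beta)
    also have "\<dots> = of_nat (card {p \<in> {..<N} \<times> {..<N}. int (fst p) - int (snd p) = k}) * b k" by simp
    \<comment> \<open>The k-th diagonal of an N by N square has N - |k| cells (none if this is
      negative), the source of the Fejer factors.\<close>
    also have "card {p \<in> {..<N} \<times> {..<N}. int (fst p) - int (snd p) = k} = card {..<N - nat \<bar>k\<bar>}"
      by (rule bij_betw_same_card[symmetric],
          rule bij_betwI[where f = "\<lambda>i. (i + nat k, i + nat (-k))" and g = "\<lambda>p. fst p - nat k"]) auto
    finally show ?thesis by simp
  qed
  define M where "M N = density arc_measure (\<lambda>t. ennreal (r (Suc N) t))" for N
  have integrable_r: "integrable arc_measure (r N)" for N
    unfolding r_def[abs_def] using integrable_F[of N 0] by (simp add: integrable_Re)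
  have integral_M: "(LINT t|M N. cis (of_int k * t)) = of_nat (Suc N - nat \<bar>k\<bar>) * b k / (of_nat (Suc N) * of_real \<beta>)" for N k
  proof -
    have "(LINT t|M N. cis (of_int k * t)) = (LINT t|arc_measure. r (Suc N) t *\<^sub>R cis (of_int k * t))"
      unfolding M_def by (rule integral_density) (auto simp: r_nonneg)
    also have "\<dots> = (LINT t|arc_measure. F (Suc N) t * cis (of_int k * t) / (of_nat (Suc N) * of_real \<beta>))"
      using F(2) by (intro Bochner_Integration.integral_cong refl) (simp add: r_def scaleR_conv_of_real del: of_nat_Suc)
    finally show ?thesis by (simp add: integral_F del: of_nat_Suc)
  qed
  have emeasure_M: "emeasure (M N) A = (\<integral>\<^sup>+t. ennreal (r (Suc N) t) * indicator A t \<partial>arc_measure)" if "A \<in> sets borel" for A N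
    unfolding M_def using that by (subst emeasure_density) auto
  have emeasure_M_UNIV: "emeasure (M N) UNIV = 1" for N
  proof -
    have "emeasure (M N) UNIV = (\<integral>\<^sup>+t. ennreal (r (Suc N) t) \<partial>arc_measure)"
      by (subst emeasure_M) auto
    also have "\<dots> = ennreal (LINT t|arc_measure. r (Suc N) t)"
      by (rule nn_integral_eq_integral) (auto simp: integrable_r r_nonneg)
    also have "(LINT t|arc_measure. r (Suc N) t) = Re (LINT t|arc_measure. F (Suc N) t) / (real (Suc N) * \<beta>)"
      unfolding r_def using integrable_F[of "Suc N" 0] by (simp add: integral_Re)
    also have "\<dots> = 1" using integral_F[of "Suc N" 0] b0 by simp
    finally show ?thesis by simp
  qed
  have dist: "real_distribution (M N)" for N
    by (intro real_distribution.intro prob_spaceI real_distribution_axioms.intro)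
      (auto simp: M_def emeasure_M_UNIV[unfolded M_def])
  have "tight M"
    unfolding tight_def
  proof (intro conjI allI impI dist)
    fix \<epsilon> :: real assume "\<epsilon> > 0"
    have "AE t in arc_measure. t \<in> {0..2*pi}"
      unfolding arc_measure_def by (rule AE_uniform_measureI) auto
    \<comment> \<open>[0, 2 pi] carries all the mass of every density; the half-open interval has to
      begin below 0 to contain it, and -1 is one choice.\<close>
    then have "emeasure (M N) {-1<..2*pi} = emeasure (M N) UNIV" for N
      by (subst (1 2) emeasure_M) (auto intro!: nn_integral_cong_AE split: split_indicator)
    then have "measure (M N) {-1<..2*pi} = 1" for N
      by (simp add: measure_def emeasure_M_UNIV)
    then show "\<exists>a b. a < b \<and> (\<forall>n. 1 - \<epsilon> < measure (M n) {a<..b})"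
      using \<open>\<epsilon> > 0\<close> pi_gt_zero by (intro exI[of _ "-1"] exI[of _ "2*pi"]) (auto simp: less_trans[of _ 0])
  qed
  from tight_imp_convergent_subsubsequence[OF this strict_mono_id]
  obtain s L where s: "strict_mono s" and L: "real_distribution L" "weak_conv_m (M \<circ> s) L"
    unfolding comp_id by blast
  have "char L (of_int k) = b k / of_real \<beta>" for k :: int
  proof (rule LIMSEQ_unique)
    show "(\<lambda>n. char ((M \<circ> s) n) (of_int k)) \<longlonglongrightarrow> char L (of_int k)"
      by (rule levy_continuity1[OF _ L]) (simp add: dist)
    have eq: "char (M N) (of_int k) = of_nat (Suc N - nat \<bar>k\<bar>) * b k / (of_nat (Suc N) * of_real \<beta>)" for N
      unfolding char_def integral_M[symmetric] by (simp add: cis_conv_exp)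
    have "(\<lambda>N. of_nat (Suc N - nat \<bar>k\<bar>) / of_nat (Suc N) * (b k / of_real \<beta>)) \<longlonglongrightarrow> 1 * (b k / of_real \<beta>)"
    proof (intro tendsto_mult tendsto_const)
      have "(\<lambda>N. 1 - of_nat (nat \<bar>k\<bar>) / of_nat (Suc N)) \<longlonglongrightarrow> 1 - (0::complex)"
        by (intro tendsto_diff tendsto_const LIMSEQ_Suc lim_const_over_n)
      moreover have "\<forall>\<^sub>F N in sequentially. of_nat (Suc N - nat \<bar>k\<bar>) / of_nat (Suc N) = 1 - of_nat (nat \<bar>k\<bar>) / (of_nat (Suc N) :: complex)"
        using eventually_ge_at_top[of "nat \<bar>k\<bar>"]
        by eventually_elim (simp add: of_nat_diff diff_divide_distrib del: of_nat_Suc)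
      ultimately show "(\<lambda>N. of_nat (Suc N - nat \<bar>k\<bar>) / of_nat (Suc N)) \<longlonglongrightarrow> (1::complex)"
        by (simp add: tendsto_cong)
    qed
    then have "(\<lambda>N. char (M N) (of_int k)) \<longlonglongrightarrow> b k / of_real \<beta>"
      by (simp add: eq)
    from LIMSEQ_subseq_LIMSEQ[OF this s] show "(\<lambda>n. char ((M \<circ> s) n) (of_int k)) \<longlonglongrightarrow> b k / of_real \<beta>"
      by (simp add: o_def)
  qed
  then show ?thesis using L(1) by blast
qed

text \<open>The limit distribution on the line is scaled by b 0 and pushed to the circle by
  \<open>cis\<close>. If b 0 = 0 there is nothing to normalise, and positivity forces the whole
  sequence to vanish.\<close>

theorem herglotz:
  fixes b :: "int \<Rightarrow> complex"
  assumes psd: "\<And>N c. \<exists>r\<ge>0. (\<Sum>j<N. \<Sum>l<N. c j * cnj (c l) * b (int j - int l)) = complex_of_real r"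
  shows "\<exists>\<mu>. circle_measure \<mu> \<and> (\<forall>j l. (LINT \<zeta>|\<mu>. \<zeta> ^ j * cnj \<zeta> ^ l) = b (int j - int l))"
proof -
  obtain \<beta> where \<beta>: "b 0 = of_real \<beta>" "\<beta> \<ge> 0"
    using psd[where N = 1 and c = "\<lambda>_. 1"] by auto
  obtain M where M: "real_distribution M" "\<And>k::int. of_real \<beta> * char M (of_int k) = b k"
  proof (cases "\<beta> = 0")
    case True
    have "b k = 0" for k
    proof -
      define n where "n = nat \<bar>k\<bar>"
      \<comment> \<open>Test vector supported on the indices 0 and n with entries 1 and z. The
        diagonal of the form is zero, so the two mixed terms have a nonnegative sum for both z and
        -z; taking z = 1, -1, \<i>, -\<i> kills both coefficients.\<close>
      have two: "\<exists>r\<ge>0. z * b (int n) + cnj z * b (- int n) = complex_of_real r" if "n > 0" for z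
      proof -
        have "(\<Sum>j<Suc n. \<Sum>l<Suc n. f j l * (g j * cnj (g l))) = f 0 0 * (g 0 * cnj (g 0)) + f 0 n * (g 0 * cnj (g n)) + f n 0 * (g n * cnj (g 0)) + f n n * (g n * cnj (g n))"
          if "\<And>j. j \<noteq> 0 \<Longrightarrow> j \<noteq> n \<Longrightarrow> g j = (0::complex)" for f :: "nat \<Rightarrow> nat \<Rightarrow> complex" and g
        proof -
          have red: "sum h {..<Suc n} = h 0 + h n" if "\<And>j. j \<noteq> 0 \<Longrightarrow> j \<noteq> n \<Longrightarrow> h j = (0::complex)" for h
            using \<open>n > 0\<close> that by (subst sum.mono_neutral_right[of _ "{0,n}"]) auto
          show ?thesis by (subst red, simp add: that, subst (1 2) red) (auto simp: that)
        qed
        note expand = this[where f = "\<lambda>j l. b (int j - int l)" and g = "\<lambda>j. if j = 0 then 1 else if j = n then z else 0"]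
        show ?thesis
          using psd[where N = "Suc n" and c = "\<lambda>j. if j = 0 then 1 else if j = n then z else 0"]
            expand \<open>n > 0\<close> True \<beta>(1) by (auto simp: mult.commute add.commute)
      qed
      have "b (int n) = 0 \<and> b (- int n) = 0"
      proof (cases "n = 0")
        case False
        then show ?thesis
          using two[of 1] two[of "-1"] two[of \<i>] two[of "-\<i>"]
          by (auto simp: complex_eq_iff)
      qed (use True \<beta> in auto)
      then show ?thesis by (cases "k \<ge> 0") (auto simp: n_def)
    qed
    moreover have "real_distribution (return borel 0)"
      by (intro real_distribution.intro prob_space_return real_distribution_axioms.intro) auto
    ultimately show ?thesis using True by (intro that) auto
  next
    case False
    then obtain M where "real_distribution M" "\<And>k::int. char M (of_int k) = b k / of_real \<beta>"
      using herglotz_distribution[OF psd \<beta>(1)] \<beta>(2) by auto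
    then show ?thesis using False by (intro that) auto
  qed
  interpret M: real_distribution M by (rule M(1))
  define C :: "complex measure" where "C = restrict_space borel (sphere 0 1)"
  have cis_C: "cis \<in> measurable (density M (\<lambda>_. ennreal \<beta>)) C"
    unfolding C_def by (intro measurable_restrict_space2) auto
  define \<mu> where "\<mu> = distr (density M (\<lambda>_. ennreal \<beta>)) C cis"
  have "circle_measure \<mu>"
    unfolding circle_measure_def
  proof
    have "emeasure \<mu> (space \<mu>) = ennreal \<beta>"
      unfolding \<mu>_def using cis_C M.emeasure_space_1
      by (subst emeasure_distr) (auto simp: emeasure_density measurable_space vimage_def
          nn_integral_cmult_indicator Int_absorb1 subset_eq)
    then show "finite_measure \<mu>" by (intro finite_measureI) auto
  qed (simp add: \<mu>_def C_def)
  moreover have "(LINT \<zeta>|\<mu>. \<zeta> ^ j * cnj \<zeta> ^ l) = b (int j - int l)" for j l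
  proof -
    have "(LINT \<zeta>|\<mu>. \<zeta> ^ j * cnj \<zeta> ^ l) = (LINT t|density M (\<lambda>_. ennreal \<beta>). cis t ^ j * cnj (cis t) ^ l)"
      unfolding \<mu>_def by (rule integral_distr[OF cis_C]) (auto simp: C_def intro!: measurable_restrict_space1 borel_measurable_continuous_onI continuous_intros)
    also have "\<dots> = of_real \<beta> * (LINT t|M. cis (of_int (int j - int l) * t))"
      unfolding cis_cnj_power
      by (subst integral_density) (auto simp: \<beta> scaleR_conv_of_real)
    also have "\<dots> = of_real \<beta> * char M (of_int (int j - int l))"
      unfolding char_def by (simp add: cis_conv_exp)
    also have "\<dots> = b (int j - int l)" by (rule M(2))
    finally show ?thesis .
  qed
  ultimately show ?thesis by blast
qed

context two_isometry
begin

text \<open>The values of \<open>dform\<close> on T^j e and T^l e depend only on j - l because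
  \<open>T\<close> preserves the form, and nonnegativity of the defect is positive semidefiniteness
  of this Toeplitz array, so \<open>herglotz\<close> applies. Nonnegative integrals are used because
  the Dirichlet integral is evaluated in them.\<close>

theorem defect_measure:
  "\<exists>\<mu>. circle_measure \<mu> \<and> (\<forall>c K. (\<integral>\<^sup>+\<zeta>. ennreal ((cmod (\<Sum>k\<le>K. c k * \<zeta> ^ k))\<^sup>2) \<partial>\<mu>)
      = ennreal (defect (\<Sum>k\<le>K. c k *\<^sub>C (T ^^ k) e)))"
proof -
  define b where "b k = (if k \<ge> 0 then dform ((T ^^ nat k) e) e else dform e ((T ^^ nat (- k)) e))" for k :: int
  have b: "b (int j - int l) = dform ((T ^^ j) e) ((T ^^ l) e)" for j l
  proof (cases "j \<ge> l")
    case True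
    then show ?thesis
      using dform_pow[of l "(T ^^ (j - l)) e" e] funpow_add[of l "j - l" T]
      by (simp add: b_def nat_diff_distrib' flip: of_nat_diff)
  next
    case False
    then show ?thesis
      using dform_pow[of j e "(T ^^ (l - j)) e"] funpow_add[of j "l - j" T]
      by (simp add: b_def nat_diff_distrib' flip: of_nat_diff)
  qed
  have form: "(\<Sum>j\<in>J. \<Sum>l\<in>J. c j * cnj (c l) * b (int j - int l)) = of_real (defect (\<Sum>k\<in>J. c k *\<^sub>C (T ^^ k) e))" for c J
    unfolding b dform_self[symmetric] dform_sum dform_simps by (subst sum.swap) (simp add: sum_distrib_left mult_ac)
  have "\<exists>\<mu>. circle_measure \<mu> \<and> (\<forall>j l. (LINT \<zeta>|\<mu>. \<zeta> ^ j * cnj \<zeta> ^ l) = b (int j - int l))"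
    by (rule herglotz) (use form defect_nonneg in blast)
  then obtain \<mu> where \<mu>: "circle_measure \<mu>" "\<And>j l. (LINT \<zeta>|\<mu>. \<zeta> ^ j * cnj \<zeta> ^ l) = b (int j - int l)" by blast
  interpret finite_measure \<mu> using \<mu>(1) by (simp add: circle_measure_def)
  have sets: "sets \<mu> = sets (restrict_space borel (sphere 0 1))"
    using \<mu>(1) by (simp add: circle_measure_def)
  have space: "space \<mu> = sphere 0 1"
    using sets_eq_imp_space_eq[OF sets] by (simp add: space_restrict_space)
  have meas: "f \<in> borel_measurable \<mu>" if "f \<in> borel_measurable borel" for f :: "complex \<Rightarrow> 'b::topological_space"
    using that measurable_cong_sets[OF sets refl] by (auto intro: measurable_restrict_space1)
  have int: "integrable \<mu> (\<lambda>\<zeta>. a * (\<zeta> ^ j * cnj \<zeta> ^ l))" for a j l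
    by (rule integrable_const_bound[of _ "cmod a"])
      (auto simp: space norm_mult norm_power intro!: AE_I2 meas borel_measurable_continuous_onI continuous_intros)
  have "(\<integral>\<^sup>+\<zeta>. ennreal ((cmod (\<Sum>k\<le>K. c k * \<zeta> ^ k))\<^sup>2) \<partial>\<mu>) = ennreal (defect (\<Sum>k\<le>K. c k *\<^sub>C (T ^^ k) e))" for c K
  proof -
    have sq: "complex_of_real ((cmod (\<Sum>k\<le>K. c k * \<zeta> ^ k))\<^sup>2)
        = (\<Sum>j\<le>K. \<Sum>l\<le>K. c j * cnj (c l) * (\<zeta> ^ j * cnj \<zeta> ^ l))" for \<zeta>
      unfolding complex_norm_square cnj_sum sum_product by (simp add: mult_ac)
    have "integrable \<mu> (\<lambda>\<zeta>. complex_of_real ((cmod (\<Sum>k\<le>K. c k * \<zeta> ^ k))\<^sup>2))"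
      unfolding sq by (intro Bochner_Integration.integrable_sum int)
    then have i: "integrable \<mu> (\<lambda>\<zeta>. (cmod (\<Sum>k\<le>K. c k * \<zeta> ^ k))\<^sup>2)"
      by (simp only: complex_of_real_integrable_eq)
    have "complex_of_real (LINT \<zeta>|\<mu>. (cmod (\<Sum>k\<le>K. c k * \<zeta> ^ k))\<^sup>2)
        = (LINT \<zeta>|\<mu>. (\<Sum>j\<le>K. \<Sum>l\<le>K. c j * cnj (c l) * (\<zeta> ^ j * cnj \<zeta> ^ l)))"
      unfolding sq[symmetric] by (rule integral_complex_of_real[symmetric])
    also have "\<dots> = (\<Sum>j\<le>K. \<Sum>l\<le>K. c j * cnj (c l) * b (int j - int l))"
      by (subst Bochner_Integration.integral_sum, intro Bochner_Integration.integrable_sum int,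
          subst Bochner_Integration.integral_sum, intro int) (simp add: \<mu>(2))
    also have "\<dots> = of_real (defect (\<Sum>k\<le>K. c k *\<^sub>C (T ^^ k) e))" by (rule form)
    finally have "(LINT \<zeta>|\<mu>. (cmod (\<Sum>k\<le>K. c k * \<zeta> ^ k))\<^sup>2) = defect (\<Sum>k\<le>K. c k *\<^sub>C (T ^^ k) e)"
      unfolding of_real_eq_iff .
    then show ?thesis using i by (subst nn_integral_eq_integral) auto
  qed
  then show ?thesis using \<mu>(1) by blast
qed

end

section \<open>The Dirichlet integral on the disc\<close>

text \<open>Finite squares exhaust the index set, so interchanging or adding double series comes
  down to finite sums.\<close>

lemma suminf_suminf_SUP:
  fixes f :: "nat \<Rightarrow> nat \<Rightarrow> ennreal"
  shows "(\<Sum>i. \<Sum>j. f i j) = (SUP M. \<Sum>i<M. \<Sum>j<M. f i j)"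
proof (rule antisym)
  have "(\<Sum>i<N. \<Sum>j. f i j) \<le> (SUP M. \<Sum>i<M. \<Sum>j<M. f i j)" for N
  proof -
    have "(\<Sum>i<N. \<Sum>j. f i j) = (SUP M. \<Sum>i<N. \<Sum>j<M. f i j)"
      unfolding suminf_eq_SUP by (rule ennreal_SUP_sum[symmetric]) (auto simp: incseq_def intro!: sum_mono2)
    also have "\<dots> \<le> (SUP M. \<Sum>i<M. \<Sum>j<M. f i j)"
    proof (rule SUP_least)
      fix M
      have "(\<Sum>i<N. \<Sum>j<M. f i j) \<le> (\<Sum>i<max N M. \<Sum>j<M. f i j)"
        by (intro sum_mono2) auto
      also have "\<dots> \<le> (\<Sum>i<max N M. \<Sum>j<max N M. f i j)"
        by (intro sum_mono sum_mono2) auto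
      also have "\<dots> \<le> (SUP M. \<Sum>i<M. \<Sum>j<M. f i j)"
        by (rule SUP_upper) simp
      finally show "(\<Sum>i<N. \<Sum>j<M. f i j) \<le> (SUP M. \<Sum>i<M. \<Sum>j<M. f i j)" .
    qed
    finally show ?thesis .
  qed
  then show "(\<Sum>i. \<Sum>j. f i j) \<le> (SUP M. \<Sum>i<M. \<Sum>j<M. f i j)"
    by (subst suminf_eq_SUP) (rule SUP_least)
  show "(SUP M. \<Sum>i<M. \<Sum>j<M. f i j) \<le> (\<Sum>i. \<Sum>j. f i j)"
  proof (rule SUP_least)
    fix M
    have "(\<Sum>i<M. \<Sum>j<M. f i j) \<le> (\<Sum>i<M. \<Sum>j. f i j)"
      by (intro sum_mono sum_le_suminf) auto
    also have "\<dots> \<le> (\<Sum>i. \<Sum>j. f i j)" by (intro sum_le_suminf) auto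
    finally show "(\<Sum>i<M. \<Sum>j<M. f i j) \<le> (\<Sum>i. \<Sum>j. f i j)" .
  qed
qed

lemma suminf_swap_ennreal:
  fixes f :: "nat \<Rightarrow> nat \<Rightarrow> ennreal"
  shows "(\<Sum>i. \<Sum>j. f i j) = (\<Sum>j. \<Sum>i. f i j)"
  unfolding suminf_suminf_SUP by (subst sum.swap) simp

text \<open>Equal to 1/(N(N+1)) for N = K + 1, and also the integral of (1 - |z|^2) |z|^(2K) against
  normalized area.\<close>

definition weight :: "nat \<Rightarrow> real" where
  "weight K = 1 / (real (Suc K) * real (Suc (Suc K)))"

lemma weight_pos: "0 < weight K"
  by (simp add: weight_def)

text \<open>Orthogonality of the exponentials settles the partial sums; absolute summability bounds
  them uniformly, so dominated convergence passes to the full series.\<close>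

lemma parseval_arc:
  fixes c :: "nat \<Rightarrow> complex"
  assumes c: "summable (\<lambda>n. cmod (c n))"
  shows "(\<integral>\<^sup>+t. ennreal ((cmod (\<Sum>n. c n * cis (real n * t)))\<^sup>2) \<partial>arc_measure) = (\<Sum>n. ennreal ((cmod (c n))\<^sup>2))"
proof -
  define S where "S N t = (\<Sum>n<N. c n * cis (real n * t))" for N t
  define F where "F t = (\<Sum>n. c n * cis (real n * t))" for t
  define B where "B = (\<Sum>n. cmod (c n))"
  have [measurable]: "S N \<in> borel_measurable borel" "F \<in> borel_measurable borel" for N
    unfolding S_def[abs_def] F_def[abs_def] by measurable
  have lim: "(\<lambda>N. S N t) \<longlonglongrightarrow> F t" for t
    unfolding S_def F_def
    by (rule summable_LIMSEQ, rule summable_norm_cancel) (simp add: norm_mult c)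
  have S_le: "cmod (S N t) \<le> B" for N t
  proof -
    have "cmod (S N t) \<le> (\<Sum>n<N. cmod (c n))"
      unfolding S_def by (rule sum_norm_le) (simp add: norm_mult)
    also have "\<dots> \<le> B" unfolding B_def by (intro sum_le_suminf c) auto
    finally show ?thesis .
  qed
  have S_le2: "(cmod (S N t))\<^sup>2 \<le> B\<^sup>2" for N t by (intro power_mono S_le) auto
  have F_le2: "(cmod (F t))\<^sup>2 \<le> B\<^sup>2" for t
    by (rule LIMSEQ_le_const2[OF tendsto_power[OF tendsto_norm[OF lim]]]) (use S_le2 in auto)
  have "(LINT t|arc_measure. (cmod (S N t))\<^sup>2) = (\<Sum>n<N. (cmod (c n))\<^sup>2)" for N
  proof -
    have sq: "complex_of_real ((cmod (S N t))\<^sup>2) = (\<Sum>j<N. \<Sum>l<N. c j * cnj (c l) * cis (of_int (int j - int l) * t))" for t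
      unfolding complex_norm_square S_def cnj_sum sum_product
      by (intro sum.cong refl) (simp add: cis_cnj cis_mult left_diff_distrib)
    have int: "integrable arc_measure (\<lambda>t. c j * cnj (c l) * cis (of_int (int j - int l) * t))" for j l
      by (rule integrable_arc_cis[OF refl])
    have "complex_of_real (LINT t|arc_measure. (cmod (S N t))\<^sup>2)
        = (LINT t|arc_measure. (\<Sum>j<N. \<Sum>l<N. c j * cnj (c l) * cis (of_int (int j - int l) * t)))"
      unfolding sq[symmetric] by (rule integral_complex_of_real[symmetric])
    also have "\<dots> = (\<Sum>j<N. \<Sum>l<N. c j * cnj (c l) * (if int j - int l = 0 then 1 else 0))"
      unfolding integral_arc_cis[symmetric]
      by (subst Bochner_Integration.integral_sum, intro Bochner_Integration.integrable_sum int,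
          subst Bochner_Integration.integral_sum, intro int) simp
    also have "\<dots> = (\<Sum>j<N. \<Sum>l<N. if l = j then c j * cnj (c j) else 0)"
      by (intro sum.cong refl) auto
    also have "\<dots> = of_real (\<Sum>n<N. (cmod (c n))\<^sup>2)"
      by (simp only: complex_norm_square of_real_sum) simp
    finally show ?thesis unfolding of_real_eq_iff .
  qed
  moreover have "(\<lambda>N. LINT t|arc_measure. (cmod (S N t))\<^sup>2) \<longlonglongrightarrow> (LINT t|arc_measure. (cmod (F t))\<^sup>2)"
    by (rule integral_dominated_convergence[where w = "\<lambda>_. B\<^sup>2"])
      (use S_le2 in \<open>auto intro!: AE_I2 tendsto_power tendsto_norm lim simp: abs_le_iff\<close>)
  ultimately have sums: "(\<lambda>n. (cmod (c n))\<^sup>2) sums (LINT t|arc_measure. (cmod (F t))\<^sup>2)"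
    unfolding sums_def by simp
  have "integrable arc_measure (\<lambda>t. (cmod (F t))\<^sup>2)"
    by (rule integrable_arc_bounded[where B = "B\<^sup>2"]) (use F_le2 in auto)
  then have "(\<integral>\<^sup>+t. ennreal ((cmod (F t))\<^sup>2) \<partial>arc_measure) = ennreal (LINT t|arc_measure. (cmod (F t))\<^sup>2)"
    by (intro nn_integral_eq_integral) auto
  also have "\<dots> = (\<Sum>n. ennreal ((cmod (c n))\<^sup>2))"
    using sums by (intro suminf_ennreal_eq[symmetric]) auto
  finally show ?thesis unfolding F_def .
qed

section \<open>Area measure on the disc: rotation invariance and the distribution of the
  modulus\<close>

lemma lborel_complex: "(lborel :: complex measure) = distr (lborel \<Otimes>\<^sub>M lborel) borel (\<lambda>(x, y). Complex x y)"
proof (rule lborel_eqI)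
  have [measurable]: "(\<lambda>(x, y). Complex x y) \<in> borel_measurable (lborel \<Otimes>\<^sub>M lborel)"
    unfolding Complex_eq by measurable
  fix l u :: complex assume le: "\<And>b. b \<in> Basis \<Longrightarrow> l \<bullet> b \<le> u \<bullet> b"
  have "Re l \<le> Re u" "Im l \<le> Im u" using le[of 1] le[of \<i>] by (auto simp: Basis_complex_def)
  have "(\<lambda>(x, y). Complex x y) -` box l u \<inter> space (lborel \<Otimes>\<^sub>M lborel) = box (Re l) (Re u) \<times> box (Im l) (Im u)"
    by (auto simp: box_def Basis_complex_def space_pair_measure)
  then have "emeasure (distr (lborel \<Otimes>\<^sub>M lborel) borel (\<lambda>(x, y). Complex x y)) (box l u)
     = emeasure lborel (box (Re l) (Re u)) * emeasure lborel (box (Im l) (Im u))"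
    by (subst emeasure_distr) (auto simp: lborel.emeasure_pair_measure_Times)
  also have "\<dots> = ennreal (\<Prod>b\<in>Basis. (u - l) \<bullet> b)"
    using \<open>Re l \<le> Re u\<close> \<open>Im l \<le> Im u\<close> by (simp add: Basis_complex_def ennreal_mult)
  finally show "emeasure (distr (lborel \<Otimes>\<^sub>M lborel) borel (\<lambda>(x, y). Complex x y)) (box l u)
      = ennreal (\<Prod>b\<in>Basis. (u - l) \<bullet> b)" .
qed simp

lemma nn_integral_lborel_complex:
  fixes f :: "complex \<Rightarrow> ennreal"
  assumes [measurable]: "f \<in> borel_measurable borel"
  shows "(\<integral>\<^sup>+z. f z \<partial>lborel) = (\<integral>\<^sup>+x. \<integral>\<^sup>+y. f (Complex x y) \<partial>lborel \<partial>lborel)"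
    and "(\<integral>\<^sup>+z. f z \<partial>lborel) = (\<integral>\<^sup>+y. \<integral>\<^sup>+x. f (Complex x y) \<partial>lborel \<partial>lborel)"
proof -
  have [measurable]: "(\<lambda>(x, y). Complex x y) \<in> borel_measurable (lborel \<Otimes>\<^sub>M lborel)"
    unfolding Complex_eq by measurable
  have eq: "(\<integral>\<^sup>+z. f z \<partial>lborel) = (\<integral>\<^sup>+p. f (case p of (x, y) \<Rightarrow> Complex x y) \<partial>(lborel \<Otimes>\<^sub>M lborel))"
    by (subst lborel_complex, subst nn_integral_distr) auto
  show fst: "(\<integral>\<^sup>+z. f z \<partial>lborel) = (\<integral>\<^sup>+x. \<integral>\<^sup>+y. f (Complex x y) \<partial>lborel \<partial>lborel)"
    unfolding eq by (subst lborel.nn_integral_fst[symmetric]) auto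
  show "(\<integral>\<^sup>+z. f z \<partial>lborel) = (\<integral>\<^sup>+y. \<integral>\<^sup>+x. f (Complex x y) \<partial>lborel \<partial>lborel)"
    unfolding fst by (rule lborel_pair.Fubini'[symmetric]) measurable
qed

lemma Complex_measurable [measurable]:
  assumes [measurable]: "f \<in> borel_measurable M" "g \<in> borel_measurable M"
  shows "(\<lambda>x. Complex (f x) (g x)) \<in> borel_measurable M"
  unfolding Complex_eq by measurable

text \<open>With one coordinate fixed a shear translates the other, so Fubini and translation
  invariance on the line suffice.\<close>

lemma nn_integral_shear:
  fixes f :: "complex \<Rightarrow> ennreal"
  assumes [measurable]: "f \<in> borel_measurable borel"
  shows "(\<integral>\<^sup>+z. f (Complex (Re z + k * Im z) (Im z)) \<partial>lborel) = (\<integral>\<^sup>+z. f z \<partial>lborel)"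
    and "(\<integral>\<^sup>+z. f (Complex (Re z) (Im z + k * Re z)) \<partial>lborel) = (\<integral>\<^sup>+z. f z \<partial>lborel)"
proof -
  have tr: "(\<integral>\<^sup>+x. g (x + t) \<partial>lborel) = (\<integral>\<^sup>+x. g x \<partial>lborel)"
    if [measurable]: "g \<in> borel_measurable borel" for g :: "real \<Rightarrow> ennreal" and t
    using nn_integral_real_affine[of g 1 t] by (simp add: add.commute)
  show "(\<integral>\<^sup>+z. f (Complex (Re z + k * Im z) (Im z)) \<partial>lborel) = (\<integral>\<^sup>+z. f z \<partial>lborel)"
    by (subst (1 2) nn_integral_lborel_complex(2), simp, simp, simp,
        intro nn_integral_cong tr[where g = "\<lambda>x. f (Complex x _)"]) simp
  show "(\<integral>\<^sup>+z. f (Complex (Re z) (Im z + k * Re z)) \<partial>lborel) = (\<integral>\<^sup>+z. f z \<partial>lborel)"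
    by (subst (1 2) nn_integral_lborel_complex(1), simp, simp, simp,
        intro nn_integral_cong tr[where g = "\<lambda>y. f (Complex _ y)"]) simp
qed

text \<open>Away from a half turn a rotation is a product of three shears.\<close>

lemma nn_integral_rotate:
  fixes f :: "complex \<Rightarrow> ennreal"
  assumes [measurable]: "f \<in> borel_measurable borel"
  shows "(\<integral>\<^sup>+z. f (z * cis t) \<partial>lborel) = (\<integral>\<^sup>+z. f z \<partial>lborel)"
proof -
  have main: "(\<integral>\<^sup>+z. f (z * cis t) \<partial>lborel) = (\<integral>\<^sup>+z. f z \<partial>lborel)"
    if nz: "cos t \<noteq> -1" and [measurable]: "f \<in> borel_measurable borel" for f :: "complex \<Rightarrow> ennreal" and t
  proof -
    \<comment> \<open>This is -tan (t/2), the slope of the two outer shears; the middle one has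
      slope sin t. A half turn would make it infinite.\<close>
    define k where "k = - sin t / (1 + cos t)"
    have nz': "1 + cos t \<noteq> 0" using nz by linarith
    have "sin t * sin t = (1 - cos t) * (1 + cos t)"
      using sin_cos_squared_add[of t] by (simp add: power2_eq_square algebra_simps)
    then have k1: "1 + sin t * k = cos t" and k2: "k * (1 + cos t) = - sin t"
      using nz' by (simp_all add: k_def field_simps)
    define g where "g z = f (Complex (Re z + k * Im z) (Im z))" for z
    define h where "h z = g (Complex (Re z) (Im z + sin t * Re z))" for z
    have [measurable]: "g \<in> borel_measurable borel" "h \<in> borel_measurable borel"
      unfolding g_def[abs_def] h_def[abs_def] by measurable
    have "f (z * cis t) = h (Complex (Re z + k * Im z) (Im z))" for z
    proof -
      have im: "Im z + sin t * (Re z + k * Im z) = sin t * Re z + cos t * Im z"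
        unfolding k1[symmetric] by (simp add: algebra_simps)
      have "Re z + k * Im z + k * (sin t * Re z + cos t * Im z)
          = (1 + sin t * k) * Re z + (k * (1 + cos t)) * Im z" by (simp add: algebra_simps)
      also have "\<dots> = cos t * Re z - sin t * Im z" unfolding k1 k2 by simp
      finally have re: "Re z + k * Im z + k * (sin t * Re z + cos t * Im z) = cos t * Re z - sin t * Im z" .
      have "z * cis t = Complex (cos t * Re z - sin t * Im z) (sin t * Re z + cos t * Im z)"
        by (rule complex_eqI) (simp_all add: algebra_simps)
      then show ?thesis by (simp only: h_def g_def complex.sel im re)
    qed
    then have "(\<integral>\<^sup>+z. f (z * cis t) \<partial>lborel) = (\<integral>\<^sup>+z. h (Complex (Re z + k * Im z) (Im z)) \<partial>lborel)"
      by (simp only:)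
    also have "\<dots> = (\<integral>\<^sup>+z. h z \<partial>lborel)" by (rule nn_integral_shear(1)[of h k]) fact
    also have "\<dots> = (\<integral>\<^sup>+z. g z \<partial>lborel)" unfolding h_def by (rule nn_integral_shear(2)[of g "sin t"]) fact
    also have "\<dots> = (\<integral>\<^sup>+z. f z \<partial>lborel)" unfolding g_def by (rule nn_integral_shear(1)[of f k]) fact
    finally show ?thesis .
  qed
  show ?thesis
  proof (cases "cos t = -1")
    case True
    \<comment> \<open>The half turn is carried out as two rotations by t/2, and these avoid the
      exceptional case.\<close>
    have "cos (t / 2) \<noteq> -1"
    proof
      assume "cos (t / 2) = -1"
      then have "cos t = 1" using cos_double_cos[of "t / 2"] by simp
      then show False using True by simp
    qed
    from main[OF this, of f] main[OF this, of "\<lambda>z. f (z * cis (t / 2))"]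
    show ?thesis by (simp add: mult.assoc cis_mult)
  qed (rule main, use assms in auto)
qed

lemma emeasure_unit_disc: "emeasure lborel (ball (0::complex) 1) = ennreal pi"
  using emeasure_ball[of 1 "0::complex"] by (simp add: unit_ball_vol_2)

lemma prob_space_area_measure: "prob_space area_measure"
  unfolding area_measure_def by (rule prob_space_uniform_measure) (auto simp: emeasure_unit_disc)

interpretation area: prob_space area_measure
  by (rule prob_space_area_measure)

lemma sets_area_measure [measurable_cong, simp]: "sets area_measure = sets borel"
  by (simp add: area_measure_def)

lemma space_area_measure [simp]: "space area_measure = UNIV"
  by (simp add: area_measure_def)

lemma AE_area_measure: "AE z in area_measure. cmod z < 1"
  unfolding area_measure_def by (rule AE_uniform_measureI) auto

lemma nn_integral_area_rotate:
  fixes f :: "complex \<Rightarrow> ennreal"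
  assumes [measurable]: "f \<in> borel_measurable borel"
  shows "(\<integral>\<^sup>+z. f (z * cis t) \<partial>area_measure) = (\<integral>\<^sup>+z. f z \<partial>area_measure)"
proof -
  have [measurable]: "ball (0::complex) 1 \<in> sets borel" by simp
  have "(\<integral>\<^sup>+z. f (z * cis t) * indicator (ball 0 1) z \<partial>lborel) = (\<integral>\<^sup>+z. f (z * cis t) * indicator (ball 0 1) (z * cis t) \<partial>lborel)"
    by (intro nn_integral_cong) (auto simp: indicator_def norm_mult)
  also have "\<dots> = (\<integral>\<^sup>+z. f z * indicator (ball 0 1) z \<partial>lborel)"
    by (rule nn_integral_rotate[where f = "\<lambda>z. f z * indicator (ball 0 1) z"]) measurable
  finally show ?thesis
    unfolding area_measure_def by (subst (1 2) nn_integral_uniform_measure) auto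
qed

text \<open>The angular half of polar coordinates: rotation invariance inserts an average over
  angles, to which Parseval's identity applies.\<close>

lemma nn_integral_area_average:
  fixes f :: "complex \<Rightarrow> ennreal"
  assumes [measurable]: "f \<in> borel_measurable borel"
  shows "(\<integral>\<^sup>+z. f z \<partial>area_measure) = (\<integral>\<^sup>+z. \<integral>\<^sup>+t. f (z * cis t) \<partial>arc_measure \<partial>area_measure)"
proof -
  interpret P: pair_sigma_finite area_measure arc_measure ..
  have "(\<integral>\<^sup>+z. f z \<partial>area_measure) = (\<integral>\<^sup>+t. \<integral>\<^sup>+z. f (z * cis t) \<partial>area_measure \<partial>arc_measure)"
    using arc.emeasure_space_1 by (simp add: nn_integral_area_rotate)
  also have "\<dots> = (\<integral>\<^sup>+z. \<integral>\<^sup>+t. f (z * cis t) \<partial>arc_measure \<partial>area_measure)"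
    by (rule P.Fubini') measurable
  finally show ?thesis .
qed

text \<open>The radial half of polar coordinates: for 0 \<le> x < 1 the set where |z|^2 \<le> x is a
  disc of normalized area x, so the distribution functions coincide.\<close>

lemma area_norm_square_uniform:
  "distr area_measure borel (\<lambda>z. (cmod z)\<^sup>2) = uniform_measure lborel {0..1}"
proof (rule cdf_unique)
  show "real_distribution (distr area_measure borel (\<lambda>z. (cmod z)\<^sup>2))"
    by (rule area.real_distribution_distr) measurable
  have "prob_space (uniform_measure lborel {0..1::real})"
    by (rule prob_space_uniform_measure) auto
  then show "real_distribution (uniform_measure lborel {0..1})"
    by (intro real_distribution.intro real_distribution_axioms.intro) auto
  show "cdf (distr area_measure borel (\<lambda>z. (cmod z)\<^sup>2)) = cdf (uniform_measure lborel {0..1})"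
  proof
    fix x :: real
    have vol: "measure lborel (cball (0::complex) r) = pi * r\<^sup>2" if "r \<ge> 0" for r
      using content_cball[of r "0::complex"] that by (simp add: unit_ball_vol_2)
    have "cdf (distr area_measure borel (\<lambda>z. (cmod z)\<^sup>2)) x = measure area_measure {z. (cmod z)\<^sup>2 \<le> x}"
      by (simp add: cdf_def measure_distr vimage_def)
    also have "\<dots> = measure lborel (ball 0 1 \<inter> {z. (cmod z)\<^sup>2 \<le> x}) / pi"
      unfolding area_measure_def
      by (subst measure_uniform_measure) (auto simp: emeasure_unit_disc measure_def)
    also have "\<dots> = (if x < 0 then 0 else if x < 1 then x else 1)"
    proof -
      consider "x < 0" | "0 \<le> x" "x < 1" | "1 \<le> x" by linarith
      then show ?thesis
      proof cases
        case 1
        then have "{z. (cmod z)\<^sup>2 \<le> x} = {}" by (auto simp: not_le intro: less_le_trans)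
        then show ?thesis using 1 by simp
      next
        case 2
        have le_iff: "(cmod z)\<^sup>2 \<le> x \<longleftrightarrow> cmod z \<le> sqrt x" for z
          using real_sqrt_le_iff[of "(cmod z)\<^sup>2" x] by simp
        have "sqrt x < 1" using 2 by simp
        then have "cmod z < 1" if "cmod z \<le> sqrt x" for z
          using that by linarith
        then have eq: "ball 0 1 \<inter> {z. (cmod z)\<^sup>2 \<le> x} = cball (0::complex) (sqrt x)"
          unfolding le_iff by auto
        have "measure lborel (cball (0::complex) (sqrt x)) = pi * (sqrt x)\<^sup>2"
          by (rule vol, rule real_sqrt_ge_zero, rule 2(1))
        also have "(sqrt x)\<^sup>2 = x" by (rule real_sqrt_pow2, rule 2(1))
        finally have "measure lborel (cball (0::complex) (sqrt x)) = pi * x" .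
        then show ?thesis unfolding eq using 2 by simp
      next
        case 3
        have "(cmod z)\<^sup>2 \<le> x" if "cmod z < 1" for z
          using power_le_one[OF norm_ge_zero less_imp_le[OF that], of 2] 3 by linarith
        then have eq: "ball 0 1 \<inter> {z. (cmod z)\<^sup>2 \<le> x} = ball (0::complex) 1"
          by (auto simp: dist_norm)
        show ?thesis unfolding eq using 3 by (simp add: measure_def emeasure_unit_disc)
      qed
    qed
    also have "\<dots> = cdf (uniform_measure lborel {0..1}) x"
    proof -
      have "{0..1} \<inter> {..x} = {0..min 1 x}" by auto
      moreover have "measure (uniform_measure lborel {0..1}) {..x} = measure lborel ({0..1} \<inter> {..x}) / measure lborel {0..1::real}"
        by (rule measure_uniform_measure) auto
      moreover have "measure lborel {0..min 1 x} = (if x < 0 then 0 else min 1 x)"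
        by (cases "x < 0") (simp_all add: min_def)
      moreover have "measure lborel {0..1::real} = 1" by simp
      ultimately have "cdf (uniform_measure lborel {0..1}) x = (if x < 0 then 0 else min 1 x)"
        unfolding cdf_def by (simp only: div_by_1)
      then show ?thesis by (simp only: min_def) auto
    qed
    finally show "cdf (distr area_measure borel (\<lambda>z. (cmod z)\<^sup>2)) x = cdf (uniform_measure lborel {0..1}) x" .
  qed
qed

lemma nn_integral_area_weight:
  "(\<integral>\<^sup>+z. ennreal (1 - (cmod z)\<^sup>2) * ennreal ((cmod z)\<^sup>2 ^ n) \<partial>area_measure) = ennreal (weight n)"
proof -
  have "(\<integral>\<^sup>+z. ennreal (1 - (cmod z)\<^sup>2) * ennreal ((cmod z)\<^sup>2 ^ n) \<partial>area_measure)
      = (\<integral>\<^sup>+s. ennreal (1 - s) * ennreal (s ^ n) \<partial>distr area_measure borel (\<lambda>z. (cmod z)\<^sup>2))"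
    by (subst nn_integral_distr) auto
  also have "\<dots> = (\<integral>\<^sup>+s. ennreal (1 - s) * ennreal (s ^ n) * indicator {0..1} s \<partial>lborel)"
    unfolding area_norm_square_uniform
    by (subst nn_integral_uniform_measure) (auto simp: divide_ennreal_def)
  also have "\<dots> = (\<integral>\<^sup>+s. ennreal ((1 - s) * s ^ n) * indicator {0..1} s \<partial>lborel)"
    by (intro nn_integral_cong) (auto simp: ennreal_mult split: split_indicator)
  also have "\<dots> = ennreal ((1 ^ Suc n / real (Suc n) - 1 ^ Suc (Suc n) / real (Suc (Suc n)))
       - (0 ^ Suc n / real (Suc n) - 0 ^ Suc (Suc n) / real (Suc (Suc n))))"
  proof (rule nn_integral_FTC_Icc)
    fix s :: real assume "s \<in> {0..1}"
    show "((\<lambda>s. s ^ Suc n / real (Suc n) - s ^ Suc (Suc n) / real (Suc (Suc n))) has_real_derivative (1 - s) * s ^ n) (at s)"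
      by (auto intro!: derivative_eq_intros simp: algebra_simps simp del: of_nat_Suc power_Suc)
        (simp add: algebra_simps)
  qed auto
  also have "\<dots> = ennreal (weight n)"
    by (simp add: weight_def field_simps)
  finally show ?thesis .
qed

section \<open>Power series on the disc weighted by Poisson kernels\<close>

lemma powser_abs_summable:
  fixes c :: "nat \<Rightarrow> complex"
  assumes "\<And>z. cmod z < 1 \<Longrightarrow> summable (\<lambda>n. c n * z ^ n)" and z: "cmod z < 1"
  shows "summable (\<lambda>n. cmod (c n * z ^ n))"
proof -
  obtain r where r: "cmod z < r" "r < 1" using dense z by blast
  have "r > 0" using r(1) norm_ge_zero[of z] by linarith
  then have "summable (\<lambda>n. c n * of_real r ^ n)" using assms(1)[of "of_real r"] r by simp
  then show ?thesis by (rule powser_insidea) (use r \<open>r > 0\<close> in simp)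
qed

text \<open>Here \<open>c\<close> holds the coefficients of the derivative. Division by \<zeta> - z
  turns coefficients into partial sums up to unimodular factors; angular averaging and Parseval then
  separate the powers of z, and integrating 1 - |z|^2 against each yields
  \<open>weight n\<close>.\<close>

lemma local_dirichlet_integral:
  fixes c :: "nat \<Rightarrow> complex"
  assumes c: "\<And>z. cmod z < 1 \<Longrightarrow> summable (\<lambda>n. c n * z ^ n)" and \<zeta>: "cmod \<zeta> = 1"
  shows "(\<integral>\<^sup>+z. ennreal ((1 - (cmod z)\<^sup>2) / (cmod (\<zeta> - z))\<^sup>2 * (cmod (\<Sum>n. c n * z ^ n))\<^sup>2) \<partial>area_measure)
    = (\<Sum>n. ennreal (weight n * (cmod (\<Sum>k\<le>n. c k * \<zeta> ^ k))\<^sup>2))"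
proof -
  have \<zeta>_cnj: "\<zeta> * cnj \<zeta> = 1" using \<zeta> by (metis complex_norm_square of_real_1 power_one)
  \<comment> \<open>Coefficients of the quotient by \<zeta> - z: since cnj \<zeta> = 1/\<zeta>, the
    factor 1/(\<zeta> - z) is the geometric series with coefficients
    \<open>cnj \<zeta> ^ Suc n\<close>, and \<open>h\<close> is the Cauchy product. Multiplying
    \<open>h n\<close> by \<open>\<zeta> ^ Suc n\<close> gives the partial sum of c k
    \<zeta>^k.\<close>
  define h where "h n = (\<Sum>k\<le>n. c k * cnj \<zeta> ^ Suc (n - k))" for n
  have h_norm: "cmod (h n) = cmod (\<Sum>k\<le>n. c k * \<zeta> ^ k)" for n
  proof -
    have "\<zeta> ^ Suc n * (c k * cnj \<zeta> ^ Suc (n - k)) = c k * \<zeta> ^ k" if "k \<le> n" for k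
    proof -
      have "\<zeta> ^ Suc n = \<zeta> ^ k * \<zeta> ^ Suc (n - k)"
        using that by (simp flip: power_add)
      then show ?thesis
        using \<zeta>_cnj power_mult_distrib[of \<zeta> "cnj \<zeta>" "Suc (n - k)"] by (simp add: mult_ac del: power_Suc)
    qed
    then have "\<zeta> ^ Suc n * h n = (\<Sum>k\<le>n. c k * \<zeta> ^ k)"
      unfolding h_def sum_distrib_left by (intro sum.cong) auto
    then have "cmod (\<Sum>k\<le>n. c k * \<zeta> ^ k) = cmod (\<zeta> ^ Suc n) * cmod (h n)"
      by (metis norm_mult)
    then show ?thesis by (simp add: norm_power \<zeta> del: power_Suc)
  qed
  have h: "(\<lambda>n. h n * z ^ n) sums ((\<Sum>n. c n * z ^ n) / (\<zeta> - z))" if z: "cmod z < 1" for z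
  proof -
    have g: "cmod (cnj \<zeta> * z) < 1" using z \<zeta> by (simp add: norm_mult)
    have gs: "(\<lambda>n. cnj \<zeta> * (cnj \<zeta> * z) ^ n) sums (cnj \<zeta> * (1 / (1 - cnj \<zeta> * z)))"
      using geometric_sums[OF g] by (rule sums_mult)
    have "summable (\<lambda>n. cmod (cnj \<zeta> * (cnj \<zeta> * z) ^ n))"
      using g by (simp add: norm_mult norm_power \<zeta> summable_geometric)
    from Cauchy_product_sums[OF powser_abs_summable[OF c z] this]
    have "(\<lambda>k. \<Sum>i\<le>k. c i * z ^ i * (cnj \<zeta> * (cnj \<zeta> * z) ^ (k - i))) sums
        ((\<Sum>n. c n * z ^ n) * (\<Sum>n. cnj \<zeta> * (cnj \<zeta> * z) ^ n))" .
    moreover have "(\<Sum>i\<le>k. c i * z ^ i * (cnj \<zeta> * (cnj \<zeta> * z) ^ (k - i))) = h k * z ^ k" for k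
    proof -
      have "z ^ i * z ^ (k - i) = z ^ k" if "i \<le> k" for i using that by (simp flip: power_add)
      then show ?thesis
        unfolding h_def sum_distrib_right
        by (intro sum.cong refl) (auto simp: power_mult_distrib mult_ac)
    qed
    moreover have "(\<Sum>n. cnj \<zeta> * (cnj \<zeta> * z) ^ n) = 1 / (\<zeta> - z)"
    proof -
      have "\<zeta> - z = \<zeta> * (1 - cnj \<zeta> * z)" using \<zeta>_cnj by (simp add: algebra_simps)
      moreover have "cnj \<zeta> = 1 / \<zeta>" using \<zeta>_cnj by (metis nonzero_eq_divide_eq mult.commute mult_zero_left zero_neq_one)
      ultimately show ?thesis unfolding sums_unique[OF gs, symmetric] by simp
    qed
    ultimately show ?thesis by simp
  qed
  define f where "f z = ennreal (1 - (cmod z)\<^sup>2) * ennreal ((cmod (\<Sum>n. h n * z ^ n))\<^sup>2)" for z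
  have [measurable]: "f \<in> borel_measurable borel" unfolding f_def[abs_def] by measurable
  have sq_less: "(cmod z)\<^sup>2 \<le> 1" if "cmod z < 1" for z
    using that by (simp add: power_le_one)
  have "(\<integral>\<^sup>+z. ennreal ((1 - (cmod z)\<^sup>2) / (cmod (\<zeta> - z))\<^sup>2 * (cmod (\<Sum>n. c n * z ^ n))\<^sup>2) \<partial>area_measure)
      = (\<integral>\<^sup>+z. f z \<partial>area_measure)"
  proof (rule nn_integral_cong_AE, use AE_area_measure in eventually_elim)
    fix z assume z: "cmod z < 1"
    show "ennreal ((1 - (cmod z)\<^sup>2) / (cmod (\<zeta> - z))\<^sup>2 * (cmod (\<Sum>n. c n * z ^ n))\<^sup>2) = f z"
      using sq_less[OF z] unfolding f_def sums_unique[OF h[OF z], symmetric]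
      by (simp add: norm_divide power_divide flip: ennreal_mult)
  qed
  also have "\<dots> = (\<integral>\<^sup>+z. \<integral>\<^sup>+t. f (z * cis t) \<partial>arc_measure \<partial>area_measure)"
    by (rule nn_integral_area_average) measurable
  also have "\<dots> = (\<integral>\<^sup>+z. (\<Sum>n. ennreal ((cmod (h n))\<^sup>2) * (ennreal (1 - (cmod z)\<^sup>2) * ennreal ((cmod z)\<^sup>2 ^ n))) \<partial>area_measure)"
  proof (rule nn_integral_cong_AE, use AE_area_measure in eventually_elim)
    fix z assume z: "cmod z < 1"
    have "(\<integral>\<^sup>+t. f (z * cis t) \<partial>arc_measure) = ennreal (1 - (cmod z)\<^sup>2) *
        (\<integral>\<^sup>+t. ennreal ((cmod (\<Sum>n. h n * z ^ n * cis (real n * t)))\<^sup>2) \<partial>arc_measure)"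
      by (subst nn_integral_cmult[symmetric])
        (auto simp: f_def norm_mult power_mult_distrib Complex.DeMoivre mult_ac)
    also have "\<dots> = ennreal (1 - (cmod z)\<^sup>2) * (\<Sum>n. ennreal ((cmod (h n * z ^ n))\<^sup>2))"
      by (simp only: parseval_arc[OF powser_abs_summable[OF sums_summable[OF h] z]])
    also have "\<dots> = (\<Sum>n. ennreal ((cmod (h n))\<^sup>2) * (ennreal (1 - (cmod z)\<^sup>2) * ennreal ((cmod z)\<^sup>2 ^ n)))"
      unfolding ennreal_suminf_cmult[symmetric]
    proof (intro suminf_cong)
      fix n
      have "(cmod (h n * z ^ n))\<^sup>2 = (cmod (h n))\<^sup>2 * (cmod z)\<^sup>2 ^ n"
        by (simp add: norm_mult norm_power power_mult_distrib mult.commute flip: power_mult)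
      moreover have "ennreal u * ennreal (v * w) = ennreal v * (ennreal u * ennreal w)" if "v \<ge> 0" "w \<ge> 0" for u v w
        using that by (simp add: ennreal_mult mult_ac)
      ultimately show "ennreal (1 - (cmod z)\<^sup>2) * ennreal ((cmod (h n * z ^ n))\<^sup>2)
          = ennreal ((cmod (h n))\<^sup>2) * (ennreal (1 - (cmod z)\<^sup>2) * ennreal ((cmod z)\<^sup>2 ^ n))"
        by simp
    qed
    finally show "(\<integral>\<^sup>+t. f (z * cis t) \<partial>arc_measure)
        = (\<Sum>n. ennreal ((cmod (h n))\<^sup>2) * (ennreal (1 - (cmod z)\<^sup>2) * ennreal ((cmod z)\<^sup>2 ^ n)))" .
  qed
  also have "\<dots> = (\<Sum>n. ennreal ((cmod (h n))\<^sup>2) * ennreal (weight n))"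
    by (subst nn_integral_suminf) (auto simp: nn_integral_cmult nn_integral_area_weight)
  also have "\<dots> = (\<Sum>n. ennreal (weight n * (cmod (\<Sum>k\<le>n. c k * \<zeta> ^ k))\<^sup>2))"
    using less_imp_le[OF weight_pos] by (simp add: h_norm mult.commute flip: ennreal_mult)
  finally show ?thesis .
qed

lemma dirichlet_integral_disc:
  fixes c :: "nat \<Rightarrow> complex"
  assumes \<mu>: "circle_measure \<mu>" and c: "\<And>z. cmod z < 1 \<Longrightarrow> summable (\<lambda>n. c n * z ^ n)"
  shows "(\<integral>\<^sup>+z. ennreal (poisson \<mu> z * (cmod (\<Sum>n. c n * z ^ n))\<^sup>2) \<partial>area_measure)
    = (\<Sum>n. \<integral>\<^sup>+\<zeta>. ennreal (weight n * (cmod (\<Sum>k\<le>n. c k * \<zeta> ^ k))\<^sup>2) \<partial>\<mu>)"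
proof -
  interpret finite_measure \<mu> using \<mu> by (simp add: circle_measure_def)
  have sets: "sets \<mu> = sets (restrict_space borel (sphere 0 1))"
    using \<mu> by (simp add: circle_measure_def)
  have space: "space \<mu> = sphere 0 1"
    using sets_eq_imp_space_eq[OF sets] by (simp add: space_restrict_space)
  have [measurable]: "(\<lambda>\<zeta>. \<zeta>) \<in> \<mu> \<rightarrow>\<^sub>M borel"
    unfolding measurable_cong_sets[OF sets refl] by (intro measurable_restrict_space1) simp
  interpret P: pair_sigma_finite area_measure \<mu> ..
  have G [measurable]: "(\<lambda>z. \<Sum>n. c n * z ^ n) \<in> borel_measurable borel" by measurable
  have "(\<integral>\<^sup>+z. ennreal (poisson \<mu> z * (cmod (\<Sum>n. c n * z ^ n))\<^sup>2) \<partial>area_measure)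
      = (\<integral>\<^sup>+z. \<integral>\<^sup>+\<zeta>. ennreal ((1 - (cmod z)\<^sup>2) / (cmod (\<zeta> - z))\<^sup>2 * (cmod (\<Sum>n. c n * z ^ n))\<^sup>2) \<partial>\<mu> \<partial>area_measure)"
  proof (rule nn_integral_cong_AE, use AE_area_measure in eventually_elim)
    fix z assume z: "cmod z < 1"
    have nonneg: "0 \<le> (1 - (cmod z)\<^sup>2) / (cmod (\<zeta> - z))\<^sup>2" for \<zeta>
      using z by (simp add: power_le_one)
    \<comment> \<open>\<open>poisson\<close> is a Bochner integral and would default to 0 without
      integrability. This bound, uniform in \<zeta>, secures integrability, so it may be rewritten
      as a nonnegative integral and Fubini applies.\<close>
    have bound: "(1 - (cmod z)\<^sup>2) / (cmod (\<zeta> - z))\<^sup>2 \<le> 1 / (1 - cmod z)\<^sup>2" if "\<zeta> \<in> space \<mu>" for \<zeta>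
    proof (rule frac_le)
      have "1 - cmod z \<le> cmod (\<zeta> - z)"
        using that norm_triangle_ineq2[of \<zeta> z] by (simp add: space)
      then show "(1 - cmod z)\<^sup>2 \<le> (cmod (\<zeta> - z))\<^sup>2" using z by (intro power_mono) auto
    qed (use z in auto)
    have "integrable \<mu> (\<lambda>\<zeta>. (1 - (cmod z)\<^sup>2) / (cmod (\<zeta> - z))\<^sup>2)"
    proof (rule integrable_const_bound[of _ "1 / (1 - cmod z)\<^sup>2"])
      show "AE \<zeta> in \<mu>. norm ((1 - (cmod z)\<^sup>2) / (cmod (\<zeta> - z))\<^sup>2) \<le> 1 / (1 - cmod z)\<^sup>2"
        by (rule AE_I2) (simp only: real_norm_def abs_of_nonneg[OF nonneg] bound)
    qed measurable
    then have "integrable \<mu> (\<lambda>\<zeta>. (1 - (cmod z)\<^sup>2) / (cmod (\<zeta> - z))\<^sup>2 * (cmod (\<Sum>n. c n * z ^ n))\<^sup>2)"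
      by (rule integrable_mult_left)
    then have "(\<integral>\<^sup>+\<zeta>. ennreal ((1 - (cmod z)\<^sup>2) / (cmod (\<zeta> - z))\<^sup>2 * (cmod (\<Sum>n. c n * z ^ n))\<^sup>2) \<partial>\<mu>)
        = ennreal (LINT \<zeta>|\<mu>. (1 - (cmod z)\<^sup>2) / (cmod (\<zeta> - z))\<^sup>2 * (cmod (\<Sum>n. c n * z ^ n))\<^sup>2)"
      by (rule nn_integral_eq_integral) (rule AE_I2, rule mult_nonneg_nonneg[OF nonneg], simp)
    also have "(LINT \<zeta>|\<mu>. (1 - (cmod z)\<^sup>2) / (cmod (\<zeta> - z))\<^sup>2 * (cmod (\<Sum>n. c n * z ^ n))\<^sup>2)
        = poisson \<mu> z * (cmod (\<Sum>n. c n * z ^ n))\<^sup>2"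
      unfolding poisson_def by (rule integral_mult_left_zero)
    finally show "ennreal (poisson \<mu> z * (cmod (\<Sum>n. c n * z ^ n))\<^sup>2)
       = (\<integral>\<^sup>+\<zeta>. ennreal ((1 - (cmod z)\<^sup>2) / (cmod (\<zeta> - z))\<^sup>2 * (cmod (\<Sum>n. c n * z ^ n))\<^sup>2) \<partial>\<mu>)" ..
  qed
  also have "\<dots> = (\<integral>\<^sup>+\<zeta>. \<integral>\<^sup>+z. ennreal ((1 - (cmod z)\<^sup>2) / (cmod (\<zeta> - z))\<^sup>2 * (cmod (\<Sum>n. c n * z ^ n))\<^sup>2) \<partial>area_measure \<partial>\<mu>)"
    by (rule P.Fubini'[symmetric]) measurable
  also have "\<dots> = (\<integral>\<^sup>+\<zeta>. (\<Sum>n. ennreal (weight n * (cmod (\<Sum>k\<le>n. c k * \<zeta> ^ k))\<^sup>2)) \<partial>\<mu>)"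
    by (intro nn_integral_cong local_dirichlet_integral c) (auto simp: space)
  also have "\<dots> = (\<Sum>n. \<integral>\<^sup>+\<zeta>. ennreal (weight n * (cmod (\<Sum>k\<le>n. c k * \<zeta> ^ k))\<^sup>2) \<partial>\<mu>)"
    by (rule nn_integral_suminf) measurable
  finally show ?thesis .
qed

section \<open>Power series on the bidisc\<close>

lemma infsum_nat_eq_suminf:
  fixes f :: "nat \<Rightarrow> 'a::banach"
  assumes "summable (\<lambda>n. norm (f n))"
  shows "infsum f UNIV = suminf f"
  by (rule infsumI[OF norm_summable_imp_has_sum[OF assms summable_sums[OF summable_norm_cancel[OF assms]]]])

lemma suminf_swap_geometric:
  fixes f :: "nat \<Rightarrow> nat \<Rightarrow> complex"
  assumes bound: "\<And>m n. cmod (f m n) \<le> B * x ^ m * y ^ n"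
    and x: "0 \<le> x" "x < 1" and y: "0 \<le> y" "y < 1"
  shows "(\<Sum>m. \<Sum>n. f m n) = (\<Sum>n. \<Sum>m. f m n)"
proof -
  have B: "0 \<le> B" using order_trans[OF norm_ge_zero bound[of 0 0]] by simp
  have row: "summable (\<lambda>n. cmod (f m n))" and row_le: "cmod (\<Sum>n. f m n) \<le> B * x ^ m / (1 - y)" for m
  proof -
    have g: "(\<lambda>n. B * x ^ m * y ^ n) sums (B * x ^ m * (1 / (1 - y)))"
      using y by (intro sums_mult geometric_sums) simp
    show 1: "summable (\<lambda>n. cmod (f m n))"
      by (rule summable_comparison_test'[OF sums_summable[OF g], of 0]) (simp add: bound)
    have "cmod (\<Sum>n. f m n) \<le> (\<Sum>n. cmod (f m n))" by (rule summable_norm[OF 1])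
    also have "\<dots> \<le> (\<Sum>n. B * x ^ m * y ^ n)" by (rule suminf_le[OF bound 1 sums_summable[OF g]])
    also have "\<dots> = B * x ^ m / (1 - y)" using sums_unique[OF g] by simp
    finally show "cmod (\<Sum>n. f m n) \<le> B * x ^ m / (1 - y)" .
  qed
  have col: "summable (\<lambda>m. cmod (f m n))" and col_le: "cmod (\<Sum>m. f m n) \<le> B * y ^ n / (1 - x)" for n
  proof -
    have g: "(\<lambda>m. B * y ^ n * x ^ m) sums (B * y ^ n * (1 / (1 - x)))"
      using x by (intro sums_mult geometric_sums) simp
    have bound': "cmod (f m n) \<le> B * y ^ n * x ^ m" for m using bound[of m n] by (simp add: mult_ac)
    show 1: "summable (\<lambda>m. cmod (f m n))"
      by (rule summable_comparison_test'[OF sums_summable[OF g], of 0]) (simp add: bound')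
    have "cmod (\<Sum>m. f m n) \<le> (\<Sum>m. cmod (f m n))" by (rule summable_norm[OF 1])
    also have "\<dots> \<le> (\<Sum>m. B * y ^ n * x ^ m)" by (rule suminf_le[OF bound' 1 sums_summable[OF g]])
    also have "\<dots> = B * y ^ n / (1 - x)" using sums_unique[OF g] by simp
    finally show "cmod (\<Sum>m. f m n) \<le> B * y ^ n / (1 - x)" .
  qed
  have geo: "summable (\<lambda>n. C * t ^ n / D)" if "0 \<le> t" "t < 1" for C D t :: real
    using that by (intro summable_divide summable_mult summable_geometric) simp
  have rows: "summable (\<lambda>m. cmod (\<Sum>n. f m n))"
    by (rule summable_comparison_test'[OF geo[OF x, of B "1 - y"], of 0]) (simp add: row_le)
  have cols: "summable (\<lambda>n. cmod (\<Sum>m. f m n))"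
    by (rule summable_comparison_test'[OF geo[OF y, of B "1 - x"], of 0]) (simp add: col_le)
  have "(\<lambda>p. norm (B * x ^ fst p * y ^ snd p)) summable_on (UNIV \<times> UNIV)"
    unfolding Infinite_Sum.abs_summable_on_Sigma_iff fst_conv snd_conv
  proof (intro conjI ballI)
    have g: "(\<lambda>n. norm (B * x ^ m * y ^ n)) sums (B * x ^ m / (1 - y))" for m
      using geometric_sums[of y] y x B sums_mult[of "\<lambda>n. y ^ n" "1 / (1 - y)" "B * x ^ m"] by simp
    show "(\<lambda>n. norm (B * x ^ m * y ^ n)) summable_on UNIV" for m
      by (rule norm_summable_imp_summable_on) (use sums_summable[OF g[of m]] in simp)
    have "infsum (\<lambda>n. norm (B * x ^ m * y ^ n)) UNIV = B * x ^ m / (1 - y)" for m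
      using infsum_nat_eq_suminf[of "\<lambda>n. norm (B * x ^ m * y ^ n)"] sums_summable[OF g[of m]] sums_unique[OF g[of m]]
      by simp
    then show "(\<lambda>m. norm (infsum (\<lambda>n. norm (B * x ^ m * y ^ n)) UNIV)) summable_on UNIV"
      using geo[OF x, of B "1 - y"] x y B
      by (intro norm_summable_imp_summable_on) simp
  qed
  then have "(\<lambda>p. norm (f (fst p) (snd p))) summable_on (UNIV \<times> UNIV)"
  proof (rule Infinite_Sum.abs_summable_on_comparison_test)
    show "norm (f (fst p) (snd p)) \<le> norm (B * x ^ fst p * y ^ snd p)" for p
      using bound[of "fst p" "snd p"] by (simp add: order_trans[OF _ abs_ge_self])
  qed
  then have "(\<lambda>(m, n). f m n) summable_on (UNIV \<times> UNIV)"
    unfolding case_prod_beta by (rule abs_summable_summable)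
  from infsum_swap_banach[OF this] show ?thesis
    by (simp add: infsum_nat_eq_suminf row col rows cols)
qed

definition column :: "(nat \<Rightarrow> nat \<Rightarrow> complex) \<Rightarrow> nat \<Rightarrow> complex \<Rightarrow> complex" where
  "column a n z = (\<Sum>m. a m n * z ^ m)"

definition dcolumn :: "(nat \<Rightarrow> nat \<Rightarrow> complex) \<Rightarrow> nat \<Rightarrow> complex \<Rightarrow> complex" where
  "dcolumn a n z = (\<Sum>m. of_nat (Suc m) * a (Suc m) n * z ^ m)"

text \<open>The iterated sum makes this a one-variable power series in the second coordinate with
  column functions as coefficients, so Parseval can be applied one variable at a time. The value 0
  off the bidisc follows the convention for Hardy functions.\<close>

definition bpower :: "(nat \<Rightarrow> nat \<Rightarrow> complex) \<Rightarrow> complex \<times> complex \<Rightarrow> complex" where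
  "bpower a p = (if p \<in> bidisc then \<Sum>n. column a n (fst p) * snd p ^ n else 0)"

lemma in_bidisc: "(z, w) \<in> bidisc \<longleftrightarrow> cmod z < 1 \<and> cmod w < 1"
  by simp

lemma column_measurable [measurable]: "column a n \<in> borel_measurable borel"
  and dcolumn_measurable [measurable]: "dcolumn a n \<in> borel_measurable borel"
  unfolding column_def[abs_def] dcolumn_def[abs_def] by measurable

text \<open>Boundedness is common to both sources of arrays: coefficients of a vector are bounded by
  its norm, those of a Hardy function by the square root of \<open>hardy_norm_sq\<close>. It gives
  geometric domination on every smaller bidisc.\<close>

locale bounded_array =
  fixes a :: "nat \<Rightarrow> nat \<Rightarrow> complex" and B :: real
  assumes bound: "cmod (a m n) \<le> B"
begin

lemma B_nonneg: "0 \<le> B"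
  using order_trans[OF norm_ge_zero bound] .

lemma column_summable:
  assumes "cmod z < 1"
  shows "summable (\<lambda>m. cmod (a m n * z ^ m))"
  by (rule summable_comparison_test'[of "\<lambda>m. B * cmod z ^ m" 0])
    (use assms bound in \<open>auto simp: norm_mult norm_power intro!: summable_mult summable_geometric mult_right_mono\<close>)

lemma dcolumn_summable:
  assumes "cmod z < 1"
  shows "summable (\<lambda>m. cmod (of_nat (Suc m) * a (Suc m) n * z ^ m))"
proof (rule summable_comparison_test'[of "\<lambda>m. B * (of_nat (Suc m) * cmod z ^ m)" 0])
  show "summable (\<lambda>m. B * (of_nat (Suc m) * cmod z ^ m))"
    using sums_summable[OF geometric_deriv_sums[of "cmod z"]] assms by (intro summable_mult) simp
  show "norm (cmod (of_nat (Suc m) * a (Suc m) n * z ^ m)) \<le> B * (of_nat (Suc m) * cmod z ^ m)" for m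
    using mult_right_mono[OF bound[of "Suc m" n], of "real (Suc m) * cmod z ^ m"]
    by (simp add: norm_mult norm_power mult_ac del: of_nat_Suc)
qed

lemma column_le:
  assumes "cmod z \<le> \<rho>" "\<rho> < 1"
  shows "cmod (column a n z) \<le> B / (1 - \<rho>)"
proof -
  have z: "cmod z < 1" and \<rho>: "0 \<le> \<rho>" using assms order_trans[OF norm_ge_zero assms(1)] by auto
  have g: "(\<lambda>m. B * \<rho> ^ m) sums (B * (1 / (1 - \<rho>)))"
    using assms \<rho> by (intro sums_mult geometric_sums) simp
  have "cmod (column a n z) \<le> (\<Sum>m. cmod (a m n * z ^ m))"
    unfolding column_def by (rule summable_norm[OF column_summable[OF z]])
  also have "\<dots> \<le> (\<Sum>m. B * \<rho> ^ m)"
    by (intro suminf_le column_summable z sums_summable[OF g])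
      (use assms bound B_nonneg in \<open>auto simp: norm_mult norm_power intro!: mult_mono power_mono\<close>)
  finally show ?thesis using sums_unique[OF g] by simp
qed

lemma dcolumn_le:
  assumes "cmod z \<le> \<rho>" "\<rho> < 1"
  shows "cmod (dcolumn a n z) \<le> B / (1 - \<rho>)\<^sup>2"
proof -
  have z: "cmod z < 1" and \<rho>: "0 \<le> \<rho>" using assms order_trans[OF norm_ge_zero assms(1)] by auto
  have g: "(\<lambda>m. B * (of_nat (Suc m) * \<rho> ^ m)) sums (B * (1 / (1 - \<rho>)\<^sup>2))"
    using assms \<rho> by (intro sums_mult geometric_deriv_sums) simp
  have "cmod (dcolumn a n z) \<le> (\<Sum>m. cmod (of_nat (Suc m) * a (Suc m) n * z ^ m))"
    unfolding dcolumn_def by (rule summable_norm[OF dcolumn_summable[OF z]])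
  also have "\<dots> \<le> (\<Sum>m. B * (of_nat (Suc m) * \<rho> ^ m))"
  proof (intro suminf_le dcolumn_summable z sums_summable[OF g])
    fix m
    have "cmod (a (Suc m) n) * (real (Suc m) * cmod z ^ m) \<le> B * (real (Suc m) * \<rho> ^ m)"
      by (intro mult_mono power_mono bound B_nonneg) (use assms in auto)
    then show "cmod (of_nat (Suc m) * a (Suc m) n * z ^ m) \<le> B * (of_nat (Suc m) * \<rho> ^ m)"
      by (simp add: norm_mult norm_power mult_ac del: of_nat_Suc)
  qed
  finally show ?thesis using sums_unique[OF g] by simp
qed

lemma column_has_derivative:
  assumes "cmod z < 1"
  shows "(column a n has_field_derivative dcolumn a n z) (at z)"
proof -
  obtain r where r: "cmod z < r" "r < 1" using dense assms by blast
  have "0 < r" using r(1) norm_ge_zero[of z] by linarith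
  have "summable (\<lambda>m. a m n * of_real r ^ m)"
    by (rule summable_norm_cancel, rule column_summable) (use r \<open>0 < r\<close> in simp)
  from termdiffs_strong[OF this, of z] show ?thesis
    using r \<open>0 < r\<close> unfolding column_def[abs_def] dcolumn_def diffs_def by simp
qed

lemma bpower_summable:
  assumes "cmod z < 1" "cmod w < 1"
  shows "summable (\<lambda>n. cmod (column a n z * w ^ n))" "summable (\<lambda>n. cmod (dcolumn a n z * w ^ n))"
proof -
  have g: "summable (\<lambda>n. C * cmod w ^ n)" for C
    using assms by (intro summable_mult summable_geometric) simp
  have le: "norm (cmod (c * w ^ n)) \<le> C * cmod w ^ n" if "cmod c \<le> C" for c C n
    using mult_right_mono[OF that, of "cmod w ^ n"] by (simp add: norm_mult norm_power)
  show "summable (\<lambda>n. cmod (column a n z * w ^ n))"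
    by (rule summable_comparison_test'[OF g, OF le[OF column_le[OF order_refl assms(1)]]])
  show "summable (\<lambda>n. cmod (dcolumn a n z * w ^ n))"
    by (rule summable_comparison_test'[OF g, OF le[OF dcolumn_le[OF order_refl assms(1)]]])
qed

text \<open>Termwise Frechet differentiation: both series of partial derivatives converge uniformly
  on a smaller bidisc by the Weierstrass test.\<close>

lemma bpower_has_derivative:
  assumes zw: "cmod z < 1" "cmod w < 1"
  shows "(bpower a has_derivative (\<lambda>h. (\<Sum>n. dcolumn a n z * w ^ n) * fst h
      + (\<Sum>n. column a n z * (of_nat n * w ^ (n - 1))) * snd h)) (at (z, w))"
proof -
  obtain \<rho> where \<rho>: "max (cmod z) (cmod w) < \<rho>" "\<rho> < 1" using dense[of "max (cmod z) (cmod w)" 1] zw by auto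
  have \<rho>0: "0 < \<rho>" using \<rho>(1) norm_ge_zero[of z] by linarith
  define S where "S = ball (0::complex) \<rho> \<times> ball (0::complex) \<rho>"
  have S: "convex S" "open S" "(z, w) \<in> S" using \<rho> by (auto simp: S_def convex_Times open_Times)
  define f1 where "f1 n p = dcolumn a n (fst p) * snd p ^ n" for n and p :: "complex \<times> complex"
  define f2 where "f2 n p = column a n (fst p) * (of_nat n * snd p ^ (n - 1))" for n and p :: "complex \<times> complex"
  define g where "g p h = (\<Sum>n. f1 n p) * fst h + (\<Sum>n. f2 n p) * snd h" for p h
  have u1: "uniform_limit S (\<lambda>n p. \<Sum>i<n. f1 i p) (\<lambda>p. \<Sum>i. f1 i p) sequentially"
  proof (rule Weierstrass_m_test)
    show "norm (f1 n p) \<le> B / (1 - \<rho>)\<^sup>2 * \<rho> ^ n" if "p \<in> S" for n p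
      unfolding f1_def norm_mult norm_power
      by (intro mult_mono dcolumn_le power_mono) (use that \<rho> B_nonneg in \<open>auto simp: S_def dist_norm\<close>)
    show "summable (\<lambda>n. B / (1 - \<rho>)\<^sup>2 * \<rho> ^ n)"
      using \<rho> \<rho>0 by (intro summable_mult summable_geometric) simp
  qed
  have u2: "uniform_limit S (\<lambda>n p. \<Sum>i<n. f2 i p) (\<lambda>p. \<Sum>i. f2 i p) sequentially"
  proof (rule Weierstrass_m_test)
    show "norm (f2 n p) \<le> B / (1 - \<rho>) * (real n * \<rho> ^ (n - 1))" if "p \<in> S" for n p
      unfolding f2_def norm_mult norm_power norm_of_nat
      by (intro mult_mono column_le power_mono) (use that \<rho> B_nonneg in \<open>auto simp: S_def dist_norm\<close>)
    have "summable (\<lambda>n. real (Suc n) * \<rho> ^ (Suc n - 1))"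
      using sums_summable[OF geometric_deriv_sums[of \<rho>]] \<rho> \<rho>0 by simp
    then have "summable (\<lambda>n. real n * \<rho> ^ (n - 1))"
      by (rule summable_Suc_iff[THEN iffD1])
    then show "summable (\<lambda>n. B / (1 - \<rho>) * (real n * \<rho> ^ (n - 1)))"
      by (rule summable_mult)
  qed
  have "\<exists>G. \<forall>p\<in>S. (\<lambda>n. column a n (fst p) * snd p ^ n) sums G p \<and> (G has_derivative g p) (at p within S)"
  proof (rule has_derivative_series[OF S(1) _ _ S(3)])
    fix n p assume "p \<in> S"
    then have "cmod (fst p) < 1" using \<rho> by (auto simp: S_def)
    have "(column a n has_derivative (*) (dcolumn a n (fst p))) (at (fst p))"
      using column_has_derivative[OF \<open>cmod (fst p) < 1\<close>] by (simp add: has_field_derivative_def)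
    from has_derivative_compose[OF has_derivative_fst[OF has_derivative_ident] this]
    have "((\<lambda>p. column a n (fst p)) has_derivative (\<lambda>h. dcolumn a n (fst p) * fst h)) (at p within S)" .
    from has_derivative_mult[OF this has_derivative_power[OF has_derivative_snd[OF has_derivative_ident], of n]]
    show "((\<lambda>p. column a n (fst p) * snd p ^ n) has_derivative (\<lambda>h. f1 n p * fst h + f2 n p * snd h)) (at p within S)"
      by (rule has_derivative_eq_rhs) (auto simp: f1_def f2_def mult_ac)
  next
    fix \<epsilon> :: real assume "\<epsilon> > 0"
    then have e2: "\<epsilon> / 2 > 0" by simp
    show "\<forall>\<^sub>F n in sequentially. \<forall>p\<in>S. \<forall>h. norm ((\<Sum>i<n. f1 i p * fst h + f2 i p * snd h) - g p h) \<le> \<epsilon> * norm h"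
      using uniform_limitD[OF u1 e2] uniform_limitD[OF u2 e2]
    proof eventually_elim
      case (elim n)
      show ?case
      proof (intro ballI allI)
        fix p h assume p: "p \<in> S"
        have eq: "(\<Sum>i<n. f1 i p * fst h + f2 i p * snd h) - g p h
            = ((\<Sum>i<n. f1 i p) - (\<Sum>i. f1 i p)) * fst h + ((\<Sum>i<n. f2 i p) - (\<Sum>i. f2 i p)) * snd h"
          by (simp add: g_def sum.distrib sum_distrib_right left_diff_distrib)
        have "norm ((\<Sum>i<n. f1 i p * fst h + f2 i p * snd h) - g p h)
            \<le> cmod ((\<Sum>i<n. f1 i p) - (\<Sum>i. f1 i p)) * cmod (fst h) + cmod ((\<Sum>i<n. f2 i p) - (\<Sum>i. f2 i p)) * cmod (snd h)"
          unfolding eq norm_mult[symmetric] by (rule norm_triangle_ineq)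
        also have "\<dots> \<le> \<epsilon> / 2 * norm h + \<epsilon> / 2 * norm h"
          using elim p norm_fst_le[of "fst h" "snd h"] norm_snd_le[of "snd h" "fst h"] e2
          by (intro add_mono mult_mono) (auto simp: dist_norm less_imp_le)
        finally show "norm ((\<Sum>i<n. f1 i p * fst h + f2 i p * snd h) - g p h) \<le> \<epsilon> * norm h" by simp
      qed
    qed
  next
    show "(\<lambda>n. column a n (fst (z, w)) * snd (z, w) ^ n) sums (\<Sum>n. column a n z * w ^ n)"
      using summable_norm_cancel[OF bpower_summable(1)[OF zw]] by (simp add: summable_sums)
  qed
  then obtain G where G: "\<And>p. p \<in> S \<Longrightarrow> (\<lambda>n. column a n (fst p) * snd p ^ n) sums G p"
      "\<And>p. p \<in> S \<Longrightarrow> (G has_derivative g p) (at p within S)" by blast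
  have "bpower a p = G p" if "p \<in> S" for p
    using sums_unique[OF G(1)[OF that]] that \<rho> by (auto simp: bpower_def S_def)
  then have "(bpower a has_derivative g (z, w)) (at (z, w) within S)"
    by (intro has_derivative_transform[OF S(3) _ G(2)[OF S(3)]]) auto
  then show ?thesis
    unfolding at_within_open[OF S(3) S(2)] g_def f1_def f2_def by simp
qed

lemma holomorphic_bpower: "holomorphic_bidisc (bpower a)"
  unfolding holomorphic_bidisc_def using bpower_has_derivative by (auto simp: in_bidisc) blast

lemma partial1_bpower:
  assumes zw: "cmod z < 1" "cmod w < 1"
  shows "partial1 (bpower a) (z, w) = (\<Sum>n. dcolumn a n z * w ^ n)"
proof -
  have "((\<lambda>u. (u, w)) has_derivative (\<lambda>h. (h, 0))) (at z)"
    by (intro has_derivative_Pair has_derivative_ident has_derivative_const)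
  from has_derivative_compose[OF this bpower_has_derivative[OF zw]]
  have "((\<lambda>u. bpower a (u, w)) has_field_derivative (\<Sum>n. dcolumn a n z * w ^ n)) (at z)"
    by (simp add: has_field_derivative_def)
  then show ?thesis by (simp add: partial1_def DERIV_imp_deriv)
qed

text \<open>Through this symmetry every statement about the second variable becomes one about the
  first variable of the transposed array.\<close>

lemma bpower_transpose: "bpower (\<lambda>m n. a n m) (w, z) = bpower a (z, w)"
proof (cases "cmod z < 1 \<and> cmod w < 1")
  case True
  have eq: "(\<Sum>m. \<Sum>n. a m n * z ^ m * w ^ n) = (\<Sum>n. \<Sum>m. a m n * z ^ m * w ^ n)"
    by (rule suminf_swap_geometric[of _ B "cmod z" "cmod w"])
      (use True bound in \<open>auto simp: norm_mult norm_power intro!: mult_right_mono\<close>)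
  interpret t: bounded_array "\<lambda>m n. a n m" B by unfold_locales (rule bound)
  have "(\<Sum>n. a m n * z ^ m * w ^ n) = column (\<lambda>m n. a n m) m w * z ^ m" for m
    unfolding column_def
    by (subst suminf_mult2[OF summable_norm_cancel[OF t.column_summable]]) (use True in \<open>auto simp: mult_ac\<close>)
  moreover have "(\<Sum>m. a m n * z ^ m * w ^ n) = column a n z * w ^ n" for n
    unfolding column_def
    by (subst suminf_mult2[OF summable_norm_cancel[OF column_summable]]) (use True in auto)
  ultimately show ?thesis using True eq by (simp add: bpower_def)
next
  case False
  then show ?thesis by (auto simp: bpower_def)
qed

end

lemma partial2_bpower:
  assumes "bounded_array a B"
  shows "partial2 (bpower a) (w, z) = partial1 (bpower (\<lambda>m n. a n m)) (z, w)"
proof -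
  interpret bounded_array a B by fact
  show ?thesis by (simp add: partial1_def partial2_def bpower_transpose)
qed

section \<open>Radial limits: Hardy norm and Dirichlet integral in terms of coefficients\<close>

lemma SUP_power_to_1:
  fixes S :: "nat \<Rightarrow> real"
  assumes "\<And>k. 0 \<le> S k" "incseq S" "S \<longlonglongrightarrow> 1"
  shows "incseq (\<lambda>k. ennreal (S k ^ d) * c)" "(SUP k. ennreal (S k ^ d) * c) = c"
proof -
  have inc: "incseq (\<lambda>k. ennreal (S k ^ d))"
    using assms by (auto simp: incseq_def intro!: ennreal_leI power_mono)
  then show "incseq (\<lambda>k. ennreal (S k ^ d) * c)"
    by (auto simp: incseq_def intro!: mult_right_mono)
  have "(\<lambda>k. ennreal (S k ^ d)) \<longlonglongrightarrow> ennreal (1 ^ d)"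
    by (intro tendsto_ennrealI tendsto_power assms)
  then have "(SUP k. ennreal (S k ^ d)) = 1"
    using LIMSEQ_unique[OF LIMSEQ_SUP[OF inc]] by simp
  then show "(SUP k. ennreal (S k ^ d) * c) = c"
    by (simp flip: SUP_mult_right_ennreal)
qed

lemma suminf_power_to_1:
  fixes S :: "nat \<Rightarrow> real" and c :: "nat \<Rightarrow> ennreal" and d :: "nat \<Rightarrow> nat"
  assumes S: "\<And>k. 0 \<le> S k" "incseq S" "S \<longlonglongrightarrow> 1"
  shows "incseq (\<lambda>k. \<Sum>n. ennreal (S k ^ d n) * c n)" "(SUP k. \<Sum>n. ennreal (S k ^ d n) * c n) = (\<Sum>n. c n)"
proof -
  show "incseq (\<lambda>k. \<Sum>n. ennreal (S k ^ d n) * c n)"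
    using SUP_power_to_1(1)[OF S] by (auto simp: incseq_def intro!: suminf_le)
  show "(SUP k. \<Sum>n. ennreal (S k ^ d n) * c n) = (\<Sum>n. c n)"
    by (subst ennreal_suminf_SUP_eq[symmetric]) (auto simp: SUP_power_to_1[OF S])
qed

text \<open>Monotone convergence, tested along increasing sequences that tend to 1.\<close>

lemma suminf_power_tendsto:
  fixes c :: "nat \<Rightarrow> ennreal"
  shows "((\<lambda>r. \<Sum>n. ennreal (r ^ d n) * c n) \<longlongrightarrow> (\<Sum>n. c n)) (at_left (1::real))"
proof (rule tendsto_at_left_sequentially[of 0])
  fix S :: "nat \<Rightarrow> real" assume S: "\<And>n. 0 < S n" "incseq S" "S \<longlonglongrightarrow> 1"
  have "\<And>k. 0 \<le> S k" using S(1) by (rule less_imp_le)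
  note * = suminf_power_to_1[OF this S(2,3), where d = d and c = c]
  show "(\<lambda>k. \<Sum>n. ennreal (S k ^ d n) * c n) \<longlonglongrightarrow> (\<Sum>n. c n)"
    using LIMSEQ_SUP[OF *(1)] unfolding *(2) .
qed simp

context bounded_array
begin

lemma cmod_cis_less: "0 < r \<Longrightarrow> r < 1 \<Longrightarrow> cmod (complex_of_real r * cis t) < 1"
  by (simp add: norm_mult)

lemma parseval_column:
  assumes r: "0 < r" "r < 1"
  shows "(\<integral>\<^sup>+s. ennreal ((cmod (column a n (of_real r * cis s)))\<^sup>2) \<partial>arc_measure)
    = (\<Sum>m. ennreal (r ^ (2 * m)) * ennreal ((cmod (a m n))\<^sup>2))"
proof -
  have eq: "column a n (of_real r * cis s) = (\<Sum>m. a m n * of_real r ^ m * cis (real m * s))" for s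
    unfolding column_def by (simp add: power_mult_distrib Complex.DeMoivre mult.assoc)
  have "summable (\<lambda>m. cmod (a m n * of_real r ^ m))"
    using column_summable[of "of_real r" n] r by simp
  from parseval_arc[OF this] show ?thesis
    unfolding eq using r
    by (simp add: norm_mult norm_power power_mult_distrib ennreal_mult mult.commute flip: power_mult)
qed

lemma parseval_bpower:
  assumes z: "cmod z < 1" and r: "0 < r" "r < 1"
  shows "(\<integral>\<^sup>+t. ennreal ((cmod (bpower a (z, of_real r * cis t)))\<^sup>2) \<partial>arc_measure)
      = (\<Sum>n. ennreal (r ^ (2 * n)) * ennreal ((cmod (column a n z))\<^sup>2))"
    and "(\<integral>\<^sup>+t. ennreal ((cmod (partial1 (bpower a) (z, of_real r * cis t)))\<^sup>2) \<partial>arc_measure)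
      = (\<Sum>n. ennreal (r ^ (2 * n)) * ennreal ((cmod (dcolumn a n z))\<^sup>2))"
proof -
  have main: "(\<integral>\<^sup>+t. ennreal ((cmod (\<Sum>n. g n * (of_real r * cis t) ^ n))\<^sup>2) \<partial>arc_measure)
      = (\<Sum>n. ennreal (r ^ (2 * n)) * ennreal ((cmod (g n))\<^sup>2))"
    if "summable (\<lambda>n. cmod (g n * of_real r ^ n))" for g
  proof -
    have eq: "(\<Sum>n. g n * (of_real r * cis t) ^ n) = (\<Sum>n. g n * of_real r ^ n * cis (real n * t))" for t
      by (simp add: power_mult_distrib Complex.DeMoivre mult.assoc)
    show ?thesis
      unfolding eq parseval_arc[OF that] using r
      by (simp add: norm_mult norm_power power_mult_distrib ennreal_mult mult.commute flip: power_mult)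
  qed
  have r': "cmod (of_real r) < 1" using r by simp
  have "bpower a (z, of_real r * cis t) = (\<Sum>n. column a n z * (of_real r * cis t) ^ n)" for t
    using z cmod_cis_less[OF r, of t] by (simp add: bpower_def)
  then show "(\<integral>\<^sup>+t. ennreal ((cmod (bpower a (z, of_real r * cis t)))\<^sup>2) \<partial>arc_measure)
      = (\<Sum>n. ennreal (r ^ (2 * n)) * ennreal ((cmod (column a n z))\<^sup>2))"
    using main[OF bpower_summable(1)[OF z r']] by (simp only:)
  show "(\<integral>\<^sup>+t. ennreal ((cmod (partial1 (bpower a) (z, of_real r * cis t)))\<^sup>2) \<partial>arc_measure)
      = (\<Sum>n. ennreal (r ^ (2 * n)) * ennreal ((cmod (dcolumn a n z))\<^sup>2))"
    using main[OF bpower_summable(2)[OF z r']] by (simp only: partial1_bpower[OF z cmod_cis_less[OF r]])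
qed

lemma hardy_integral_bpower:
  assumes r: "0 < r" "r < 1"
  shows "(\<integral>\<^sup>+s. (\<integral>\<^sup>+t. ennreal ((cmod (bpower a (of_real r * cis s, of_real r * cis t)))\<^sup>2) \<partial>arc_measure) \<partial>arc_measure)
    = (\<Sum>n. ennreal (r ^ (2 * n)) * (\<Sum>m. ennreal (r ^ (2 * m)) * ennreal ((cmod (a m n))\<^sup>2)))"
  unfolding parseval_bpower(1)[OF cmod_cis_less[OF r] r]
  by (subst nn_integral_suminf, measurable, subst nn_integral_cmult, measurable)
    (simp add: parseval_column[OF r])

text \<open>Parseval in each variable attaches r^(2m) r^(2n) to the coefficient, which gives one
  inequality at once. For the other the two radii are separated, so that monotone convergence
  applies to each sum in turn.\<close>

lemma hardy_norm_sq_bpower: "hardy_norm_sq (bpower a) = (\<Sum>m. \<Sum>n. ennreal ((cmod (a m n))\<^sup>2))"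
proof (rule antisym)
  define H where "H r = (\<Sum>n. ennreal (r ^ (2 * n)) * (\<Sum>m. ennreal (r ^ (2 * m)) * ennreal ((cmod (a m n))\<^sup>2)))" for r :: real
  have hardy: "hardy_norm_sq (bpower a) = (SUP r\<in>{0<..<1}. H r)"
    unfolding hardy_norm_sq_def by (rule SUP_cong) (simp_all add: hardy_integral_bpower H_def)
  have le1: "ennreal (r ^ d) * c \<le> c" if "0 < r" "r < 1" for r d c
  proof -
    have "ennreal (r ^ d) \<le> 1" using that by (simp add: power_le_one)
    from mult_right_mono[OF this, of c] show ?thesis by simp
  qed
  have "H r \<le> (\<Sum>n. \<Sum>m. ennreal ((cmod (a m n))\<^sup>2))" if "0 < r" "r < 1" for r
    unfolding H_def by (intro suminf_le order_trans[OF le1[OF that]] le1[OF that]) auto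
  then show "hardy_norm_sq (bpower a) \<le> (\<Sum>m. \<Sum>n. ennreal ((cmod (a m n))\<^sup>2))"
    unfolding hardy suminf_swap_ennreal[of "\<lambda>m n. ennreal ((cmod (a m n))\<^sup>2)"] by (intro SUP_least) auto
  define S where "S k = 1 - 1 / real (Suc (Suc k))" for k
  have S: "0 < S k" "S k < 1" for k by (simp_all add: S_def)
  have S0: "0 \<le> S k" for k using S(1) by (rule less_imp_le)
  have S_inc: "incseq S"
    unfolding S_def by (intro incseq_SucI) (simp add: frac_le)
  have S_lim: "S \<longlonglongrightarrow> 1"
    unfolding S_def using tendsto_diff[OF tendsto_const[of 1] LIMSEQ_Suc[OF LIMSEQ_Suc[OF lim_1_over_n]]] by simp
  note inner = suminf_power_to_1[OF S0 S_inc S_lim, where d = "\<lambda>m. 2 * m"]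
  have "(\<Sum>n. \<Sum>m. ennreal ((cmod (a m n))\<^sup>2))
      = (SUP j. \<Sum>n. ennreal (S j ^ (2 * n)) * (\<Sum>m. ennreal ((cmod (a m n))\<^sup>2)))"
    by (rule inner(2)[symmetric])
  also have "\<dots> = (SUP j. \<Sum>n. ennreal (S j ^ (2 * n)) * (SUP k. \<Sum>m. ennreal (S k ^ (2 * m)) * ennreal ((cmod (a m n))\<^sup>2)))"
    unfolding inner(2) ..
  also have "\<dots> = (SUP j. SUP k. \<Sum>n. ennreal (S j ^ (2 * n)) * (\<Sum>m. ennreal (S k ^ (2 * m)) * ennreal ((cmod (a m n))\<^sup>2)))"
    unfolding SUP_mult_left_ennreal
    by (intro SUP_cong refl ennreal_suminf_SUP_eq) (use inner(1) in \<open>auto simp: incseq_def intro!: mult_left_mono\<close>)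
  also have "\<dots> \<le> (SUP r\<in>{0<..<1}. H r)"
  proof (intro SUP_least)
    fix j k :: nat
    \<comment> \<open>Raising both radii to the larger one returns to the diagonal, where
      \<open>H\<close> lives, at no loss.\<close>
    define i where "i = max j k"
    have "S j \<le> S i" "S k \<le> S i" unfolding i_def using S_inc by (auto simp: incseq_def)
    then have "(\<Sum>n. ennreal (S j ^ (2 * n)) * (\<Sum>m. ennreal (S k ^ (2 * m)) * ennreal ((cmod (a m n))\<^sup>2))) \<le> H (S i)"
      unfolding H_def by (intro suminf_le mult_mono mult_right_mono ennreal_leI power_mono S0) auto
    also have "\<dots> \<le> (SUP r\<in>{0<..<1}. H r)" by (rule SUP_upper) (use S in auto)
    finally show "(\<Sum>n. ennreal (S j ^ (2 * n)) * (\<Sum>m. ennreal (S k ^ (2 * m)) * ennreal ((cmod (a m n))\<^sup>2)))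
        \<le> (SUP r\<in>{0<..<1}. H r)" .
  qed
  finally show "(\<Sum>m. \<Sum>n. ennreal ((cmod (a m n))\<^sup>2)) \<le> hardy_norm_sq (bpower a)"
    unfolding hardy suminf_swap_ennreal[of "\<lambda>m n. ennreal ((cmod (a m n))\<^sup>2)"] .
qed

text \<open>Parseval in the variable on the circle of radius r leaves r^(2n) times the one-variable
  integral of the n-th column, so the limit is monotone and each column is covered by
  \<open>dirichlet_integral_disc\<close>.\<close>

lemma dirichlet_part_tendsto:
  assumes \<mu>: "circle_measure \<mu>"
  shows "((\<lambda>r. \<integral>\<^sup>+z. (\<integral>\<^sup>+t. ennreal (poisson \<mu> z * (cmod (partial1 (bpower a) (z, of_real r * cis t)))\<^sup>2)
          \<partial>arc_measure) \<partial>area_measure) \<longlongrightarrow>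
      (\<Sum>n. \<Sum>K. \<integral>\<^sup>+\<zeta>. ennreal (weight K * (cmod (\<Sum>k\<le>K. (of_nat (Suc k) * a (Suc k) n) * \<zeta> ^ k))\<^sup>2) \<partial>\<mu>)) (at_left 1)"
proof -
  interpret finite_measure \<mu> using \<mu> by (simp add: circle_measure_def)
  have sets: "sets \<mu> = sets (restrict_space borel (sphere 0 1))"
    using \<mu> by (simp add: circle_measure_def)
  have [measurable]: "(\<lambda>\<zeta>. \<zeta>) \<in> \<mu> \<rightarrow>\<^sub>M borel"
    unfolding measurable_cong_sets[OF sets refl] by (intro measurable_restrict_space1) simp
  have [measurable]: "poisson \<mu> \<in> borel_measurable borel"
    unfolding poisson_def[abs_def] by measurable
  have poisson_nonneg: "0 \<le> poisson \<mu> z" if "cmod z < 1" for z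
    unfolding poisson_def using that
    by (intro integral_nonneg_AE AE_I2 divide_nonneg_nonneg) (auto simp: power_le_one)
  have "(\<lambda>z. ennreal (poisson \<mu> z * (cmod (dcolumn a n z))\<^sup>2)) \<in> borel_measurable borel" for n
    by measurable
  then have D_meas: "(\<lambda>z. ennreal (poisson \<mu> z * (cmod (dcolumn a n z))\<^sup>2)) \<in> borel_measurable area_measure" for n
    by (simp only: measurable_cong_sets[OF sets_area_measure refl])
  define D where "D n = (\<integral>\<^sup>+z. ennreal (poisson \<mu> z * (cmod (dcolumn a n z))\<^sup>2) \<partial>area_measure)" for n
  have D: "D n = (\<Sum>K. \<integral>\<^sup>+\<zeta>. ennreal (weight K * (cmod (\<Sum>k\<le>K. (of_nat (Suc k) * a (Suc k) n) * \<zeta> ^ k))\<^sup>2) \<partial>\<mu>)" for n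
    unfolding D_def dcolumn_def
    by (rule dirichlet_integral_disc[OF \<mu>]) (rule summable_norm_cancel[OF dcolumn_summable])
  have "(\<integral>\<^sup>+z. (\<integral>\<^sup>+t. ennreal (poisson \<mu> z * (cmod (partial1 (bpower a) (z, of_real r * cis t)))\<^sup>2) \<partial>arc_measure) \<partial>area_measure)
      = (\<Sum>n. ennreal (r ^ (2 * n)) * D n)" if r: "0 < r" "r < 1" for r
  proof -
    have "(\<integral>\<^sup>+z. (\<integral>\<^sup>+t. ennreal (poisson \<mu> z * (cmod (partial1 (bpower a) (z, of_real r * cis t)))\<^sup>2) \<partial>arc_measure) \<partial>area_measure)
       = (\<integral>\<^sup>+z. (\<Sum>n. ennreal (r ^ (2 * n)) * ennreal (poisson \<mu> z * (cmod (dcolumn a n z))\<^sup>2)) \<partial>area_measure)"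
    proof (rule nn_integral_cong_AE, use AE_area_measure in eventually_elim)
      fix z assume z: "cmod z < 1"
      have [measurable]: "(\<lambda>t. partial1 (bpower a) (z, of_real r * cis t)) \<in> borel_measurable borel"
        unfolding partial1_bpower[OF z cmod_cis_less[OF r]] by measurable
      have "(\<integral>\<^sup>+t. ennreal (poisson \<mu> z * (cmod (partial1 (bpower a) (z, of_real r * cis t)))\<^sup>2) \<partial>arc_measure)
         = ennreal (poisson \<mu> z) * (\<Sum>n. ennreal (r ^ (2 * n)) * ennreal ((cmod (dcolumn a n z))\<^sup>2))"
        unfolding parseval_bpower(2)[OF z r, symmetric]
        by (subst nn_integral_cmult[symmetric]) (auto simp: ennreal_mult poisson_nonneg[OF z])
      also have "\<dots> = (\<Sum>n. ennreal (r ^ (2 * n)) * ennreal (poisson \<mu> z * (cmod (dcolumn a n z))\<^sup>2))"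
        unfolding ennreal_suminf_cmult[symmetric]
        by (intro suminf_cong) (simp add: ennreal_mult poisson_nonneg[OF z] mult.left_commute)
      finally show "(\<integral>\<^sup>+t. ennreal (poisson \<mu> z * (cmod (partial1 (bpower a) (z, of_real r * cis t)))\<^sup>2) \<partial>arc_measure)
         = (\<Sum>n. ennreal (r ^ (2 * n)) * ennreal (poisson \<mu> z * (cmod (dcolumn a n z))\<^sup>2))" .
    qed
    also have "\<dots> = (\<Sum>n. ennreal (r ^ (2 * n)) * D n)"
      unfolding D_def nn_integral_cmult[OF D_meas, symmetric]
    proof (rule nn_integral_suminf)
      show "(\<lambda>z. ennreal (r ^ (2 * n)) * ennreal (poisson \<mu> z * (cmod (dcolumn a n z))\<^sup>2)) \<in> borel_measurable area_measure" for n
        by (rule borel_measurable_times_ennreal[OF borel_measurable_const D_meas])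
    qed
    finally show ?thesis .
  qed
  then have "\<forall>\<^sub>F r in at_left 1. (\<integral>\<^sup>+z. (\<integral>\<^sup>+t. ennreal (poisson \<mu> z * (cmod (partial1 (bpower a) (z, of_real r * cis t)))\<^sup>2)
      \<partial>arc_measure) \<partial>area_measure) = (\<Sum>n. ennreal (r ^ (2 * n)) * D n)"
    by (intro eventually_at_leftI[of 0]) auto
  from tendsto_cong[OF this] suminf_power_tendsto[of "\<lambda>n. 2 * n" D] show ?thesis
    unfolding D[symmetric] by simp
qed

end

text \<open>The second summand is the first one for the transposed array. Because the limits exist,
  the operator \<open>Lim\<close> in the definition has the intended value.\<close>

lemma dirichlet_integral_bpower:
  assumes a: "bounded_array a B" and \<mu>: "circle_measure \<mu>1" "circle_measure \<mu>2"
  shows "dirichlet_integral \<mu>1 \<mu>2 (bpower a) =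
      (\<Sum>n. \<Sum>K. \<integral>\<^sup>+\<zeta>. ennreal (weight K * (cmod (\<Sum>k\<le>K. (of_nat (Suc k) * a (Suc k) n) * \<zeta> ^ k))\<^sup>2) \<partial>\<mu>1)
    + (\<Sum>m. \<Sum>K. \<integral>\<^sup>+\<zeta>. ennreal (weight K * (cmod (\<Sum>k\<le>K. (of_nat (Suc k) * a m (Suc k)) * \<zeta> ^ k))\<^sup>2) \<partial>\<mu>2)"
proof -
  interpret bounded_array a B by fact
  interpret t: bounded_array "\<lambda>m n. a n m" B by unfold_locales (rule bound)
  show ?thesis
    unfolding dirichlet_integral_def partial2_bpower[OF a]
    by (intro arg_cong2[where f = "(+)"] tendsto_Lim trivial_limit_at_left_real
        dirichlet_part_tendsto t.dirichlet_part_tendsto \<mu>)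
qed

section \<open>Power series of Hardy functions\<close>

lemma continuous_on_contour_integral_param:
  fixes F :: "complex \<Rightarrow> complex \<Rightarrow> complex"
  assumes cont: "continuous_on (A \<times> path_image \<gamma>) (\<lambda>(x, y). F x y)" and \<gamma>: "valid_path \<gamma>"
    and d: "continuous_on {0..1} (\<lambda>t. vector_derivative \<gamma> (at t))"
  shows "continuous_on A (\<lambda>x. contour_integral \<gamma> (F x))"
proof -
  have "continuous_on {0..1} \<gamma>" using valid_path_imp_path[OF \<gamma>] by (simp add: path_def)
  then have "continuous_on (A \<times> {0..1}) (\<lambda>p. (\<lambda>(x, y). F x y) (fst p, \<gamma> (snd p)))"
    by (intro continuous_on_compose2[OF cont] continuous_intros continuous_on_compose2[OF \<open>continuous_on {0..1} \<gamma>\<close>])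
      (auto simp: path_image_def)
  moreover have "continuous_on (A \<times> {0..1}) (\<lambda>p. vector_derivative \<gamma> (at (snd p)))"
    by (intro continuous_on_compose2[OF d] continuous_intros) auto
  ultimately have "continuous_on (A \<times> cbox 0 1) (\<lambda>(x, t). F x (\<gamma> t) * vector_derivative \<gamma> (at t))"
    by (auto simp: case_prod_beta intro!: continuous_on_mult)
  from integral_continuous_on_param[OF this] show ?thesis
    by (simp add: contour_integral_integral)
qed

text \<open>Morera's theorem; the triangle and the circle integrals are interchanged.\<close>

lemma holomorphic_contour_integral_param:
  fixes F :: "complex \<Rightarrow> complex \<Rightarrow> complex"
  assumes A: "open A" and cont: "continuous_on (A \<times> sphere 0 r) (\<lambda>(z, u). F z u)"
    and hol: "\<And>u. u \<in> sphere 0 r \<Longrightarrow> (\<lambda>z. F z u) holomorphic_on A" and r: "0 < r"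
  shows "(\<lambda>z. contour_integral (circlepath 0 r) (F z)) holomorphic_on A"
proof -
  define I where "I z = contour_integral (circlepath 0 r) (F z)" for z
  have img: "path_image (circlepath 0 r) = sphere 0 r" using r by simp
  have cd: "continuous_on {0..1} (\<lambda>t. vector_derivative (circlepath 0 r) (at t))"
    unfolding vector_derivative_circlepath by (intro continuous_intros)
  have contI: "continuous_on A I"
    unfolding I_def by (rule continuous_on_contour_integral_param) (use cont cd img in auto)
  have "I analytic_on A"
  proof (rule Morera_triangle[OF contI A], intro allI impI)
    fix a b c assume abc: "convex hull {a, b, c} \<subseteq> A"
    define J where "J p q u = contour_integral (linepath p q) (\<lambda>z. F z u)" for p q u
    have swap: "contour_integral (linepath p q) I = contour_integral (circlepath 0 r) (J p q)"
      and int: "J p q contour_integrable_on circlepath 0 r" if "closed_segment p q \<subseteq> A" for p q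
    proof -
      have c1: "continuous_on (path_image (linepath p q) \<times> path_image (circlepath 0 r)) (\<lambda>(z, u). F z u)"
        using continuous_on_subset[OF cont] that img by (metis Sigma_mono path_image_linepath subset_refl)
      have ld: "continuous_on {0..1} (\<lambda>t. vector_derivative (linepath p q) (at t))"
        by simp
      show "contour_integral (linepath p q) I = contour_integral (circlepath 0 r) (J p q)"
        unfolding I_def J_def by (rule contour_integral_swap[OF c1 _ _ ld cd]) auto
      have "continuous_on (sphere 0 r) (J p q)"
        unfolding J_def
      proof (rule continuous_on_contour_integral_param[where F = "\<lambda>u z. F z u", OF _ _ ld])
        show "continuous_on (sphere 0 r \<times> path_image (linepath p q)) (\<lambda>(u, z). F z u)"
          using continuous_on_swap_args[OF c1[unfolded img]] by simp
      qed simp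
      then show "J p q contour_integrable_on circlepath 0 r"
        by (intro contour_integrable_continuous_circlepath) (simp only: img)
    qed
    have seg: "closed_segment a b \<subseteq> A" "closed_segment b c \<subseteq> A" "closed_segment c a \<subseteq> A"
    proof -
      have "closed_segment p q \<subseteq> convex hull {a, b, c}" if "p \<in> {a, b, c}" "q \<in> {a, b, c}" for p q
        using that by (intro closed_segment_subset convex_convex_hull hull_inc)
      then show "closed_segment a b \<subseteq> A" "closed_segment b c \<subseteq> A" "closed_segment c a \<subseteq> A"
        using abc by (meson insertCI subset_trans)+
    qed
    have zero: "J a b u + J b c u + J c a u = 0" if "u \<in> sphere 0 r" for u
      unfolding J_def
      by (rule has_chain_integral_chain_integral3[OF Cauchy_theorem_triangle])
        (rule holomorphic_on_subset[OF hol[OF that] abc])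
    have "contour_integral (circlepath 0 r) (J a b) + contour_integral (circlepath 0 r) (J b c)
        + contour_integral (circlepath 0 r) (J c a) = contour_integral (circlepath 0 r) (\<lambda>u. J a b u + J b c u + J c a u)"
      using int[OF seg(1)] int[OF seg(2)] int[OF seg(3)]
      by (simp add: contour_integral_add contour_integrable_add)
    also have "\<dots> = contour_integral (circlepath 0 r) (\<lambda>u. 0)"
    proof (rule contour_integral_cong[OF refl])
      show "J a b u + J b c u + J c a u = 0" if "u \<in> path_image (circlepath 0 r)" for u
        by (rule zero) (use that in \<open>simp only: img\<close>)
    qed
    finally show "contour_integral (linepath a b) I + contour_integral (linepath b c) I + contour_integral (linepath c a) I = 0"
      by (simp add: swap seg)
  qed
  then show ?thesis unfolding I_def by (rule analytic_imp_holomorphic)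
qed

lemma holomorphic_bidisc_sections:
  assumes f: "holomorphic_bidisc f"
  shows "cmod w < 1 \<Longrightarrow> (\<lambda>z. f (z, w)) holomorphic_on ball 0 1"
    and "cmod z < 1 \<Longrightarrow> (\<lambda>w. f (z, w)) holomorphic_on ball 0 1"
    and "continuous_on bidisc f"
proof -
  have d: "\<exists>a b. (f has_derivative (\<lambda>h. a * fst h + b * snd h)) (at (z, w))" if "cmod z < 1" "cmod w < 1" for z w
    using f that by (simp add: holomorphic_bidisc_def)
  show "(\<lambda>z. f (z, w)) holomorphic_on ball 0 1" if w: "cmod w < 1"
  proof (rule holomorphic_onI, rule field_differentiable_at_within)
    fix z :: complex assume "z \<in> ball 0 1"
    then obtain a b where ab: "(f has_derivative (\<lambda>h. a * fst h + b * snd h)) (at (z, w))"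
      using d[of z w] w by auto
    have "((\<lambda>z. (z, w)) has_derivative (\<lambda>h. (h, 0))) (at z)"
      by (intro has_derivative_Pair has_derivative_ident has_derivative_const)
    from has_derivative_compose[OF this ab] show "(\<lambda>z. f (z, w)) field_differentiable at z"
      unfolding field_differentiable_def has_field_derivative_def by auto
  qed
  show "(\<lambda>w. f (z, w)) holomorphic_on ball 0 1" if z: "cmod z < 1"
  proof (rule holomorphic_onI, rule field_differentiable_at_within)
    fix w :: complex assume "w \<in> ball 0 1"
    then obtain a b where ab: "(f has_derivative (\<lambda>h. a * fst h + b * snd h)) (at (z, w))"
      using d[of z w] z by auto
    have "((\<lambda>w. (z, w)) has_derivative (\<lambda>h. (0, h))) (at w)"
      by (intro has_derivative_Pair has_derivative_ident has_derivative_const)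
    from has_derivative_compose[OF this ab] show "(\<lambda>w. f (z, w)) field_differentiable at w"
      unfolding field_differentiable_def has_field_derivative_def by auto
  qed
  show "continuous_on bidisc f"
    unfolding continuous_on_eq_continuous_at[OF open_Times[OF open_ball open_ball]]
    using d has_derivative_continuous by fastforce
qed

text \<open>Expand in the second variable for fixed z, show that the coefficients are holomorphic in
  z, and expand them again. Finiteness of the Hardy norm is what bounds the resulting array.\<close>

lemma hardy_space_eq_bpower:
  assumes f: "f \<in> hardy_space"
  shows "\<exists>a B. bounded_array a B \<and> f = bpower a"
proof -
  have hol: "holomorphic_bidisc f" and zero: "\<And>p. p \<notin> bidisc \<Longrightarrow> f p = 0" and fin: "hardy_norm_sq f < \<infinity>"
    using f unfolding hardy_space_def mem_Collect_eq by blast+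
  note sections = holomorphic_bidisc_sections[OF hol]
  define b where "b n z = (deriv ^^ n) (\<lambda>w. f (z, w)) 0 / fact n" for n z
  have b_sums: "(\<lambda>n. b n z * w ^ n) sums f (z, w)" if "cmod z < 1" "cmod w < 1" for z w
    using holomorphic_power_series[OF sections(2)[OF that(1)], of w] that by (simp add: b_def)
  have b_hol: "b n holomorphic_on ball 0 1" for n
  proof -
    \<comment> \<open>Cauchy's formula over one fixed circle, of radius 1/2, represents the n-th
      coefficient for all z simultaneously; this makes its holomorphy in z visible.\<close>
    have "(\<lambda>z. contour_integral (circlepath 0 (1/2)) (\<lambda>u. f (z, u) / u ^ Suc n)) holomorphic_on ball 0 1"
    proof (rule holomorphic_contour_integral_param)
      show "continuous_on (ball 0 1 \<times> sphere 0 (1/2)) (\<lambda>(z, u). f (z, u) / u ^ Suc n)"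
        unfolding case_prod_beta prod.collapse
        by (intro continuous_on_divide continuous_on_power continuous_on_snd continuous_on_id
            continuous_on_subset[OF sections(3)]) auto
      show "(\<lambda>z. f (z, u) / u ^ Suc n) holomorphic_on ball 0 1" if "u \<in> sphere 0 (1/2)" for u
        using that by (intro holomorphic_intros sections(1)) auto
    qed auto
    then have "(\<lambda>z. contour_integral (circlepath 0 (1/2)) (\<lambda>u. f (z, u) / u ^ Suc n) / (2 * pi * \<i>)) holomorphic_on ball 0 1"
      by (intro holomorphic_intros) auto
    moreover have "contour_integral (circlepath 0 (1/2)) (\<lambda>u. f (z, u) / u ^ Suc n) / (2 * pi * \<i>) = b n z"
      if "z \<in> ball 0 1" for z
    proof -
      have h: "(\<lambda>w. f (z, w)) holomorphic_on cball 0 (1/2)"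
        by (rule holomorphic_on_subset[OF sections(2)]) (use that in auto)
      then have "contour_integral (circlepath 0 (1/2)) (\<lambda>u. f (z, u) / (u - 0) ^ Suc n)
          = 2 * pi * \<i> * (deriv ^^ n) (\<lambda>w. f (z, w)) 0 / fact n"
        by (intro Cauchy_contour_integral_circlepath holomorphic_on_imp_continuous_on
            holomorphic_on_subset[OF h]) auto
      then show ?thesis by (simp add: b_def)
    qed
    ultimately show ?thesis by (rule holomorphic_transform)
  qed
  define a where "a m n = (deriv ^^ m) (b n) 0 / fact m" for m n
  have a_sums: "(\<lambda>m. a m n * z ^ m) sums b n z" if "cmod z < 1" for n z
    using holomorphic_power_series[OF b_hol, of z n] that by (simp add: a_def)
  obtain C where C: "hardy_norm_sq f = ennreal C" "0 \<le> C"
    using fin by (cases "hardy_norm_sq f") auto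
  have le: "(cmod (a m n) * r ^ (m + n))\<^sup>2 \<le> C" if r: "0 < r" "r < 1" for m n r
  proof -
    have disc: "cmod (of_real r * cis t) < 1" for t using r by (simp add: norm_mult)
    have b_abs: "summable (\<lambda>n. cmod (b n z * of_real r ^ n))" if "cmod z < 1" for z
      by (rule powser_abs_summable[OF sums_summable[OF b_sums[OF that]]]) (use r in auto)
    have a_abs: "summable (\<lambda>m. cmod (a m n * of_real r ^ m))" for n
      by (rule powser_abs_summable[OF sums_summable[OF a_sums]]) (use r in auto)
    have term_le: "c i \<le> (\<Sum>i. c i)" for c :: "nat \<Rightarrow> ennreal" and i
      using sum_le_suminf[OF summableI, of "{i}" c] by simp
    \<comment> \<open>A single term is at most the whole Parseval sum; this is used first in the
      second variable and afterwards in the first.\<close>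
    have "ennreal ((cmod (b n (of_real r * cis s) * of_real r ^ n))\<^sup>2)
        \<le> (\<integral>\<^sup>+t. ennreal ((cmod (f (of_real r * cis s, of_real r * cis t)))\<^sup>2) \<partial>arc_measure)" for s
    proof -
      have "f (of_real r * cis s, of_real r * cis t) = (\<Sum>n. b n (of_real r * cis s) * of_real r ^ n * cis (real n * t))" for t
        using sums_unique[OF b_sums[OF disc disc]] by (simp add: power_mult_distrib Complex.DeMoivre mult.assoc)
      then show ?thesis
        using parseval_arc[OF b_abs[OF disc[of s]]] term_le by (simp only:)
    qed
    then have "(\<integral>\<^sup>+s. ennreal ((cmod (b n (of_real r * cis s) * of_real r ^ n))\<^sup>2) \<partial>arc_measure)
       \<le> (\<integral>\<^sup>+s. (\<integral>\<^sup>+t. ennreal ((cmod (f (of_real r * cis s, of_real r * cis t)))\<^sup>2) \<partial>arc_measure) \<partial>arc_measure)"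
      by (intro nn_integral_mono)
    also have "\<dots> \<le> ennreal C"
      unfolding C(1)[symmetric] hardy_norm_sq_def by (rule SUP_upper) (use r in auto)
    finally have 1: "(\<integral>\<^sup>+s. ennreal ((cmod (b n (of_real r * cis s) * of_real r ^ n))\<^sup>2) \<partial>arc_measure) \<le> ennreal C" .
    have "b n (of_real r * cis s) * of_real r ^ n = (\<Sum>m. a m n * of_real r ^ m * of_real r ^ n * cis (real m * s))" for s
    proof -
      have "(\<lambda>m. a m n * (of_real r * cis s) ^ m * of_real r ^ n) sums (b n (of_real r * cis s) * of_real r ^ n)"
        by (rule sums_mult2[OF a_sums[OF disc]])
      from sums_unique[OF this] show ?thesis
        by (simp add: power_mult_distrib Complex.DeMoivre mult_ac)
    qed
    moreover have "summable (\<lambda>m. cmod (a m n * of_real r ^ m * of_real r ^ n))"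
      unfolding norm_mult[of "_ * _"] by (rule summable_mult2[OF a_abs])
    ultimately have "(\<integral>\<^sup>+s. ennreal ((cmod (b n (of_real r * cis s) * of_real r ^ n))\<^sup>2) \<partial>arc_measure)
        = (\<Sum>m. ennreal ((cmod (a m n * of_real r ^ m * of_real r ^ n))\<^sup>2))"
      using parseval_arc by (simp only:)
    then have "ennreal ((cmod (a m n * of_real r ^ m * of_real r ^ n))\<^sup>2) \<le> ennreal C"
      using 1 order_trans[OF term_le] by (simp only:)
    then have "(cmod (a m n * of_real r ^ m * of_real r ^ n))\<^sup>2 \<le> C"
      using C(2) by (simp add: ennreal_le_iff)
    then show ?thesis using r by (simp add: norm_mult norm_power power_add mult.assoc)
  qed
  \<comment> \<open>The bound \<open>C\<close> does not depend on r, so r may tend to 1 and the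
    power of r disappears.\<close>
  have "(cmod (a m n))\<^sup>2 \<le> C" for m n
  proof (rule tendsto_upperbound)
    have "((\<lambda>r. (cmod (a m n) * r ^ (m + n))\<^sup>2) \<longlongrightarrow> (cmod (a m n) * 1 ^ (m + n))\<^sup>2) (at_left (1::real))"
      by (intro tendsto_intros)
    then show "((\<lambda>r. (cmod (a m n) * r ^ (m + n))\<^sup>2) \<longlongrightarrow> (cmod (a m n))\<^sup>2) (at_left (1::real))" by simp
    show "\<forall>\<^sub>F r in at_left (1::real). (cmod (a m n) * r ^ (m + n))\<^sup>2 \<le> C"
      by (rule eventually_at_leftI[of 0]) (use le in auto)
  qed simp
  then have "cmod (a m n) \<le> sqrt C" for m n by (rule real_le_rsqrt)
  then have "bounded_array a (sqrt C)" by unfold_locales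
  moreover have "f p = bpower a p" for p
  proof (cases "p \<in> bidisc")
    case True
    then obtain z w where p: "p = (z, w)" "cmod z < 1" "cmod w < 1" by (cases p) auto
    have "column a n z = b n z" for n
      unfolding column_def using sums_unique[OF a_sums[OF p(2)]] by simp
    then show ?thesis
      using sums_unique[OF b_sums[OF p(2,3)]] p by (simp add: bpower_def)
  qed (auto simp: bpower_def zero)
  ultimately show ?thesis by blast
qed

section \<open>Coefficients of a commuting pair\<close>

text \<open>The toral identities with equal indices are contained in the two instances of
  \<open>two_isometry\<close>; \<open>toral\<close> is the mixed one, again written without
  adjoints.\<close>

locale commuting_pair = A: two_isometry T1 L1 + B: two_isometry T2 L2
  for T1 L1 T2 L2 :: "'h::chilbert_space \<Rightarrow> 'h" +
  assumes T1_T2: "T1 (T2 x) = T2 (T1 x)"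
    and L1_T2: "L1 (T2 x) = T2 (L1 x)"
    and L2_T1: "L2 (T1 x) = T1 (L2 x)"
    and toral: "cinner (T1 (T2 x)) (T1 (T2 y)) - cinner (T1 x) (T1 y) - cinner (T2 x) (T2 y) + cinner x y = 0"
    and analytic1: "(\<And>n. \<exists>z. x = (T1 ^^ n) z) \<Longrightarrow> x = 0"
    and analytic2: "(\<And>n. \<exists>z. x = (T2 ^^ n) z) \<Longrightarrow> x = 0"
begin

text \<open>\<open>P1\<close> and \<open>P2\<close> are the orthogonal projections onto the kernels
  of the adjoints of \<open>T1\<close> and \<open>T2\<close>.\<close>

definition P1 :: "'h \<Rightarrow> 'h" where "P1 x = x - T1 (L1 x)"
definition P2 :: "'h \<Rightarrow> 'h" where "P2 x = x - T2 (L2 x)"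

lemma P1_T2: "P1 (T2 x) = T2 (P1 x)"
  by (simp add: P1_def L1_T2 T1_T2 B.T_simps)

text \<open>The assumptions relate each left inverse only to the other operator. By uniqueness of
  \<open>L1\<close> it suffices that L2 (P1 x) is orthogonal to the range of \<open>T1\<close>, and
  it is because it equals P1 (L2 x).\<close>

lemma L1_L2: "L1 (L2 x) = L2 (L1 x)"
proof (rule A.L_unique)
  fix y
  have "cinner (L2 x - T1 (L2 (L1 x))) (T1 y) = cinner (L2 (P1 x)) (T1 y)"
    by (simp add: P1_def B.L_simps L2_T1)
  also have "\<dots> = 0"
  proof -
    text \<open>The projection onto the kernel of the adjoint of \<open>T1\<close> commutes with \<open>T2\<close>, hence with its adjoint.\<close>
    have P1_adj: "cinner (P1 u) v = cinner u (P1 v)" for u v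
    proof -
      have "cinner (P1 u) (T1 (L1 v)) = 0" "cinner (T1 (L1 u)) (P1 v) = 0"
        using A.orthogonal[of u "L1 v"] A.orthogonal[of v "L1 u"]
          cinner_commute[of "T1 (L1 u)" "P1 v"] by (simp_all add: P1_def)
      then have "cinner (P1 u) v = cinner (P1 u) (P1 v)" "cinner u (P1 v) = cinner (P1 u) (P1 v)"
        by (simp_all add: P1_def cinner_diff_left cinner_diff_right)
      then show ?thesis by simp
    qed
    have "L2 (P1 x) = P1 (L2 x)"
    proof (rule B.L_unique)
      fix z
      have "cinner (P1 x - T2 (P1 (L2 x))) (T2 z) = cinner (P1 (P2 x)) (T2 z)"
        by (simp add: P2_def P1_T2[symmetric]) (simp add: P1_def A.L_simps A.T_simps algebra_simps)
      also have "\<dots> = cinner (P2 x) (T2 (P1 z))" by (simp add: P1_adj P1_T2)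
      also have "\<dots> = 0" by (simp add: P2_def B.orthogonal)
      finally show "cinner (P1 x - T2 (P1 (L2 x))) (T2 z) = 0" .
    qed
    then show ?thesis by (simp add: P1_def A.orthogonal)
  qed
  finally show "cinner (L2 x - T1 (L2 (L1 x))) (T1 y) = 0" .
qed

lemma P1_L2: "P1 (L2 x) = L2 (P1 x)"
  by (simp add: P1_def B.L_simps L1_L2 L2_T1)

lemma P1_P2: "P1 (P2 x) = P2 (P1 x)"
  by (simp add: P1_def P2_def B.L_simps B.T_simps A.L_simps A.T_simps L1_L2 L1_T2 L2_T1 T1_T2)

lemma pow_commute:
  "P1 ((T2 ^^ n) x) = (T2 ^^ n) (P1 x)" "P1 ((L2 ^^ n) x) = (L2 ^^ n) (P1 x)"
  "L1 ((L2 ^^ n) x) = (L2 ^^ n) (L1 x)" "(L1 ^^ m) ((L2 ^^ n) x) = (L2 ^^ n) ((L1 ^^ m) x)"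
  "L1 ((T2 ^^ n) x) = (T2 ^^ n) (L1 x)" "(L1 ^^ m) ((T2 ^^ n) x) = (T2 ^^ n) ((L1 ^^ m) x)"
  "T1 ((T2 ^^ n) x) = (T2 ^^ n) (T1 x)" "(T1 ^^ m) ((T2 ^^ n) x) = (T2 ^^ n) ((T1 ^^ m) x)"
  "T1 ((L2 ^^ n) x) = (L2 ^^ n) (T1 x)" "(T1 ^^ m) ((L2 ^^ n) x) = (L2 ^^ n) ((T1 ^^ m) x)"
proof -
  show 1: "P1 ((T2 ^^ n) x) = (T2 ^^ n) (P1 x)" for n x by (induction n) (auto simp: P1_T2)
  show 2: "P1 ((L2 ^^ n) x) = (L2 ^^ n) (P1 x)" for n x by (induction n) (auto simp: P1_L2)
  show 3: "L1 ((L2 ^^ n) x) = (L2 ^^ n) (L1 x)" for n x by (induction n) (auto simp: L1_L2)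
  show 5: "L1 ((T2 ^^ n) x) = (T2 ^^ n) (L1 x)" for n x by (induction n) (auto simp: L1_T2)
  show 7: "T1 ((T2 ^^ n) x) = (T2 ^^ n) (T1 x)" for n x by (induction n) (auto simp: T1_T2)
  show 9: "T1 ((L2 ^^ n) x) = (L2 ^^ n) (T1 x)" for n x by (induction n) (auto simp: L2_T1[symmetric])
  show "(L1 ^^ m) ((L2 ^^ n) x) = (L2 ^^ n) ((L1 ^^ m) x)" by (induction m) (auto simp: 3)
  show "(L1 ^^ m) ((T2 ^^ n) x) = (T2 ^^ n) ((L1 ^^ m) x)" by (induction m) (auto simp: 5)
  show "(T1 ^^ m) ((T2 ^^ n) x) = (T2 ^^ n) ((T1 ^^ m) x)" by (induction m) (auto simp: 7)
  show "(T1 ^^ m) ((L2 ^^ n) x) = (L2 ^^ n) ((T1 ^^ m) x)" by (induction m) (auto simp: 9)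
qed

lemma P2_P1_orthogonal: "cinner (P2 (P1 z)) (T1 y) = 0" "cinner (P2 (P1 z)) (T2 y) = 0"
proof -
  show "cinner (P2 (P1 z)) (T1 y) = 0"
    unfolding P1_P2[symmetric] by (simp add: P1_def A.orthogonal)
  show "cinner (P2 (P1 z)) (T2 y) = 0"
    by (simp add: P2_def B.orthogonal)
qed

lemma double_projection_commute: "P2 ((L2 ^^ n) (P1 ((L1 ^^ m) x))) = P2 (P1 ((L2 ^^ n) ((L1 ^^ m) x)))"
  by (simp add: pow_commute)

text \<open>If all double projections vanish, the expansion along \<open>T2\<close> reduces to its
  remainder, so each P1 (L1^m x) lies in the range of every power of \<open>T2\<close> and is 0 by
  analyticity. The same argument along \<open>T1\<close> then gives x = 0.\<close>

lemma eq_zero_if_projections_zero: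
  assumes zero: "\<And>m n. P2 ((L2 ^^ n) (P1 ((L1 ^^ m) x))) = 0"
  shows "x = 0"
proof -
  have "x = (T1 ^^ M) ((L1 ^^ M) x)" for M
  proof -
    have "P1 ((L1 ^^ m) x) = 0" for m
    proof (rule analytic2)
      fix N
      have "P1 ((L1 ^^ m) x) = (T2 ^^ N) ((L2 ^^ N) (P1 ((L1 ^^ m) x)))"
        using B.telescope[of "P1 ((L1 ^^ m) x)" N]
        by (simp add: P2_def[symmetric] zero B.pow_simps)
      then show "\<exists>z. P1 ((L1 ^^ m) x) = (T2 ^^ N) z" by blast
    qed
    then show ?thesis
      using A.telescope[of x M] by (simp add: P1_def[symmetric] A.pow_simps)
  qed
  then show ?thesis using analytic1 by blast
qed

end

text \<open>The vector \<open>e\<close> corresponds to the constant function 1;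
  \<open>wandering\<close> says that it spans the common kernel of the two adjoints.\<close>

locale shift_pair = commuting_pair T1 L1 T2 L2
  for T1 L1 T2 L2 :: "'h::chilbert_space \<Rightarrow> 'h" +
  fixes e :: 'h
  assumes norm_e: "norm e = 1"
    and e_T1: "cinner e (T1 x) = 0"
    and e_T2: "cinner e (T2 x) = 0"
    and wandering: "(\<And>y. cinner w (T1 y) = 0) \<Longrightarrow> (\<And>y. cinner w (T2 y) = 0) \<Longrightarrow> \<exists>c. w = c *\<^sub>C e"
begin

text \<open>Statements about one operator can thus be proved once and transferred to the
  other.\<close>

lemma swap: "shift_pair T2 L2 T1 L1 e"
proof
  fix x y w
  show "T2 (T1 x) = T1 (T2 x)" "L2 (T1 x) = T1 (L2 x)" "L1 (T2 x) = T2 (L1 x)"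
    by (simp_all add: T1_T2 L1_T2 L2_T1)
  show "cinner (T2 (T1 x)) (T2 (T1 y)) - cinner (T2 x) (T2 y) - cinner (T1 x) (T1 y) + cinner x y = 0"
    using toral[of x y] by (simp add: T1_T2 algebra_simps)
  show "x = 0" if "\<And>n. \<exists>z. x = (T2 ^^ n) z" using that by (rule analytic2)
  show "x = 0" if "\<And>n. \<exists>z. x = (T1 ^^ n) z" using that by (rule analytic1)
  show "norm e = 1" "cinner e (T2 x) = 0" "cinner e (T1 x) = 0" by (fact norm_e e_T2 e_T1)+
  show "\<exists>c. w = c *\<^sub>C e" if "\<And>y. cinner w (T2 y) = 0" "\<And>y. cinner w (T1 y) = 0"
    using that(2,1) by (rule wandering)
qed

text \<open>The Taylor coefficient of the function attached to \<open>x\<close>: the left inverses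
  act as backward shifts, and pairing with \<open>e\<close> is evaluation at the origin.\<close>

definition coef :: "nat \<Rightarrow> nat \<Rightarrow> 'h \<Rightarrow> complex" where
  "coef m n x = cinner ((L1 ^^ m) ((L2 ^^ n) x)) e"

lemma coef_swap: "shift_pair.coef L2 L1 e n m x = coef m n x"
proof -
  interpret S: shift_pair T2 L2 T1 L1 e by (rule swap)
  show ?thesis by (simp add: coef_def S.coef_def pow_commute)
qed

lemma coef_add: "coef m n (x + y) = coef m n x + coef m n y"
  and coef_scaleC: "coef m n (c *\<^sub>C x) = c * coef m n x"
  by (simp_all add: coef_def A.Lpow_add B.Lpow_add A.Lpow_scaleC B.Lpow_scaleC cinner_simps)

lemma coef_sum: "coef m n (sum f I) = (\<Sum>i\<in>I. coef m n (f i))"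
  by (induction I rule: infinite_finite_induct)
    (auto simp: coef_add coef_def[of _ _ 0] A.Lpow_zero B.Lpow_zero)

lemma cmod_coef_le: "cmod (coef m n x) \<le> norm x"
  unfolding coef_def using cmod_cinner_le[of "(L1 ^^ m) ((L2 ^^ n) x)" e] norm_e
    A.norm_Lpow_le[of m "(L2 ^^ n) x"] B.norm_Lpow_le[of n x] by simp

lemma T1_e: "cinner (T1 x) e = 0" and T2_e: "cinner (T2 x) e = 0"
  using e_T1[of x] e_T2[of x] cinner_commute[of "T1 x" e] cinner_commute[of "T2 x" e] by simp_all

lemma coef_T1: "coef m n (T1 x) = (case m of 0 \<Rightarrow> 0 | Suc k \<Rightarrow> coef k n x)"
proof (cases m)
  case 0
  then show ?thesis by (simp add: coef_def T1_e flip: pow_commute(9))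
next
  case (Suc k)
  have "(L1 ^^ Suc k) (T1 y) = (L1 ^^ k) y" for y
    unfolding funpow_Suc_right by (simp add: A.L_T)
  then show ?thesis unfolding coef_def Suc pow_commute(9)[symmetric] by simp
qed

lemma coef_T2: "coef m n (T2 x) = (case n of 0 \<Rightarrow> 0 | Suc k \<Rightarrow> coef m k x)"
proof -
  interpret S: shift_pair T2 L2 T1 L1 e by (rule swap)
  show ?thesis using S.coef_T1[of n m x] by (simp add: coef_swap split: nat.splits)
qed

lemma L1_e: "L1 e = 0" and L2_e: "L2 e = 0"
  by (rule A.L_unique, simp add: e_T1 A.T_simps, rule B.L_unique, simp add: e_T2 B.T_simps)

lemma coef_e: "coef m n e = (if m = 0 \<and> n = 0 then 1 else 0)"
proof (cases "m = 0 \<and> n = 0")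
  case False
  have "(L2 ^^ Suc k) e = 0" "(L1 ^^ Suc k) e = 0" for k
    unfolding funpow_Suc_right by (simp_all add: L1_e L2_e A.Lpow_zero B.Lpow_zero)
  then show ?thesis using False
    by (cases n; cases m) (simp_all add: coef_def A.Lpow_zero del: funpow.simps(2))
qed (simp add: coef_def cinner_self norm_e)

lemma coef_monomial: "coef m n ((T1 ^^ p) ((T2 ^^ q) e)) = (if m = p \<and> n = q then 1 else 0)"
proof -
  have 1: "coef m n ((T2 ^^ q) e) = (if m = 0 \<and> n = q then 1 else 0)" for m n q
    by (induction q arbitrary: n) (auto simp: coef_e coef_T2 split: nat.splits)
  show ?thesis
    by (induction p arbitrary: m) (auto simp: 1 coef_T1 split: nat.splits)
qed

text \<open>The double projection lies in the common kernel, hence is a multiple of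
  \<open>e\<close>. Pairing with \<open>e\<close> finds the factor, since \<open>e\<close> does not
  see the parts in the ranges that the projections remove.\<close>

lemma double_projection: "P2 ((L2 ^^ n) (P1 ((L1 ^^ m) x))) = coef m n x *\<^sub>C e"
proof -
  define z where "z = (L2 ^^ n) ((L1 ^^ m) x)"
  obtain c where c: "P2 (P1 z) = c *\<^sub>C e"
    using wandering[OF P2_P1_orthogonal] by blast
  have "c = cinner (P2 (P1 z)) e" by (simp add: c cinner_scaleC_left cinner_self norm_e)
  also have "\<dots> = cinner z e" by (simp add: P2_def P1_def cinner_diff_left T1_e T2_e)
  also have "\<dots> = coef m n x" by (simp add: coef_def z_def pow_commute)
  finally show ?thesis by (simp only: double_projection_commute z_def[symmetric] c)
qed

lemma coef_inject:
  assumes "\<And>m n. coef m n x = coef m n y"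
  shows "x = y"
proof -
  have zero: "coef m n (x + (-1) *\<^sub>C y) = 0" for m n
    unfolding coef_add coef_scaleC assms[of m n] by simp
  have "x + (-1) *\<^sub>C y = 0"
    by (rule eq_zero_if_projections_zero) (simp only: double_projection zero complex_vector.scale_zero_left)
  then show ?thesis by (simp add: scaleC_minus1)
qed

end

section \<open>The energy of a coefficient array\<close>

text \<open>Otherwise the terms would eventually exceed \<epsilon>/(M+1) and the harmonic series
  would converge. The lower bound \<open>k\<close> is free, so suitable indices occur arbitrarily
  far out.\<close>

lemma finite_suminf_frequently_small:
  fixes f :: "nat \<Rightarrow> ennreal"
  assumes fin: "(\<Sum>i. f i) < \<infinity>" and "\<epsilon> > 0"
  shows "\<exists>M\<ge>k. of_nat (Suc M) * f M \<le> ennreal \<epsilon>"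
proof (rule ccontr)
  assume neg: "\<not> ?thesis"
  have gt: "ennreal \<epsilon> < of_nat (Suc M) * f M" if "M \<ge> k" for M
    using neg that by (meson not_le)
  have f_fin: "f i < \<infinity>" for i
    using fin ennreal_suminf_lessD[of f \<infinity> i] by simp
  define g where "g i = enn2real (f i)" for i
  have fg: "f i = ennreal (g i)" for i
    using f_fin[of i] by (simp add: g_def)
  have "summable g"
  proof (rule summable_suminf_not_top)
    show "0 \<le> g i" for i by (simp add: g_def)
    show "(\<Sum>i. ennreal (g i)) \<noteq> top" using fin unfolding fg by simp
  qed
  moreover have "norm (\<epsilon> * inverse (real (Suc M))) \<le> g M" if "M \<ge> k" for M
  proof -
    have "ennreal \<epsilon> < ennreal (real (Suc M) * g M)"
      using gt[OF that] unfolding fg ennreal_of_nat_eq_real_of_nat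
      by (subst ennreal_mult) (auto simp: g_def)
    then have "\<epsilon> < real (Suc M) * g M"
      using \<open>\<epsilon> > 0\<close> by (simp add: ennreal_less_iff)
    then show ?thesis using \<open>\<epsilon> > 0\<close> by (simp add: field_simps)
  qed
  ultimately have "summable (\<lambda>M. \<epsilon> * inverse (real (Suc M)))"
    by (rule summable_comparison_test'[where N = k])
  then have "summable (\<lambda>M. inverse (real (Suc M)))"
    using \<open>\<epsilon> > 0\<close> summable_mult_D[of \<epsilon>] by simp
  then show False
    using not_summable_harmonic[where 'a = real] summable_Suc_iff[of "\<lambda>n. inverse (real n)"] by simp
qed

text \<open>The operator version of a Taylor polynomial of the derivative, with T^k e in place of
  \<zeta>^k.\<close>

definition (in two_isometry) part :: "'h \<Rightarrow> (nat \<Rightarrow> complex) \<Rightarrow> nat \<Rightarrow> 'h" where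
  "part e c K = (\<Sum>k\<le>K. (of_nat (Suc k) * c (Suc k)) *\<^sub>C (T ^^ k) e)"

lemma (in two_isometry) part_alt:
  "part e c K = (\<Sum>k\<le>K. real (Suc k) *\<^sub>R (T ^^ k) (c (Suc k) *\<^sub>C e))"
  by (simp add: part_def pow_scaleC scaleR_scaleC scaleC_scaleC del: of_nat_Suc)

context shift_pair
begin

definition energy :: "(nat \<Rightarrow> nat \<Rightarrow> complex) \<Rightarrow> ennreal" where
  "energy a = (\<Sum>m. \<Sum>n. ennreal ((cmod (a m n))\<^sup>2))
     + (\<Sum>n. \<Sum>K. ennreal (weight K * A.defect (A.part e (\<lambda>m. a m n) K)))
     + (\<Sum>m. \<Sum>K. ennreal (weight K * B.defect (B.part e (a m) K)))"

text \<open>This is the mixed toral identity on the diagonal, regrouped as a difference of two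
  defects.\<close>

lemma defect1_T2: "A.defect (T2 x) = A.defect x"
proof -
  have "complex_of_real (A.defect (T2 x)) = of_real (A.defect x)"
    using toral[of x x] unfolding A.dform_self[symmetric] A.dform_def by (simp add: algebra_simps)
  then show ?thesis by simp
qed

text \<open>Peel off the lowest power of \<open>T2\<close>: \<open>v 0\<close> and its image under
  \<open>T1\<close> are both orthogonal to the range of \<open>T2\<close>, so the cross term of the
  defect vanishes, and invariance removes the common factor \<open>T2\<close> from the rest. The
  vector \<open>r\<close> is unrestricted.\<close>

lemma defect1_sum:
  assumes "\<And>n z. n \<le> M \<Longrightarrow> cinner (v n) (T2 z) = 0" "\<And>n z. n \<le> M \<Longrightarrow> cinner (T1 (v n)) (T2 z) = 0"
  shows "A.defect ((\<Sum>n\<le>M. (T2 ^^ n) (v n)) + (T2 ^^ Suc M) r) = (\<Sum>n\<le>M. A.defect (v n)) + A.defect r"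
  using assms
proof (induction M arbitrary: v)
  case 0
  have "A.dform (v 0) (T2 r) = 0"
    by (simp add: A.dform_def 0 T1_T2)
  then show ?case by (simp add: A.defect_add defect1_T2)
next
  case (Suc M)
  define w where "w = (\<Sum>n\<le>M. (T2 ^^ n) (v (Suc n))) + (T2 ^^ Suc M) r"
  have eq: "(\<Sum>n\<le>Suc M. (T2 ^^ n) (v n)) + (T2 ^^ Suc (Suc M)) r = v 0 + T2 w"
    unfolding w_def by (subst sum.atMost_Suc_shift) (simp add: B.T_simps)
  have "A.dform (v 0) (T2 w) = 0"
    by (simp add: A.dform_def Suc.prems T1_T2)
  moreover have "A.defect w = (\<Sum>n\<le>M. A.defect (v (Suc n))) + A.defect r"
    unfolding w_def by (rule Suc.IH) (use Suc.prems in auto)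
  ultimately show ?case
    unfolding eq A.defect_add by (simp add: defect1_T2 sum.atMost_Suc_shift del: sum.atMost_Suc)
qed

text \<open>\<open>L2\<close> commutes with powers of \<open>T1\<close> and annihilates
  \<open>e\<close>, so projecting T1^k e away from the range of \<open>T2\<close> changes
  nothing.\<close>

lemma pow_e_orthogonal: "cinner ((T1 ^^ k) e) (T2 z) = 0"
proof -
  have "(T1 ^^ k) e - T2 (L2 ((T1 ^^ k) e)) = (T1 ^^ k) e"
    using pow_commute(10)[of k 1 e] by (simp add: L2_e A.pow_simps B.T_simps)
  then show ?thesis using B.orthogonal[of "(T1 ^^ k) e" z] by simp
qed

lemma part_orthogonal:
  "cinner (A.part e c K) (T2 z) = 0" "cinner (T1 (A.part e c K)) (T2 z) = 0"
proof -
  have "cinner (T1 ((T1 ^^ k) e)) (T2 z) = 0" for k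
    using pow_e_orthogonal[of "Suc k"] by simp
  then show "cinner (A.part e c K) (T2 z) = 0" "cinner (T1 (A.part e c K)) (T2 z) = 0"
    by (simp_all add: A.part_def A.T_simps cinner_sum_left cinner_scaleC_left pow_e_orthogonal)
qed

text \<open>The one-operator inequality along \<open>T1\<close> produces the vectors
  \<open>y m\<close>; the same inequality along \<open>T2\<close> bounds each of their norms below.
  The defect terms of the first step split over the powers of \<open>T2\<close>, and the defect of
  the unrestricted remainder is dropped because it is nonnegative.\<close>

lemma norm_ge_partial_energy:
  "(\<Sum>m\<le>M. \<Sum>n\<le>M. (cmod (coef m n x))\<^sup>2)
     + (\<Sum>n\<le>M. \<Sum>K<M. weight K * A.defect (A.part e (\<lambda>m. coef m n x) K))
     + (\<Sum>m\<le>M. \<Sum>K<M. weight K * B.defect (B.part e (\<lambda>n. coef m n x) K)) \<le> (norm x)\<^sup>2"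
proof -
  define y where "y m = P1 ((L1 ^^ m) x)" for m
  define r where "r m = (L2 ^^ Suc M) (y m)" for m
  have y_row: "(L2 ^^ n) (y m) - T2 (L2 ((L2 ^^ n) (y m))) = coef m n x *\<^sub>C e" for m n
    using double_projection[of n m x] by (simp add: y_def P2_def)
  have y: "y m = (\<Sum>n\<le>M. (T2 ^^ n) (coef m n x *\<^sub>C e)) + (T2 ^^ Suc M) (r m)" for m
    using B.telescope[of "y m" "Suc M"] by (simp only: y_row r_def lessThan_Suc_atMost)
  have 1: "(\<Sum>m\<le>M. (norm (y m))\<^sup>2)
      + (\<Sum>K<M. weight K * A.defect (\<Sum>k\<le>K. real (Suc k) *\<^sub>R (T1 ^^ k) (y (Suc k)))) \<le> (norm x)\<^sup>2"
    using A.norm_ge_sum_defect[of y x M] by (simp add: y_def P1_def weight_def)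
  have 2: "(\<Sum>n\<le>M. (cmod (coef m n x))\<^sup>2)
      + (\<Sum>K<M. weight K * B.defect (B.part e (\<lambda>n. coef m n x) K)) \<le> (norm (y m))\<^sup>2" for m
    using B.norm_ge_sum_defect[of "\<lambda>n. coef m n x *\<^sub>C e" "y m" M]
    by (simp add: y_row weight_def B.part_alt norm_scaleC norm_e)
  have 3: "A.defect (\<Sum>k\<le>K. real (Suc k) *\<^sub>R (T1 ^^ k) (y (Suc k)))
      \<ge> (\<Sum>n\<le>M. A.defect (A.part e (\<lambda>m. coef m n x) K))" for K
  proof -
    have "(\<Sum>k\<le>K. real (Suc k) *\<^sub>R (T1 ^^ k) (y (Suc k)))
      = (\<Sum>n\<le>M. (T2 ^^ n) (A.part e (\<lambda>m. coef m n x) K))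
        + (T2 ^^ Suc M) (\<Sum>k\<le>K. real (Suc k) *\<^sub>R (T1 ^^ k) (r (Suc k)))"
      by (subst y) (simp only: A.part_alt A.pow_simps B.pow_simps scaleR_add_right
        scaleR_sum_right sum.distrib pow_commute, subst sum.swap, simp)
    then show ?thesis
      using defect1_sum[of M "\<lambda>n. A.part e (\<lambda>m. coef m n x) K"]
      by (simp add: part_orthogonal A.defect_nonneg)
  qed
  have "(\<Sum>n\<le>M. \<Sum>K<M. weight K * A.defect (A.part e (\<lambda>m. coef m n x) K))
      \<le> (\<Sum>K<M. weight K * A.defect (\<Sum>k\<le>K. real (Suc k) *\<^sub>R (T1 ^^ k) (y (Suc k))))"
    by (subst sum.swap) (intro sum_mono, simp only: sum_distrib_left[symmetric],
        intro mult_left_mono 3 less_imp_le weight_pos)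
  moreover have "(\<Sum>m\<le>M. \<Sum>n\<le>M. (cmod (coef m n x))\<^sup>2)
      + (\<Sum>m\<le>M. \<Sum>K<M. weight K * B.defect (B.part e (\<lambda>n. coef m n x) K)) \<le> (\<Sum>m\<le>M. (norm (y m))\<^sup>2)"
    unfolding sum.distrib[symmetric] by (intro sum_mono 2)
  ultimately show ?thesis using 1 by linarith
qed

lemma energy_coef_le: "energy (\<lambda>m n. coef m n x) \<le> ennreal ((norm x)\<^sup>2)"
proof -
  let ?f = "\<lambda>m n. ennreal ((cmod (coef m n x))\<^sup>2)"
  let ?g = "\<lambda>n K. ennreal (weight K * A.defect (A.part e (\<lambda>m. coef m n x) K))"
  let ?h = "\<lambda>m K. ennreal (weight K * B.defect (B.part e (\<lambda>n. coef m n x) K))"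
  have inc: "incseq (\<lambda>M. \<Sum>i<M. \<Sum>j<M. f i j)" for f :: "nat \<Rightarrow> nat \<Rightarrow> ennreal"
  proof (rule incseq_SucI)
    fix M
    have "(\<Sum>i<M. \<Sum>j<M. f i j) \<le> (\<Sum>i<Suc M. \<Sum>j<M. f i j)" by (intro sum_mono2) auto
    also have "\<dots> \<le> (\<Sum>i<Suc M. \<Sum>j<Suc M. f i j)" by (intro sum_mono sum_mono2) auto
    finally show "(\<Sum>i<M. \<Sum>j<M. f i j) \<le> (\<Sum>i<Suc M. \<Sum>j<Suc M. f i j)" .
  qed
  have add3: "(SUP M. \<Sum>i<M. \<Sum>j<M. f i j) + (SUP M. \<Sum>i<M. \<Sum>j<M. g i j) + (SUP M. \<Sum>i<M. \<Sum>j<M. h i j)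
    = (SUP M. (\<Sum>i<M. \<Sum>j<M. f i j) + (\<Sum>i<M. \<Sum>j<M. g i j) + (\<Sum>i<M. \<Sum>j<M. h i j))"
    for f g h :: "nat \<Rightarrow> nat \<Rightarrow> ennreal"
  proof -
    have "incseq (\<lambda>M. (\<Sum>i<M. \<Sum>j<M. f i j) + (\<Sum>i<M. \<Sum>j<M. g i j))"
      using inc[of f] inc[of g] unfolding incseq_def by (blast intro: add_mono)
    then show ?thesis
      by (simp only: ennreal_SUP_add[OF inc inc, symmetric] ennreal_SUP_add[OF _ inc, symmetric])
  qed
  have "energy (\<lambda>m n. coef m n x) = (SUP M. (\<Sum>m<M. \<Sum>n<M. ?f m n) + (\<Sum>n<M. \<Sum>K<M. ?g n K) + (\<Sum>m<M. \<Sum>K<M. ?h m K))"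
    unfolding energy_def suminf_suminf_SUP by (rule add3)
  also have "\<dots> \<le> ennreal ((norm x)\<^sup>2)"
  proof (rule SUP_least)
    fix M
    have "(\<Sum>m<M. \<Sum>n<M. ?f m n) + (\<Sum>n<M. \<Sum>K<M. ?g n K) + (\<Sum>m<M. \<Sum>K<M. ?h m K)
       \<le> (\<Sum>m\<le>M. \<Sum>n\<le>M. ?f m n) + (\<Sum>n\<le>M. \<Sum>K<M. ?g n K) + (\<Sum>m\<le>M. \<Sum>K<M. ?h m K)"
      by (intro add_mono sum_mono2 order_trans[OF sum_mono sum_mono2]) (auto intro!: sum_mono2)
    also have "\<dots> = ennreal ((\<Sum>m\<le>M. \<Sum>n\<le>M. (cmod (coef m n x))\<^sup>2)
     + (\<Sum>n\<le>M. \<Sum>K<M. weight K * A.defect (A.part e (\<lambda>m. coef m n x) K))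
     + (\<Sum>m\<le>M. \<Sum>K<M. weight K * B.defect (B.part e (\<lambda>n. coef m n x) K)))"
      by (simp add: sum_ennreal sum_nonneg A.defect_nonneg B.defect_nonneg weight_pos less_imp_le
          flip: ennreal_plus)
    also have "\<dots> \<le> ennreal ((norm x)\<^sup>2)"
      by (intro ennreal_leI norm_ge_partial_energy)
    finally show "(\<Sum>m<M. \<Sum>n<M. ?f m n) + (\<Sum>n<M. \<Sum>K<M. ?g n K) + (\<Sum>m<M. \<Sum>K<M. ?h m K)
       \<le> ennreal ((norm x)\<^sup>2)" .
  qed
  finally show ?thesis .
qed

text \<open>The rectangle reaches \<open>Suc M\<close> and \<open>Suc N\<close> because
  \<open>part\<close> at index K involves the coefficient \<open>Suc K\<close>.\<close>

definition truncation :: "(nat \<Rightarrow> nat \<Rightarrow> complex) \<Rightarrow> nat \<Rightarrow> nat \<Rightarrow> 'h" where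
  "truncation a M N = (\<Sum>m\<le>Suc M. (T1 ^^ m) (\<Sum>n\<le>Suc N. (T2 ^^ n) (a m n *\<^sub>C e)))"

lemma coef_truncation:
  assumes "m \<le> Suc M" "n \<le> Suc N"
  shows "coef m n (truncation a M N) = a m n"
proof -
  have "coef m n (truncation a M N) = (\<Sum>p\<le>Suc M. \<Sum>q\<le>Suc N. a p q * (if m = p \<and> n = q then 1 else 0))"
    unfolding truncation_def A.pow_simps B.pow_simps coef_sum coef_scaleC coef_monomial ..
  also have "\<dots> = (\<Sum>p\<le>Suc M. if p = m then a p n else 0)"
  proof (intro sum.cong refl)
    fix p
    have "(\<Sum>q\<le>Suc N. a p q * (if m = p \<and> n = q then 1 else 0)) = (\<Sum>q\<le>Suc N. if q = n then (if p = m then a p q else 0) else 0)"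
      by (intro sum.cong) auto
    then show "(\<Sum>q\<le>Suc N. a p q * (if m = p \<and> n = q then 1 else 0)) = (if p = m then a p n else 0)"
      using assms by (simp del: sum.atMost_Suc)
  qed
  also have "\<dots> = a m n" using assms by (simp del: sum.atMost_Suc)
  finally show ?thesis .
qed

lemma pow2_e_orthogonal: "cinner ((T2 ^^ k) e) (T1 z) = 0"
proof -
  interpret S: shift_pair T2 L2 T1 L1 e by (rule swap)
  show ?thesis by (rule S.pow_e_orthogonal)
qed

text \<open>For a polynomial in \<open>T1\<close>, \<open>T2\<close> applied to \<open>e\<close> all
  the orthogonality conditions hold, so the norm formula is exact in both directions. The last two
  terms are the boundary terms.\<close>

lemma norm_truncation:
  "(norm (truncation a M N))\<^sup>2 = (\<Sum>m\<le>Suc M. \<Sum>n\<le>Suc N. (cmod (a m n))\<^sup>2)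
     + (\<Sum>n\<le>Suc N. \<Sum>K\<le>M. weight K * A.defect (A.part e (\<lambda>m. a m n) K))
     + (\<Sum>m\<le>Suc M. \<Sum>K\<le>N. weight K * B.defect (B.part e (a m) K))
     + (\<Sum>n\<le>Suc N. A.defect (A.part e (\<lambda>m. a m n) M)) / real (Suc (Suc M))
     + (\<Sum>m\<le>Suc M. B.defect (B.part e (a m) N)) / real (Suc (Suc N))"
proof -
  define y where "y m = (\<Sum>n\<le>Suc N. (T2 ^^ n) (a m n *\<^sub>C e))" for m
  have "cinner (y m) (T1 z) = 0" for m z
    by (simp only: y_def B.pow_simps cinner_sum_left cinner_scaleC_left pow2_e_orthogonal) simp
  then have 1: "(norm (truncation a M N))\<^sup>2 = (\<Sum>m\<le>Suc M. (norm (y m))\<^sup>2)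
     + (\<Sum>K\<le>M. weight K * A.defect (\<Sum>k\<le>K. real (Suc k) *\<^sub>R (T1 ^^ k) (y (Suc k))))
     + A.defect (\<Sum>k\<le>M. real (Suc k) *\<^sub>R (T1 ^^ k) (y (Suc k))) / real (Suc (Suc M))"
    unfolding truncation_def y_def[symmetric]
    by (subst A.norm_sum_pow) (auto simp: weight_def)
  have 2: "(norm (y m))\<^sup>2 = (\<Sum>n\<le>Suc N. (cmod (a m n))\<^sup>2)
     + (\<Sum>K\<le>N. weight K * B.defect (B.part e (a m) K)) + B.defect (B.part e (a m) N) / real (Suc (Suc N))" for m
    unfolding y_def
    by (subst B.norm_sum_pow) (auto simp: weight_def B.part_alt norm_scaleC norm_e cinner_scaleC_left e_T2)
  have 3: "A.defect (\<Sum>k\<le>K. real (Suc k) *\<^sub>R (T1 ^^ k) (y (Suc k)))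
      = (\<Sum>n\<le>Suc N. A.defect (A.part e (\<lambda>m. a m n) K))" for K
  proof -
    have "(\<Sum>k\<le>K. real (Suc k) *\<^sub>R (T1 ^^ k) (y (Suc k)))
      = (\<Sum>n\<le>Suc N. (T2 ^^ n) (A.part e (\<lambda>m. a m n) K)) + (T2 ^^ Suc (Suc N)) 0"
      by (simp only: y_def A.part_alt A.pow_simps B.pow_simps
        scaleR_sum_right pow_commute, subst sum.swap, simp)
    then show ?thesis
      using defect1_sum[of "Suc N" "\<lambda>n. A.part e (\<lambda>m. a m n) K" 0]
      by (simp only: part_orthogonal A.defect_zero add_0_right)
  qed
  show ?thesis
    unfolding 1 2 3 sum.distrib sum_distrib_left sum_divide_distrib
    by (subst (2) sum.swap) (simp only: add_ac)
qed

text \<open>The boundary term of side \<open>M\<close> is bounded by a sum over all n, whatever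
  \<open>N\<close> is, and symmetrically for \<open>N\<close>; so the two sides can be chosen
  independently, both beyond \<open>k\<close>.\<close>

lemma finite_energy_truncation:
  assumes fin: "energy a < \<infinity>" and "\<epsilon> > 0"
  shows "\<exists>x. (\<forall>m\<le>k. \<forall>n\<le>k. coef m n x = a m n) \<and> ennreal ((norm x)\<^sup>2) \<le> energy a + ennreal (2 * \<epsilon>)"
proof -
  define f where "f K = (\<Sum>n. ennreal (weight K * A.defect (A.part e (\<lambda>m. a m n) K)))" for K
  define g where "g K = (\<Sum>m. ennreal (weight K * B.defect (B.part e (a m) K)))" for K
  \<comment> \<open>The boundary coefficient 1/(M+2) equals (M+1) times \<open>weight M\<close>; the
    factor M + 1 is the one supplied by \<open>finite_suminf_frequently_small\<close>.\<close>
  have small: "ennreal ((\<Sum>n\<in>I. d n) / real (Suc (Suc M))) \<le> ennreal \<epsilon>"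
    if le: "of_nat (Suc M) * (\<Sum>n. ennreal (weight M * d n)) \<le> ennreal \<epsilon>"
      and d: "\<And>n. d n \<ge> 0" and "finite I" for d :: "nat \<Rightarrow> real" and M and I
  proof -
    have "(\<Sum>n\<in>I. d n) / real (Suc (Suc M)) = real (Suc M) * (\<Sum>n\<in>I. weight M * d n)"
      by (simp add: weight_def sum_distrib_left sum_divide_distrib del: of_nat_Suc)
    then have "ennreal ((\<Sum>n\<in>I. d n) / real (Suc (Suc M))) = ennreal (real (Suc M) * (\<Sum>n\<in>I. weight M * d n))"
      by (simp only:)
    also have "\<dots> = ennreal (real (Suc M)) * ennreal (\<Sum>n\<in>I. weight M * d n)"
      by (intro ennreal_mult sum_nonneg mult_nonneg_nonneg d less_imp_le[OF weight_pos]) simp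
    also have "\<dots> = of_nat (Suc M) * (\<Sum>n\<in>I. ennreal (weight M * d n))"
      unfolding ennreal_of_nat_eq_real_of_nat
      by (intro arg_cong2[where f = "(*)"] refl sum_ennreal[symmetric] mult_nonneg_nonneg d less_imp_le[OF weight_pos])
    also have "\<dots> \<le> of_nat (Suc M) * (\<Sum>n. ennreal (weight M * d n))"
      by (intro mult_left_mono sum_le_suminf that) auto
    finally show ?thesis using le by (rule order_trans)
  qed
  have "(\<Sum>K. f K) \<le> energy a" "(\<Sum>K. g K) \<le> energy a"
    unfolding energy_def f_def g_def
    by (simp_all only: suminf_swap_ennreal[of "\<lambda>K n. ennreal (weight K * A.defect (A.part e (\<lambda>m. a m n) K))"]
        suminf_swap_ennreal[of "\<lambda>K m. ennreal (weight K * B.defect (B.part e (a m) K))"])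
      (auto simp: add_increasing add_increasing2)
  then have "(\<Sum>K. f K) < \<infinity>" "(\<Sum>K. g K) < \<infinity>"
    using fin by (auto intro: order_le_less_trans)
  from finite_suminf_frequently_small[OF this(1) \<open>\<epsilon> > 0\<close>, of k]
    finite_suminf_frequently_small[OF this(2) \<open>\<epsilon> > 0\<close>, of k]
  obtain M N where MN: "M \<ge> k" "N \<ge> k"
    and M: "of_nat (Suc M) * f M \<le> ennreal \<epsilon>" and N: "of_nat (Suc N) * g N \<le> ennreal \<epsilon>"
    by blast
  have double: "ennreal (\<Sum>i\<in>I. \<Sum>j\<in>J. h i j) \<le> (\<Sum>i. \<Sum>j. ennreal (h i j))"
    if "\<And>i j. h i j \<ge> 0" "finite I" "finite J" for h :: "nat \<Rightarrow> nat \<Rightarrow> real" and I J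
  proof -
    have "ennreal (\<Sum>i\<in>I. \<Sum>j\<in>J. h i j) = (\<Sum>i\<in>I. \<Sum>j\<in>J. ennreal (h i j))"
      using that by (simp add: sum_ennreal sum_nonneg)
    also have "\<dots> \<le> (\<Sum>i\<in>I. \<Sum>j. ennreal (h i j))" by (intro sum_mono sum_le_suminf that) auto
    also have "\<dots> \<le> (\<Sum>i. \<Sum>j. ennreal (h i j))" by (intro sum_le_suminf that) auto
    finally show ?thesis .
  qed
  have "ennreal ((norm (truncation a M N))\<^sup>2) \<le> energy a + ennreal \<epsilon> + ennreal \<epsilon>"
    unfolding norm_truncation energy_def
    by (subst ennreal_plus, (simp add: add_nonneg_nonneg sum_nonneg A.defect_nonneg B.defect_nonneg less_imp_le[OF weight_pos] divide_nonneg_nonneg; fail)+)+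
      (intro add_mono double small[OF M[unfolded f_def]] small[OF N[unfolded g_def]],
        auto simp: A.defect_nonneg B.defect_nonneg less_imp_le[OF weight_pos])
  also have "\<dots> = energy a + ennreal (2 * \<epsilon>)"
    using \<open>\<epsilon> > 0\<close> by (simp add: add.assoc flip: ennreal_plus)
  finally show ?thesis
    using MN by (intro exI[of _ "truncation a M N"]) (auto simp: coef_truncation)
qed

lemma continuous_coef: "continuous_on UNIV (coef m n)"
proof -
  have "continuous_on UNIV (\<lambda>x. cinner x e)"
    by (intro linear_continuous_on bounded_linear_cinner_left)
  then show ?thesis
    unfolding coef_def
    by (intro continuous_on_compose2[OF \<open>continuous_on UNIV (\<lambda>x. cinner x e)\<close>]
        continuous_on_compose2[OF A.continuous_Lpow] B.continuous_Lpow) auto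
qed

text \<open>The truncations meet ever more of the conditions on coefficients within one fixed ball.
  Each finite set of conditions cuts out a closed convex set, so a vector satisfying all of them
  exists.\<close>

lemma finite_energy_coef:
  assumes fin: "energy a < \<infinity>"
  shows "\<exists>x. (\<forall>m n. coef m n x = a m n) \<and> ennreal ((norm x)\<^sup>2) \<le> energy a"
proof -
  define E where "E = enn2real (energy a)"
  have E: "energy a = ennreal E" "0 \<le> E" using fin by (simp_all add: E_def less_top)
  have ex: "\<exists>x. (\<forall>m n. coef m n x = a m n) \<and> norm x \<le> sqrt (E + 2 * \<epsilon>)" if eps: "\<epsilon> > 0" for \<epsilon>
  proof -
    define R where "R = sqrt (E + 2 * \<epsilon>)"
    define C where "C k = {x. \<forall>m\<le>k. \<forall>n\<le>k. coef m n x = a m n}" for k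
    have "\<exists>x. (\<forall>k. x \<in> C k) \<and> norm x \<le> R"
    proof (rule nested_closed_convex_Inter)
      fix k
      have "C k = (\<Inter>m\<in>{..k}. \<Inter>n\<in>{..k}. {x. coef m n x = a m n})" by (auto simp: C_def)
      moreover have "closed {x. coef m n x = a m n}" for m n
        by (intro closed_Collect_eq continuous_coef continuous_on_const)
      ultimately show "closed (C k)" by (simp only:) (intro closed_INT ballI)
      show "C (Suc k) \<subseteq> C k" by (auto simp: C_def)
      show "convex (C k)"
      proof (rule convexI)
        fix x y and u v :: real assume "x \<in> C k" "y \<in> C k" "u + v = 1"
        moreover have "of_real u * c + of_real v * c = c" if "u + v = 1" for c :: complex
          using that by (metis distrib_right mult_1 of_real_1 of_real_add)
        ultimately show "u *\<^sub>R x + v *\<^sub>R y \<in> C k"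
          by (simp add: C_def coef_add scaleR_scaleC coef_scaleC)
      qed
      from finite_energy_truncation[OF fin eps, of k]
      obtain x where x: "x \<in> C k" "ennreal ((norm x)\<^sup>2) \<le> energy a + ennreal (2 * \<epsilon>)"
        unfolding C_def mem_Collect_eq by blast
      have "energy a + ennreal (2 * \<epsilon>) = ennreal (E + 2 * \<epsilon>)"
        unfolding E(1) using eps E(2) by (intro ennreal_plus[symmetric]) auto
      with x(2) have "ennreal ((norm x)\<^sup>2) \<le> ennreal (E + 2 * \<epsilon>)" by (simp only:)
      then have "(norm x)\<^sup>2 \<le> E + 2 * \<epsilon>"
        using eps E(2) by (subst (asm) ennreal_le_iff) auto
      then have "norm x \<le> R" unfolding R_def by (rule real_le_rsqrt)
      then show "\<exists>x\<in>C k. norm x \<le> R" using x(1) by blast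
    qed
    then obtain x where x: "\<And>k. x \<in> C k" and "norm x \<le> R" by blast
    moreover have "coef m n x = a m n" for m n
      using x[of "max m n"] by (simp add: C_def)
    ultimately show ?thesis unfolding R_def by (intro exI[of _ x] conjI allI)
  qed
  obtain x where x: "\<And>m n. coef m n x = a m n" using ex[of 1] by auto
  \<comment> \<open>The vector found for each \<epsilon> is always the same one by
    \<open>coef_inject\<close>, so the bounds accumulate on \<open>x\<close> and the slack can be
    sent to 0.\<close>
  have "(norm x)\<^sup>2 \<le> E + \<epsilon>" if "\<epsilon> > 0" for \<epsilon>
  proof -
    have "\<epsilon> / 2 > 0" using that by simp
    from ex[OF this] obtain x' where x': "\<And>m n. coef m n x' = a m n"
        "norm x' \<le> sqrt (E + 2 * (\<epsilon> / 2))"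
      by blast
    have "x' = x" by (rule coef_inject) (simp only: x x')
    then have "norm x \<le> sqrt (E + \<epsilon>)"
      using x'(2) by (simp only: mult_2 field_sum_of_halves)
    then have "(norm x)\<^sup>2 \<le> (sqrt (E + \<epsilon>))\<^sup>2"
      by (rule power_mono) simp
    also have "\<dots> = E + \<epsilon>" using that E(2) by (intro real_sqrt_pow2) simp
    finally show ?thesis .
  qed
  then have "(norm x)\<^sup>2 \<le> E" by (rule field_le_epsilon)
  then have "ennreal ((norm x)\<^sup>2) \<le> ennreal (E)" by (rule ennreal_leI)
  also have "\<dots> = energy a" by (simp only: E)
  finally show ?thesis by (intro exI[of _ x] conjI allI x)
qed

text \<open>For the missing inequality, reconstruct a vector from the coefficients of
  \<open>x\<close>: its norm is controlled by the energy, and it is \<open>x\<close> itself by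
  uniqueness.\<close>

lemma energy_coef: "energy (\<lambda>m n. coef m n x) = ennreal ((norm x)\<^sup>2)"
proof (rule antisym)
  show "energy (\<lambda>m n. coef m n x) \<le> ennreal ((norm x)\<^sup>2)" by (rule energy_coef_le)
  have "energy (\<lambda>m n. coef m n x) < \<infinity>"
    unfolding infinity_ennreal_def by (rule order_le_less_trans[OF energy_coef_le[of x] ennreal_less_top])
  from finite_energy_coef[OF this] obtain x' where x': "\<And>m n. coef m n x' = coef m n x"
      "ennreal ((norm x')\<^sup>2) \<le> energy (\<lambda>m n. coef m n x)"
    by blast
  have "x' = x" using x'(1) by (rule coef_inject)
  from x'(2)[unfolded this] show "ennreal ((norm x)\<^sup>2) \<le> energy (\<lambda>m n. coef m n x)" .
qed

end

section \<open>The model on the Dirichlet-type space\<close>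

lemma shifted_series:
  fixes c :: "nat \<Rightarrow> complex"
  assumes "summable (\<lambda>n. c n * z ^ n)"
  shows "(\<Sum>n. (case n of 0 \<Rightarrow> 0 | Suc k \<Rightarrow> c k) * z ^ n) = z * (\<Sum>n. c n * z ^ n)"
proof -
  have "(\<lambda>n. (case Suc n of 0 \<Rightarrow> 0 | Suc k \<Rightarrow> c k) * z ^ Suc n) sums (z * (\<Sum>n. c n * z ^ n))"
    using sums_mult[OF summable_sums[OF assms], of z] by (simp add: mult_ac)
  from sums_Suc[OF this] show ?thesis by (simp add: sums_iff)
qed

lemma bpower_add:
  assumes "bounded_array a A" "bounded_array b B"
  shows "bpower (\<lambda>m n. a m n + b m n) p = bpower a p + bpower b p"
proof (cases "p \<in> bidisc")
  case True
  interpret a: bounded_array a A by fact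
  interpret b: bounded_array b B by fact
  have p: "cmod (fst p) < 1" "cmod (snd p) < 1" using True by auto
  have "column (\<lambda>m n. a m n + b m n) n (fst p) = column a n (fst p) + column b n (fst p)" for n
    unfolding column_def distrib_right
    by (rule suminf_add[symmetric]) (intro summable_norm_cancel[OF a.column_summable] summable_norm_cancel[OF b.column_summable] p)+
  then show ?thesis
    using True suminf_add[OF summable_norm_cancel[OF a.bpower_summable(1)[OF p]] summable_norm_cancel[OF b.bpower_summable(1)[OF p]]]
    by (simp add: bpower_def distrib_right)
qed (auto simp: bpower_def)

lemma bpower_scale:
  assumes "bounded_array a A"
  shows "bpower (\<lambda>m n. c * a m n) p = c * bpower a p"
proof (cases "p \<in> bidisc")
  case True
  interpret a: bounded_array a A by fact
  have p: "cmod (fst p) < 1" "cmod (snd p) < 1" using True by auto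
  have "column (\<lambda>m n. c * a m n) n (fst p) = c * column a n (fst p)" for n
    unfolding column_def mult.assoc by (rule suminf_mult[OF summable_norm_cancel[OF a.column_summable[OF p(1)]]])
  then show ?thesis
    using True suminf_mult[OF summable_norm_cancel[OF a.bpower_summable(1)[OF p]], of c]
    by (simp add: bpower_def mult.assoc)
qed (auto simp: bpower_def)

lemma bpower_shift:
  assumes "bounded_array a A"
  shows "bpower (\<lambda>m n. case m of 0 \<Rightarrow> 0 | Suc k \<Rightarrow> a k n) = mult_z1 (bpower a)"
    and "bpower (\<lambda>m n. case n of 0 \<Rightarrow> 0 | Suc k \<Rightarrow> a m k) = mult_z2 (bpower a)"
proof -
  interpret a: bounded_array a A by fact
  have "bpower (\<lambda>m n. case m of 0 \<Rightarrow> 0 | Suc k \<Rightarrow> a k n) p = mult_z1 (bpower a) p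
      \<and> bpower (\<lambda>m n. case n of 0 \<Rightarrow> 0 | Suc k \<Rightarrow> a m k) p = mult_z2 (bpower a) p" for p
  proof (cases "p \<in> bidisc")
    case True
    then have p: "cmod (fst p) < 1" "cmod (snd p) < 1" by auto
    have 1: "column (\<lambda>m n. case m of 0 \<Rightarrow> 0 | Suc k \<Rightarrow> a k n) n (fst p) = fst p * column a n (fst p)" for n
      unfolding column_def by (rule shifted_series[OF summable_norm_cancel[OF a.column_summable[OF p(1)]]])
    have 2: "column (\<lambda>m n. case n of 0 \<Rightarrow> 0 | Suc k \<Rightarrow> a m k) n (fst p)
        = (case n of 0 \<Rightarrow> 0 | Suc k \<Rightarrow> column a k (fst p))" for n
      by (cases n) (simp_all add: column_def)
    have s: "summable (\<lambda>n. column a n (fst p) * snd p ^ n)"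
      by (rule summable_norm_cancel[OF a.bpower_summable(1)[OF p]])
    show ?thesis
      using True suminf_mult[OF s, of "fst p"] shifted_series[OF s]
      by (simp add: bpower_def mult_z1_def mult_z2_def 1 2 mult.assoc)
  qed (auto simp: bpower_def mult_z1_def mult_z2_def)
  then show "bpower (\<lambda>m n. case m of 0 \<Rightarrow> 0 | Suc k \<Rightarrow> a k n) = mult_z1 (bpower a)"
    "bpower (\<lambda>m n. case n of 0 \<Rightarrow> 0 | Suc k \<Rightarrow> a m k) = mult_z2 (bpower a)" by auto
qed

lemma nn_integral_circle_weight:
  assumes "circle_measure \<mu>"
  shows "(\<integral>\<^sup>+\<zeta>. ennreal (weight K * (cmod (\<Sum>k\<le>K. c k * \<zeta> ^ k))\<^sup>2) \<partial>\<mu>)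
    = ennreal (weight K) * (\<integral>\<^sup>+\<zeta>. ennreal ((cmod (\<Sum>k\<le>K. c k * \<zeta> ^ k))\<^sup>2) \<partial>\<mu>)"
proof -
  have sets: "sets \<mu> = sets (restrict_space borel (sphere 0 1))"
    using assms by (simp add: circle_measure_def)
  have "(\<lambda>\<zeta>. ennreal ((cmod (\<Sum>k\<le>K. c k * \<zeta> ^ k))\<^sup>2)) \<in> borel_measurable (borel :: complex measure)"
    by measurable
  then have m: "(\<lambda>\<zeta>. ennreal ((cmod (\<Sum>k\<le>K. c k * \<zeta> ^ k))\<^sup>2)) \<in> borel_measurable \<mu>"
    unfolding measurable_cong_sets[OF sets refl] by (rule measurable_restrict_space1)
  show ?thesis
    unfolding nn_integral_cmult[OF m, symmetric]
    by (intro nn_integral_cong ennreal_mult) (auto intro: less_imp_le weight_pos)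
qed

context shift_pair
begin

lemma energy_bpower:
  assumes a: "bounded_array a B" and \<mu>: "circle_measure \<mu>1" "circle_measure \<mu>2"
    and \<mu>1: "\<And>c K. (\<integral>\<^sup>+\<zeta>. ennreal ((cmod (\<Sum>k\<le>K. c k * \<zeta> ^ k))\<^sup>2) \<partial>\<mu>1) = ennreal (A.defect (\<Sum>k\<le>K. c k *\<^sub>C (T1 ^^ k) e))"
    and \<mu>2: "\<And>c K. (\<integral>\<^sup>+\<zeta>. ennreal ((cmod (\<Sum>k\<le>K. c k * \<zeta> ^ k))\<^sup>2) \<partial>\<mu>2) = ennreal (B.defect (\<Sum>k\<le>K. c k *\<^sub>C (T2 ^^ k) e))"
  shows "hardy_norm_sq (bpower a) + dirichlet_integral \<mu>1 \<mu>2 (bpower a) = energy a"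
proof -
  have part: "(\<Sum>k\<le>K. (of_nat (Suc k) * a (Suc k) n) *\<^sub>C (T1 ^^ k) e) = A.part e (\<lambda>m. a m n) K"
    "(\<Sum>k\<le>K. (of_nat (Suc k) * a m (Suc k)) *\<^sub>C (T2 ^^ k) e) = B.part e (a m) K" for m n K
    by (simp_all only: A.part_def B.part_def)
  show ?thesis
    unfolding bounded_array.hardy_norm_sq_bpower[OF a] dirichlet_integral_bpower[OF a \<mu>] energy_def
      nn_integral_circle_weight[OF \<mu>(1)] nn_integral_circle_weight[OF \<mu>(2)] \<mu>1 \<mu>2 part
    by (simp only: ennreal_mult[OF less_imp_le[OF weight_pos] A.defect_nonneg]
        ennreal_mult[OF less_imp_le[OF weight_pos] B.defect_nonneg] add.assoc)
qed

theorem unitarily_equivalent_dirichlet: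
  "\<exists>\<mu>1 \<mu>2. circle_measure \<mu>1 \<and> circle_measure \<mu>2 \<and>
     (\<exists>U. unitary_onto_dirichlet \<mu>1 \<mu>2 U \<and>
        (\<forall>x. U (T1 x) = mult_z1 (U x)) \<and> (\<forall>x. U (T2 x) = mult_z2 (U x)))"
proof -
  obtain \<mu>1 where \<mu>1': "circle_measure \<mu>1" "\<forall>c K. (\<integral>\<^sup>+\<zeta>. ennreal ((cmod (\<Sum>k\<le>K. c k * \<zeta> ^ k))\<^sup>2) \<partial>\<mu>1)
      = ennreal (A.defect (\<Sum>k\<le>K. c k *\<^sub>C (T1 ^^ k) e))"
    using A.defect_measure[of e] by (elim exE conjE) (rule that, assumption+)
  note \<mu>1 = \<mu>1'(1) \<mu>1'(2)[rule_format]
  obtain \<mu>2 where \<mu>2': "circle_measure \<mu>2" "\<forall>c K. (\<integral>\<^sup>+\<zeta>. ennreal ((cmod (\<Sum>k\<le>K. c k * \<zeta> ^ k))\<^sup>2) \<partial>\<mu>2)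
      = ennreal (B.defect (\<Sum>k\<le>K. c k *\<^sub>C (T2 ^^ k) e))"
    using B.defect_measure[of e] by (elim exE conjE) (rule that, assumption+)
  note \<mu>2 = \<mu>2'(1) \<mu>2'(2)[rule_format]
  note total = energy_bpower[OF _ \<mu>1(1) \<mu>2(1) \<mu>1(2) \<mu>2(2)]
  define U where "U x = bpower (\<lambda>m n. coef m n x)" for x
  have bdd: "bounded_array (\<lambda>m n. coef m n x) (norm x)" for x
    by unfold_locales (rule cmod_coef_le)
  have U_total: "hardy_norm_sq (U x) + dirichlet_integral \<mu>1 \<mu>2 (U x) = ennreal ((norm x)\<^sup>2)" for x
    unfolding U_def total[OF bdd] by (rule energy_coef)
  have U_norm: "dirichlet_norm \<mu>1 \<mu>2 (U x) = norm x" for x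
    unfolding dirichlet_norm_def U_total by simp
  have U_add: "U (x + y) = (\<lambda>p. U x p + U y p)" for x y
    unfolding U_def coef_add by (rule ext) (rule bpower_add[OF bdd bdd])
  have U_scale: "U (c *\<^sub>C x) = (\<lambda>p. c * U x p)" for c x
    unfolding U_def coef_scaleC by (rule ext) (rule bpower_scale[OF bdd])
  have U_in: "U x \<in> dirichlet_space \<mu>1 \<mu>2" for x
  proof -
    have "hardy_norm_sq (U x) + dirichlet_integral \<mu>1 \<mu>2 (U x) < \<infinity>"
      unfolding U_total by simp
    then have "hardy_norm_sq (U x) < \<infinity>" "dirichlet_integral \<mu>1 \<mu>2 (U x) < \<infinity>" by auto
    moreover have "holomorphic_bidisc (U x)"
      unfolding U_def by (rule bounded_array.holomorphic_bpower[OF bdd])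
    moreover have "U x p = 0" if "p \<notin> bidisc" for p
      using that by (simp only: U_def bpower_def if_False)
    ultimately show ?thesis unfolding dirichlet_space_def hardy_space_def by blast
  qed
  have "inj U"
  proof (rule injI)
    fix x y assume eq: "U x = U y"
    \<comment> \<open>Injectivity comes from the isometry: the difference of x and y is mapped to 0
      and therefore has norm 0.\<close>
    have "U (x + (-1) *\<^sub>C y) = (\<lambda>p. 0)" unfolding U_add U_scale eq by simp
    moreover have "U 0 = (\<lambda>p. 0)" using U_scale[of 0 0] by simp
    ultimately have "norm (x + (-1) *\<^sub>C y) = norm (0 :: 'h)" by (simp only: U_norm[symmetric])
    then show "x = y" by (simp add: scaleC_minus1)
  qed
  moreover have "range U = dirichlet_space \<mu>1 \<mu>2"
  proof (intro antisym subsetI)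
    show "f \<in> dirichlet_space \<mu>1 \<mu>2" if "f \<in> range U" for f using that U_in by auto
    fix f assume f: "f \<in> dirichlet_space \<mu>1 \<mu>2"
    then have "f \<in> hardy_space" by (simp add: dirichlet_space_def)
    from hardy_space_eq_bpower[OF this] obtain a B where a: "bounded_array a B" "f = bpower a"
      by (elim exE conjE) (rule that)
    have "energy a < \<infinity>"
      unfolding total[OF a(1), symmetric] a(2)[symmetric]
      using f by (auto simp: dirichlet_space_def hardy_space_def)
    from finite_energy_coef[OF this] obtain x where x: "\<forall>m n. coef m n x = a m n"
      by (elim exE conjE) (rule that)
    have "U x = f" unfolding U_def x[rule_format] a(2) ..
    then show "f \<in> range U" by blast
  qed
  ultimately have "bij_betw U UNIV (dirichlet_space \<mu>1 \<mu>2)" by (simp add: bij_betw_def)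
  then have "unitary_onto_dirichlet \<mu>1 \<mu>2 U"
    unfolding unitary_onto_dirichlet_def using U_add U_scale U_norm by blast
  moreover have "U (T1 x) = mult_z1 (U x)" "U (T2 x) = mult_z2 (U x)" for x
    unfolding U_def coef_T1 coef_T2 bpower_shift[OF bdd] by (rule refl)+
  ultimately show ?thesis using \<mu>1(1) \<mu>2(1) by blast
qed

end

section \<open>From the hypotheses on the pair to the abstract setting\<close>

lemma cadjoint_cinner_left:
  assumes "bounded_clinear T"
  shows "cinner (cadjoint T x) y = cinner x (T y)"
  using cadjoint_cinner[OF assms, of y x] by (subst (1 2) cinner_commute) simp

text \<open>The closed range of \<open>T\<close> has an orthogonal projection, which writes x as T v
  plus a vector orthogonal to the range. Applying the adjoint and injectivity of the adjoint of
  \<open>T\<close> times \<open>T\<close> identifies v with the value of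
  \<open>left_inverse_op\<close>.\<close>

lemma two_isometry_left_inverse_op:
  fixes T :: "'h::chilbert_space \<Rightarrow> 'h"
  assumes T: "left_invertible T"
    and two_iso: "\<And>x. x - cadjoint T (T x) - cadjoint T (T x) + cadjoint T (cadjoint T (T (T x))) = 0"
  shows "two_isometry T (left_inverse_op T)"
proof -
  have bounded: "bounded_clinear T" using T by (simp add: left_invertible_def)
  then have lin: "bounded_linear T" and sc: "\<And>c x. T (c *\<^sub>C x) = c *\<^sub>C T x"
    by (auto simp: bounded_clinear_def)
  obtain S where S: "bounded_linear S" "\<And>x. S (T x) = x"
    using T unfolding left_invertible_def bounded_clinear_def by (metis comp_apply id_apply)
  note adj = cadjoint_cinner_left[OF bounded]
  have diff: "T (x - y) = T x - T y" for x y by (rule linear_diff[OF bounded_linear.linear[OF lin]])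
  have eqI: "x = y" if "\<And>z. cinner (T x - T y) (T z) = 0" for x y
  proof -
    have "cinner (T (x - y)) (T (x - y)) = 0" using that[of "x - y"] by (simp only: diff)
    then have "T (x - y) = T 0" using diff[of 0 0] by (simp add: cinner_eq_zero_iff)
    then have "x - y = 0" using S(2) by metis
    then show ?thesis by simp
  qed
  \<comment> \<open>A bounded left inverse makes the range the fixed point set of the continuous map
    T S, hence closed.\<close>
  have "range T = {y. T (S y) = y}" using S(2) by (auto intro: range_eqI[OF sym])
  moreover have "closed {y. T (S y) = y}"
    by (intro closed_Collect_eq continuous_on_id linear_continuous_on bounded_linear_compose[OF lin S(1)])
  ultimately have closed: "closed (range T)" by simp
  have subspace: "subspace (range T)"
    by (rule linear_subspace_image[OF bounded_linear.linear[OF lin] subspace_UNIV])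
  have ex: "\<exists>v. \<forall>z. cinner (x - T v) (T z) = 0" for x
  proof -
    obtain v where v: "\<And>z. inner (x - T v) (T z) = 0"
      using orthogonal_projection_exists[OF closed subspace, of x] by auto
    have "cinner (x - T v) (T z) = 0" for z
      using v[of z] v[of "\<i> *\<^sub>C z"]
      by (simp add: complex_eq_iff inner_eq_Re_cinner sc cinner_scaleC_right)
    then show ?thesis by blast
  qed
  have "inj (cadjoint T \<circ> T)"
  proof (rule injI)
    fix x y assume "(cadjoint T \<circ> T) x = (cadjoint T \<circ> T) y"
    then have "cinner (T x) (T z) = cinner (T y) (T z)" for z
      using adj[of "T x" z] adj[of "T y" z] by simp
    then show "x = y" by (intro eqI) (simp add: cinner_diff_left)
  qed
  have L: "left_inverse_op T x = v" if v: "\<And>z. cinner (x - T v) (T z) = 0" for x v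
  proof -
    have "cinner (cadjoint T x - cadjoint T (T v)) z = 0" for z
      using v[of z] by (simp add: cinner_diff_left adj)
    then have "cadjoint T x = cadjoint T (T v)" by (metis cinner_eq_zero_iff eq_iff_diff_eq_0)
    then have "left_inverse_op T x = inv (cadjoint T \<circ> T) ((cadjoint T \<circ> T) v)"
      by (simp add: left_inverse_op_def)
    then show ?thesis by (simp only: inv_f_f[OF \<open>inj (cadjoint T \<circ> T)\<close>])
  qed
  show ?thesis
  proof
    fix x y
    show "bounded_clinear T" by (rule bounded)
    have "cinner (x - cadjoint T (T x) - cadjoint T (T x) + cadjoint T (cadjoint T (T (T x)))) y = 0"
      unfolding two_iso by simp
    then show "cinner (T (T x)) (T (T y)) - 2 * cinner (T x) (T y) + cinner x y = 0"
      by (simp add: cinner_add_left cinner_diff_left adj algebra_simps)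
    show "left_inverse_op T (T x) = x" by (rule L) simp
    obtain v where v: "\<And>z. cinner (x - T v) (T z) = 0" using ex by blast
    then show "cinner (x - T (left_inverse_op T x)) (T y) = 0" by (simp only: L[OF v])
  qed
qed

lemma analytic_operator_zero:
  assumes "analytic_operator T" and "\<And>n. \<exists>z. x = (T ^^ n) z"
  shows "x = 0"
proof -
  have "x \<in> (\<Inter>m\<in>{1..}. range (T ^^ m))" using assms(2) by blast
  then show ?thesis using assms(1)[unfolded analytic_operator_def] by (simp only: singleton_iff)
qed

text \<open>A vector orthogonal to both ranges already annihilates every T1^m T2^n x except x
  itself. One scalar condition remains, which is why the common kernel of the adjoints is at most
  one-dimensional.\<close>

lemma orthogonal_to_cyclic_vector:
  assumes dense: "closure (cspan {(T1 ^^ m) ((T2 ^^ n) x) |m n. True}) = UNIV"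
    and w: "\<And>y. cinner w (T1 y) = 0" "\<And>y. cinner w (T2 y) = 0" "cinner w x = 0"
  shows "w = 0"
proof -
  let ?V = "{v. cinner w v = 0}"
  have "(T1 ^^ m) ((T2 ^^ n) x) \<in> ?V" for m n
    using w by (cases m; cases n) auto
  then have "{(T1 ^^ m) ((T2 ^^ n) x) |m n. True} \<subseteq> ?V" by blast
  moreover have "complex_vector.subspace ?V"
    by (auto simp: complex_vector.subspace_def cinner_add_right cinner_scaleC_right)
  ultimately have "cspan {(T1 ^^ m) ((T2 ^^ n) x) |m n. True} \<subseteq> ?V"
    by (rule complex_vector.span_minimal)
  moreover have "closed ?V"
  proof -
    have "?V = {v. cinner v w = 0}" using cinner_commute[of w] cinner_commute[of _ w] by (metis complex_cnj_zero)
    then show ?thesis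
      by (simp only:) (intro closed_Collect_eq linear_continuous_on bounded_linear_cinner_left continuous_on_const)
  qed
  ultimately have "closure (cspan {(T1 ^^ m) ((T2 ^^ n) x) |m n. True}) \<subseteq> ?V"
    by (rule closure_minimal)
  then have "cinner w w = 0" unfolding dense by blast
  then show ?thesis by (simp add: cinner_eq_zero_iff)
qed

theorem theorem2p18:
  fixes T1 T2 :: "'h::chilbert_space \<Rightarrow> 'h"
  assumes nonzero: "\<exists>x::'h. x \<noteq> 0"
    and separable: "separable_space (euclidean :: 'h topology)"
    and bounded: "bounded_clinear T1" "bounded_clinear T2"
    and left_inverse_commuting: "left_inverse_commuting T1 T2"
    and cyclic: "cyclic_pair T1 T2"
    and analytic: "analytic_operator T1" "analytic_operator T2"
    and toral: "toral_2_isometry T1 T2"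
  shows "\<exists>\<mu>1 \<mu>2. circle_measure \<mu>1 \<and> circle_measure \<mu>2 \<and>
           (\<exists>U :: 'h \<Rightarrow> complex \<times> complex \<Rightarrow> complex.
              unitary_onto_dirichlet \<mu>1 \<mu>2 U \<and>
              (\<forall>x. U (T1 x) = mult_z1 (U x)) \<and>
              (\<forall>x. U (T2 x) = mult_z2 (U x)))"
proof -
  define L1 where "L1 = left_inverse_op T1"
  define L2 where "L2 = left_inverse_op T2"
  have inv: "left_invertible T1" "left_invertible T2"
    and comm: "T1 (T2 x) = T2 (T1 x)" "L1 (T2 x) = T2 (L1 x)" "L2 (T1 x) = T1 (L2 x)" for x
    using left_inverse_commuting unfolding left_inverse_commuting_def L1_def L2_def
    by (auto simp: fun_eq_iff)
  have tor: "x - cadjoint A (A x) - cadjoint B (B x) + cadjoint B (cadjoint A (A (B x))) = 0"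
    if "A \<in> {T1, T2}" "B \<in> {T1, T2}" for A B x
    using toral that unfolding toral_2_isometry_def by blast
  interpret A: two_isometry T1 L1
    unfolding L1_def by (rule two_isometry_left_inverse_op[OF inv(1)], rule tor) auto
  interpret B: two_isometry T2 L2
    unfolding L2_def by (rule two_isometry_left_inverse_op[OF inv(2)], rule tor) auto
  interpret commuting_pair T1 L1 T2 L2
  proof
    fix x y
    show "T1 (T2 x) = T2 (T1 x)" "L1 (T2 x) = T2 (L1 x)" "L2 (T1 x) = T1 (L2 x)" by (fact comm)+
    have "cinner (x - cadjoint T1 (T1 x) - cadjoint T2 (T2 x) + cadjoint T2 (cadjoint T1 (T1 (T2 x)))) y = 0"
      by (subst tor) auto
    then show "cinner (T1 (T2 x)) (T1 (T2 y)) - cinner (T1 x) (T1 y) - cinner (T2 x) (T2 y) + cinner x y = 0"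
      by (simp add: cinner_add_left cinner_diff_left cadjoint_cinner_left[OF bounded(1)]
          cadjoint_cinner_left[OF bounded(2)] algebra_simps)
  qed (use analytic_operator_zero[OF analytic(1)] analytic_operator_zero[OF analytic(2)] in blast)+
  obtain x0 where dense: "closure (cspan {(T1 ^^ m) ((T2 ^^ n) x0) |m n. True}) = UNIV"
    using cyclic unfolding cyclic_pair_def by blast
  \<comment> \<open>Some double projection of a nonzero vector is nonzero, since otherwise
    analyticity would force that vector to be 0; it lies in the common kernel.\<close>
  obtain w where w: "w \<noteq> 0" "\<And>y. cinner w (T1 y) = 0" "\<And>y. cinner w (T2 y) = 0"
  proof -
    obtain x :: 'h where "x \<noteq> 0" using nonzero by blast
    then obtain m n where "P2 ((L2 ^^ n) (P1 ((L1 ^^ m) x))) \<noteq> 0"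
      using eq_zero_if_projections_zero by blast
    then show ?thesis
      unfolding double_projection_commute by (rule that) (rule P2_P1_orthogonal)+
  qed
  define e where "e = of_real (1 / norm w) *\<^sub>C w"
  have e: "norm e = 1" "cinner e (T1 y) = 0" "cinner e (T2 y) = 0" for y
    using w by (simp_all add: e_def norm_scaleC norm_divide cinner_scaleC_left)
  have e_x0: "cinner e x0 \<noteq> 0"
    using orthogonal_to_cyclic_vector[OF dense, of e] e by auto
  interpret shift_pair T1 L1 T2 L2 e
  proof
    show "norm e = 1" "cinner e (T1 y) = 0" "cinner e (T2 y) = 0" for y by (fact e)+
    fix v assume v: "\<And>y. cinner v (T1 y) = 0" "\<And>y. cinner v (T2 y) = 0"
    \<comment> \<open>The multiple of \<open>e\<close> is chosen so that the difference annihilates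
      the cyclic vector; the denominator is nonzero because \<open>e\<close> is.\<close>
    have "v - (cinner v x0 / cinner e x0) *\<^sub>C e = 0"
    proof (rule orthogonal_to_cyclic_vector[OF dense])
      show "cinner (v - (cinner v x0 / cinner e x0) *\<^sub>C e) (T1 y) = 0"
        "cinner (v - (cinner v x0 / cinner e x0) *\<^sub>C e) (T2 y) = 0" for y
        by (simp_all only: cinner_diff_left cinner_scaleC_left e v mult_zero_right diff_self)
      show "cinner (v - (cinner v x0 / cinner e x0) *\<^sub>C e) x0 = 0"
        using e_x0 by (simp add: cinner_diff_left cinner_scaleC_left)
    qed
    then have "v = (cinner v x0 / cinner e x0) *\<^sub>C e" by simp
    then show "\<exists>c. v = c *\<^sub>C e" by (rule exI)
  qed
  show ?thesis by (rule unitarily_equivalent_dirichlet)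
qed

end
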